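(* Let $(X,Y),(X_1,Y_1),\dots,(X_n,Y_n)$ be i.i.d. random pairs in $\mathbb R^d\times\mathbb R$ with $\mathbb E\|X\|^2<+\infty$ and $\mathbb E[Y^2]<+\infty$. Assume that $\Sigma=\mathbb E[XX^\top]$ is invertible and $\widehat\Sigma_n=\frac1n\sum_{i=1}^nX_iX_i^\top$ is invertible almost surely. Assume moreover: (i) there exist $C\ge1$ and $\alpha\in(0,1)$ such that for every hyperplane $H\subset\mathbb R^d$ and every $t>0$, $\mathbb P\big(\operatorname{dist}(\Sigma^{-1/2}X,H)\le t\big)\le(Ct)^\alpha$; (ii) $\mathbb E\|\Sigma^{-1/2}X\|^4\le\kappa d^2$ for some $\kappa\ge1$. Let $\widetilde f_n(\cdot\mid x)=\mathcal N\big(\langle\widehat\theta_n,x\rangle,(1+\langle(n\widehat\Sigma_n)^{-1}x,x\rangle)^2\big)$, where $\widehat\theta_n=\widehat\Sigma_n^{-1}\big(\frac1n\sum_{i=1}^nY_iX_i\big)$. Then, with $C'=28\,C^4e^{1+9/\alpha}$, for every $n\ge\max\big(6d/\alpha,\ 12\log(12/\alpha)/\alpha\big)$, $$\mathbb E\big[\mathcal E(\widetilde f_n)\big]\le\frac dn\Big(1+C'\,\frac{\kappa d}{n}\Big).$$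
   Context: The comparison class is the Gaussian linear family $\mathcal F=\{f_\theta(\cdot\mid x)=\mathcal N(\langle\theta,x\rangle,1):\theta\in\mathbb R^d\}$. For a conditional density $g(y\mid x)$ (with respect to $\mu(dy)=(2\pi)^{-1/2}dy$ on $\mathbb R$), the risk is $\mathcal R(g)=\mathbb E[-\log g(Y\mid X)]$ and $\mathcal E(g)=\mathcal R(g)-\inf_{\theta\in\mathbb R^d}\mathcal R(f_\theta)$; $\mathbb E[\mathcal E(\widetilde f_n)]$ is the expectation over the sample. "Hyperplane" means linear hyperplane (through the origin), and $\operatorname{dist}$ is the Euclidean distance; condition (i) is equivalent to $\mathbb P(|\langle\theta,X\rangle|\le t\,\langle\Sigma\theta,\theta\rangle^{1/2})\le(Ct)^\alpha$ for all $\theta\in\mathbb R^d\setminus\{0\}$ and $t>0$. *)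

theory Defs
  imports "HOL-Analysis.Analysis" "HOL-Probability.Probability"
begin

definition outer_square :: "real ^ 'd \<Rightarrow> real ^ 'd ^ 'd" where
  "outer_square x = (columnvector x :: real ^ 1 ^ 'd) ** (rowvector x :: real ^ 'd ^ 1)"

definition second_moment :: "'a measure \<Rightarrow> ('a \<Rightarrow> real ^ 'd) \<Rightarrow> real ^ 'd ^ 'd" where
  "second_moment M X = (\<integral>\<omega>. outer_square (X \<omega>) \<partial>M)"

definition pos_semidef :: "real ^ 'd ^ 'd \<Rightarrow> bool" where
  "pos_semidef A \<longleftrightarrow> transpose A = A \<and> (\<forall>v. 0 \<le> (A *v v) \<bullet> v)"

text \<open>The symmetric positive semidefinite square root; it exists and is unique for every
  positive semidefinite argument, and is unspecified otherwise.\<close>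
definition matrix_sqrt :: "real ^ 'd ^ 'd \<Rightarrow> real ^ 'd ^ 'd" where
  "matrix_sqrt A = (THE S. pos_semidef S \<and> S ** S = A)"

definition matrix_inv_sqrt :: "real ^ 'd ^ 'd \<Rightarrow> real ^ 'd ^ 'd" where
  "matrix_inv_sqrt A = matrix_inv (matrix_sqrt A)"

definition linear_hyperplane :: "(real ^ 'd) set \<Rightarrow> bool" where
  "linear_hyperplane H \<longleftrightarrow> subspace H \<and> dim H = CARD('d) - 1"

text \<open>Density at \<open>y\<close> of the normal law with mean \<open>m\<close> and variance \<open>v\<close>. The dominating measure is
  \<open>(2 * pi) powr (- 1 / 2)\<close> times Lebesgue measure, hence the factor \<open>sqrt (2 * pi)\<close>; the second
  argument of \<^const>\<open>normal_density\<close> is the standard deviation.\<close>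
definition gaussian_density :: "real \<Rightarrow> real \<Rightarrow> real \<Rightarrow> real" where
  "gaussian_density m v y = sqrt (2 * pi) * normal_density m (sqrt v) y"

text \<open>A conditional density \<open>g(y | x)\<close> is represented by the curried function \<open>g x y\<close>.\<close>

definition linear_model :: "real ^ 'd \<Rightarrow> real ^ 'd \<Rightarrow> real \<Rightarrow> real" where
  "linear_model \<theta> x y = gaussian_density (\<theta> \<bullet> x) 1 y"

definition log_loss :: "(real ^ 'd \<Rightarrow> real \<Rightarrow> real) \<Rightarrow> real ^ 'd \<Rightarrow> real \<Rightarrow> real" where
  "log_loss g x y = - ln (g x y)"

text \<open>The risk is meaningful for \<open>g\<close> that are positive and whose loss is integrable, as the
  logarithm and the Bochner integral default to 0 otherwise.\<close>
definition risk ::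
  "'a measure \<Rightarrow> ('a \<Rightarrow> real ^ 'd) \<Rightarrow> ('a \<Rightarrow> real) \<Rightarrow> (real ^ 'd \<Rightarrow> real \<Rightarrow> real) \<Rightarrow> real" where
  "risk M X Y g = (\<integral>\<omega>. log_loss g (X \<omega>) (Y \<omega>) \<partial>M)"

definition excess_risk ::
  "'a measure \<Rightarrow> ('a \<Rightarrow> real ^ 'd) \<Rightarrow> ('a \<Rightarrow> real) \<Rightarrow> (real ^ 'd \<Rightarrow> real \<Rightarrow> real) \<Rightarrow> real" where
  "excess_risk M X Y g = risk M X Y g - (INF \<theta>. risk M X Y (linear_model \<theta>))"

text \<open>A sample of size \<open>n\<close> is given by \<open>(xs i, ys i)\<close> for \<open>i \<in> {1..n}\<close>.\<close>

definition empirical_second_moment :: "nat \<Rightarrow> (nat \<Rightarrow> real ^ 'd) \<Rightarrow> real ^ 'd ^ 'd" where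
  "empirical_second_moment n xs = (1 / real n) *\<^sub>R (\<Sum>i=1..n. outer_square (xs i))"

definition least_squares :: "nat \<Rightarrow> (nat \<Rightarrow> real ^ 'd) \<Rightarrow> (nat \<Rightarrow> real) \<Rightarrow> real ^ 'd" where
  "least_squares n xs ys =
     matrix_inv (empirical_second_moment n xs) *v ((1 / real n) *\<^sub>R (\<Sum>i=1..n. ys i *\<^sub>R xs i))"

definition smp :: "nat \<Rightarrow> (nat \<Rightarrow> real ^ 'd) \<Rightarrow> (nat \<Rightarrow> real) \<Rightarrow> real ^ 'd \<Rightarrow> real \<Rightarrow> real" where
  "smp n xs ys x y =
     gaussian_density (least_squares n xs ys \<bullet> x)
       ((1 + (matrix_inv (real n *\<^sub>R empirical_second_moment n xs) *v x) \<bullet> x)\<^sup>2) y"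

end

theory Submission
  imports Defs "HOL-Real_Asymp.Real_Asymp"
begin

text \<open>
  Let \<open>u\<close> be the leverage \<open>\<langle>(n \<Sigma>\<^sub>n)\<inverse> X, X\<rangle>\<close> of the test point. Adding that point to the sample
  turns \<open>u\<close> into \<open>u / (1 + u)\<close> and divides its least squares residual by \<open>1 + u\<close>. Hence, by
  exchangeability of the \<open>n + 1\<close> points, \<open>E (u / (1 + u)) = d / (n + 1)\<close>, and the squared residual
  term of the predictor's risk is at most that of any fixed \<open>\<theta>\<close>. The expected excess risk is thus
  at most \<open>E (ln (1 + u)) \<le> d / n + E (min u\<^sup>2 u)\<close>, and it remains to bound \<open>E u\<^sup>2\<close>.

  For whitened \<open>X\<close> with Gram matrix \<open>A\<close>, integrate \<open>\<bar>\<theta> \<bullet> x\<bar> powr m\<close> over the ellipsoid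
  \<open>\<langle>A \<theta>, \<theta>\<rangle> \<le> \<alpha> n\<close>. The integral is at least of order \<open>u powr (m / 2) * tr A powr (- d / 2)\<close>, while its
  expectation is controlled by the small ball condition, through the Laplace transform of
  \<open>\<langle>A \<theta>, \<theta>\<rangle>\<close> at each fixed \<open>\<theta>\<close>. With \<open>m\<close> proportional to \<open>\<alpha> n\<close>, the trace factor is removed by
  the weighted AM-GM inequality and \<open>E (tr A) = n d\<close>. The resulting bound on \<open>E u\<^sup>2\<close> involves
  \<open>C powr (4 + 6 d / (\<alpha> n))\<close> instead of \<open>C ^ 4\<close>; the excess is absorbed by \<open>exp (9 / \<alpha>)\<close> when
  \<open>C\<^sup>2 d \<le> n\<close>, and otherwise \<open>min u\<^sup>2 u \<le> u\<close> is used.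
\<close>

subsection \<open>Diagonalization and square roots of symmetric matrices\<close>

text \<open>The obstacle: the small ball condition is pointwise in the direction, while
  \<open>u\<close> involves the inverse of a random matrix, hence all directions at once. A union
  bound over a net would need high-probability control of the largest eigenvalue, which is out of
  reach with so few moments. Averaging over an ellipsoid replaces the net: only its volume enters,
  and this is bounded below through the trace, whose mean is known. With
  \<open>p = \<alpha> * n\<close>, a fixed \<open>\<theta>\<close> belongs to the random ellipsoid
  with probability of order \<open>norm \<theta> powr (- p)\<close>. The moment uses up
  \<open>m = 2 * p / 3\<close> of these powers, and the remaining \<open>k = p / 3\<close> must be
  at least \<open>d + 1\<close> for integrability over the space. The final inequality has the
  exponents \<open>2 / k\<close> and \<open>d / k\<close>, whose sum must be at most 1. Both
  demands, and the absolute constants, are met by \<open>p \<ge> 6 * d\<close> and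
  \<open>p \<ge> 24\<close>; the latter is what the logarithmic condition on \<open>n\<close>
  supplies. A power of order \<open>p\<close> of the leverage costs factors exponential in
  \<open>p\<close> and \<open>d\<close>. They are harmless because \<open>u\<^sup>2\<close> is
  recovered by raising to the power \<open>2 / k = 6 / p\<close>.\<close>

lemma symmetric_matrix_inner:
  fixes A :: "real^'n^'n"
  assumes "transpose A = A"
  shows "(A *v x) \<bullet> y = x \<bullet> (A *v y)"
  by (metis assms dot_lmul_matrix transpose_matrix_vector inner_commute)

text \<open>Rayleigh quotient: with \<open>a\<close> the maximum of the form on the unit sphere of
  \<open>V\<close>, the form \<open>a * (y \<bullet> y) - f y \<bullet> y\<close> is nonnegative on
  \<open>V\<close> and vanishes at the maximizer, so its derivative vanishes there too. The
  maximality clause serves the uniqueness of square roots.\<close>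

lemma self_adjoint_has_max_eigenvector:
  fixes f :: "'a::euclidean_space \<Rightarrow> 'a"
  assumes lin: "linear f" and adj: "\<And>x y. f x \<bullet> y = x \<bullet> f y"
    and V: "subspace V" "\<And>x. x \<in> V \<Longrightarrow> f x \<in> V" "V \<noteq> {0}"
  obtains x a where "x \<in> V" "norm x = 1" "f x = a *\<^sub>R x" "\<And>y. y \<in> V \<Longrightarrow> f y \<bullet> y \<le> a * (y \<bullet> y)"
proof -
  interpret linear f by (rule lin)
  have "0 \<in> V" using V(1) by (rule subspace_0)
  then obtain z where z: "z \<in> V" "z \<noteq> 0" using V(3) by auto
  let ?S = "V \<inter> sphere 0 1"
  have "(1 / norm z) *\<^sub>R z \<in> ?S" using z V(1) by (auto intro: subspace_scale)
  then have ne: "?S \<noteq> {}" by blast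
  have comp: "compact ?S" using V(1) by (intro closed_Int_compact closed_subspace compact_sphere)
  have cont: "continuous_on ?S (\<lambda>x. f x \<bullet> x)"
    by (intro continuous_intros linear_continuous_on linear_conv_bounded_linear[THEN iffD1] lin)
  obtain x where x: "x \<in> ?S" and max: "\<And>y. y \<in> ?S \<Longrightarrow> f y \<bullet> y \<le> f x \<bullet> x"
    using continuous_attains_sup[OF comp ne cont] by auto
  define a where "a = f x \<bullet> x"
  have xx: "x \<bullet> x = 1" and nx: "norm x = 1" and xV: "x \<in> V" using x by (auto simp: dot_square_norm)
  have fxx: "x \<bullet> f x = a" by (simp add: a_def inner_commute)
  have le: "f y \<bullet> y \<le> a * (y \<bullet> y)" if "y \<in> V" for y
  proof (cases "y = 0")
    case False
    have "(1 / norm y) *\<^sub>R y \<in> ?S" using that False V(1) by (auto intro: subspace_scale)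
    from max[OF this] have "f y \<bullet> y / (norm y * norm y) \<le> a"
      by (simp add: scale a_def)
    then show ?thesis using False by (simp add: divide_simps dot_square_norm power2_eq_square)
  qed (simp add: zero)
  have orth: "a * (x \<bullet> y) - f x \<bullet> y = 0" if y: "y \<in> V" for y
  proof (rule ccontr)
    define c where "c = a * (x \<bullet> y) - f x \<bullet> y"
    define q where "q = a * (y \<bullet> y) - f y \<bullet> y"
    assume "a * (x \<bullet> y) - f x \<bullet> y \<noteq> 0"
    then have c: "c \<noteq> 0" by (simp add: c_def)
    have q: "q \<ge> 0" using le[OF y] by (simp add: q_def)
    have pos: "0 \<le> 2 * t * c + t^2 * q" for t
    proof -
      have "x + t *\<^sub>R y \<in> V" using xV y V(1) by (auto intro: subspace_add subspace_scale)
      from le[OF this] show ?thesis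
        using adj[of y x] by (simp add: add scale inner_add_left inner_add_right xx fxx c_def q_def
             inner_commute power2_eq_square algebra_simps)
    qed
    \<comment> \<open>A small \<open>t\<close> of sign opposite to \<open>c\<close> makes the linear
      term win; this one gives exactly \<open>- (t\<^sup>2 * (2 + q))\<close> and is defined even
      for \<open>q = 0\<close>.\<close>
    define t where "t = - c / (1 + q)"
    have ct: "c = - t * (1 + q)" using q by (simp add: t_def)
    have t: "t \<noteq> 0" using c q by (auto simp: t_def)
    have "0 \<le> 2 * t * c + t^2 * q" by (rule pos)
    also have "\<dots> = - (t^2 * (2 + q))"
      by (simp add: ct power2_eq_square algebra_simps)
    also have "\<dots> < 0" using t q by (simp add: mult_pos_pos)
    finally show False by simp
  qed
  have "a *\<^sub>R x - f x \<in> V" using xV V(1,2) by (auto intro: subspace_diff subspace_scale)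
  from orth[OF this] have "(a *\<^sub>R x - f x) \<bullet> (a *\<^sub>R x - f x) = 0"
    by (simp add: inner_diff_left)
  then have "f x = a *\<^sub>R x" by simp
  with xV nx le show thesis by (intro that) auto
qed

text \<open>Induction on the dimension, splitting off one eigenvector at a time: by self-adjointness
  its orthogonal complement in \<open>V\<close> is again invariant.\<close>

lemma self_adjoint_eigenvectors_span:
  fixes f :: "'a::euclidean_space \<Rightarrow> 'a"
  assumes lin: "linear f" and adj: "\<And>x y. f x \<bullet> y = x \<bullet> f y"
    and "subspace V" "\<And>x. x \<in> V \<Longrightarrow> f x \<in> V"
  shows "\<exists>B. B \<subseteq> V \<and> pairwise orthogonal B \<and> (\<forall>b\<in>B. norm b = 1 \<and> (\<exists>a. f b = a *\<^sub>R b)) \<and> V \<subseteq> span B"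
  using assms(3,4)
proof (induction "dim V" arbitrary: V rule: less_induct)
  case less
  show ?case
  proof (cases "V = {0}")
    case True
    then show ?thesis by (intro exI[of _ "{}"]) auto
  next
    case False
    from self_adjoint_has_max_eigenvector[OF lin adj less.prems False]
    obtain x a where x: "x \<in> V" "norm x = 1" "f x = a *\<^sub>R x" by metis
    define W where "W = {y \<in> V. x \<bullet> y = 0}"
    have xx: "x \<bullet> x = 1" using x by (simp add: dot_square_norm)
    have W: "subspace W"
      using less.prems(1) unfolding W_def by (auto simp: subspace_def inner_add_right)
    have WV: "W \<subseteq> V" by (auto simp: W_def)
    have fW: "f y \<in> W" if "y \<in> W" for y
      using that less.prems(2) adj[of x y] x by (auto simp: W_def)
    have "x \<notin> W" using xx by (simp add: W_def)
    then have "W \<subset> V" using WV x by auto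
    then have "dim W < dim V"
      using W less.prems(1) by (intro dim_psubset) (simp add: span_eq_iff[THEN iffD2])
    from less.hyps[OF this W fW] obtain B where B: "B \<subseteq> W" "pairwise orthogonal B"
      "\<forall>b\<in>B. norm b = 1 \<and> (\<exists>a. f b = a *\<^sub>R b)" "W \<subseteq> span B" by blast
    have "V \<subseteq> span (insert x B)"
    proof
      fix y assume y: "y \<in> V"
      have "y - (x \<bullet> y) *\<^sub>R x \<in> W"
        using y x xx less.prems(1) by (auto simp: W_def inner_diff_right intro: subspace_diff subspace_scale)
      then have "y - (x \<bullet> y) *\<^sub>R x \<in> span (insert x B)"
        using B(4) span_mono[of B "insert x B"] by blast
      moreover have "(x \<bullet> y) *\<^sub>R x \<in> span (insert x B)" by (intro span_scale span_base) simp
      ultimately have "(y - (x \<bullet> y) *\<^sub>R x) + (x \<bullet> y) *\<^sub>R x \<in> span (insert x B)" by (rule span_add)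
      then show "y \<in> span (insert x B)" by simp
    qed
    moreover have "pairwise orthogonal (insert x B)"
      using B(1,2) by (auto simp: pairwise_insert orthogonal_def W_def inner_commute)
    ultimately show ?thesis using B(1,3) WV x by (intro exI[of _ "insert x B"]) auto
  qed
qed

abbreviation diag :: "('n \<Rightarrow> real) \<Rightarrow> real^'n^'n" where
  "diag a \<equiv> (\<chi> i j. if i = j then a i else 0)"

lemma diag_mult: "diag a ** diag b = diag (\<lambda>i. a i * b i)"
  by (simp add: vec_eq_iff matrix_matrix_mult_def if_distrib [of "\<lambda>x. _ * x"] if_distrib [of "\<lambda>x. x * _"]
       cong: if_cong)

lemma diag_mult_vec: "diag a *v x = (\<chi> i. a i * x $ i)"
  by (simp add: vec_eq_iff matrix_vector_mult_def if_distrib [of "\<lambda>x. x * _"] cong: if_cong)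

lemma transpose_diag [simp]: "transpose (diag a) = diag a"
  by (simp add: vec_eq_iff transpose_def)

lemma symmetric_matrix_diagonalizable:
  fixes A :: "real^'n^'n"
  assumes A: "transpose A = A"
  obtains Q a where "orthogonal_matrix Q" "A = Q ** diag a ** transpose Q"
proof -
  have "\<exists>B. B \<subseteq> UNIV \<and> pairwise orthogonal B \<and>
      (\<forall>b\<in>B. norm b = 1 \<and> (\<exists>a. A *v b = a *\<^sub>R b)) \<and> UNIV \<subseteq> span B"
    by (rule self_adjoint_eigenvectors_span)
       (auto simp: symmetric_matrix_inner[OF A] matrix_vector_mul_linear)
  then obtain B where B: "pairwise orthogonal B" "\<And>b. b \<in> B \<Longrightarrow> norm b = 1"
    "\<And>b. b \<in> B \<Longrightarrow> \<exists>a. A *v b = a *\<^sub>R b" "span B = UNIV" by auto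
  have "independent B"
    using B(1,2) by (intro pairwise_orthogonal_independent) (force simp: )+
  then have "finite B" "card B = dim (UNIV :: (real^'n) set)"
    using independent_imp_finite B(4) dim_eq_card_independent[of B] dim_span[of B] by auto
  then have "card B = card (UNIV :: 'n set)" by simp
  then obtain e :: "'n \<Rightarrow> real^'n" where e: "bij_betw e UNIV B"
    using \<open>finite B\<close> finite_same_card_bij[of "UNIV :: 'n set" B] by auto
  then have eB: "e i \<in> B" for i by (auto simp: bij_betw_def)
  obtain a where a: "\<And>i. A *v e i = a i *\<^sub>R e i" using B(3)[OF eB] by metis
  have ee: "e i \<bullet> e j = (if i = j then 1 else 0)" for i j
  proof (cases "i = j")
    case False
    then have "e i \<noteq> e j" using e by (auto simp: bij_betw_def inj_on_def)
    then show ?thesis using False B(1) eB by (auto simp: pairwise_def orthogonal_def)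
  qed (use B(2)[OF eB] in \<open>simp add: dot_square_norm\<close>)
  define Q :: "real^'n^'n" where "Q = (\<chi> i j. e j $ i)"
  have "transpose Q ** Q = mat 1"
    by (simp add: vec_eq_iff Q_def matrix_matrix_mult_def transpose_def mat_def ee[unfolded inner_vec_def inner_real_def])
  then have Q: "orthogonal_matrix Q" by (simp add: orthogonal_matrix)
  have "(A *v e j) $ i = a j * e j $ i" for i j by (simp add: a)
  then have "A ** Q = Q ** diag a"
    by (simp add: vec_eq_iff matrix_matrix_mult_def Q_def matrix_vector_mult_def
        if_distrib [of "\<lambda>x. _ * x"] mult.commute cong: if_cong)
  then have "A = Q ** diag a ** transpose Q"
    using Q by (metis matrix_mul_assoc matrix_mul_rid orthogonal_matrix_def)
  with Q show thesis by (rule that)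
qed

lemma orthogonal_matrix_inner:
  fixes Q :: "real^'n^'n"
  assumes "orthogonal_matrix Q"
  shows "(Q *v x) \<bullet> (Q *v y) = x \<bullet> y"
proof -
  have "orthogonal_transformation ((*v) Q)"
    using assms by (simp add: orthogonal_transformation_matrix matrix_vector_mul_linear)
  then show ?thesis by (simp add: orthogonal_transformation_def)
qed

lemma pos_semidef_diagonalization:
  fixes A :: "real^'n^'n"
  assumes A: "pos_semidef A"
  obtains Q a where "orthogonal_matrix Q" "A = Q ** diag a ** transpose Q" "\<forall>i. 0 \<le> a i"
proof -
  from A have "transpose A = A" by (simp add: pos_semidef_def)
  then obtain Q a where Q: "orthogonal_matrix Q" and AQ: "A = Q ** diag a ** transpose Q"
    by (rule symmetric_matrix_diagonalizable)
  have QQ: "transpose Q ** Q = mat 1" using Q by (simp add: orthogonal_matrix_def)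
  have "0 \<le> a i" for i
  proof -
    let ?v = "Q *v axis i 1"
    have "A *v ?v = Q *v (diag a *v ((transpose Q ** Q) *v axis i 1))"
      unfolding AQ by (simp only: matrix_vector_mul_assoc matrix_mul_assoc)
    also have "\<dots> = Q *v (diag a *v axis i 1)" by (simp add: QQ)
    finally have "(A *v ?v) \<bullet> ?v = (diag a *v axis i 1) \<bullet> axis i 1"
      by (simp only: orthogonal_matrix_inner[OF Q])
    also have "\<dots> = a i" by (simp add: diag_mult_vec inner_axis)
    finally show ?thesis using A unfolding pos_semidef_def by metis
  qed
  then have "\<forall>i. 0 \<le> a i" ..
  with Q AQ show thesis by (rule that)
qed

lemma pos_semidef_sqrt_exists:
  fixes A :: "real^'n^'n"
  assumes A: "pos_semidef A"
  obtains S where "pos_semidef S" "S ** S = A"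
proof -
  from A obtain Q a where Q: "orthogonal_matrix Q" and AQ: "A = Q ** diag a ** transpose Q"
    and a: "\<forall>i. 0 \<le> a i" by (rule pos_semidef_diagonalization)
  have QQ: "transpose Q ** Q = mat 1" using Q by (simp add: orthogonal_matrix_def)
  define b where "b = (\<lambda>i. sqrt (a i))"
  define S where "S = Q ** diag b ** transpose Q"
  have "S ** S = Q ** (diag b ** (transpose Q ** Q) ** diag b) ** transpose Q"
    by (simp add: S_def matrix_mul_assoc)
  also have "\<dots> = Q ** diag (\<lambda>i. b i * b i) ** transpose Q" by (simp add: QQ diag_mult)
  also have "(\<lambda>i. b i * b i) = a" using a by (simp add: b_def fun_eq_iff)
  also have "Q ** diag a ** transpose Q = A" by (rule AQ[symmetric])
  finally have SS: "S ** S = A" .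
  have "transpose S = S" by (simp add: S_def matrix_transpose_mul matrix_mul_assoc)
  moreover have "0 \<le> (S *v v) \<bullet> v" for v
  proof -
    define w where "w = transpose Q *v v"
    have "S *v v = Q *v (diag b *v w)"
      by (simp only: S_def w_def matrix_vector_mul_assoc matrix_mul_assoc)
    moreover have "v = Q *v w"
      using Q by (simp only: w_def matrix_vector_mul_assoc orthogonal_matrix_def matrix_vector_mul_lid)
    ultimately have "(S *v v) \<bullet> v = (diag b *v w) \<bullet> w"
      by (simp only: orthogonal_matrix_inner[OF Q])
    also have "\<dots> \<ge> 0"
      by (simp add: diag_mult_vec inner_vec_def b_def mult.assoc a sum_nonneg)
    finally show ?thesis .
  qed
  ultimately have "pos_semidef S" by (simp add: pos_semidef_def)
  with SS show thesis by (intro that)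
qed

text \<open>With a root \<open>R\<close> of \<open>S\<close>, the form is the squared norm of
  \<open>R *v x\<close>. This gives both the uniqueness of roots and the criterion for
  invertibility.\<close>

lemma pos_semidef_form_zero:
  assumes "pos_semidef S" "(S *v x) \<bullet> x = 0"
  shows "S *v x = 0"
proof -
  obtain R where R: "pos_semidef R" "R ** R = S" using pos_semidef_sqrt_exists[OF assms(1)] by metis
  then have "(R *v x) \<bullet> (R *v x) = 0"
    using assms(2) symmetric_matrix_inner[of R "R *v x" x]
    by (auto simp: pos_semidef_def matrix_vector_mul_assoc)
  then have "R *v x = 0" by simp
  then show ?thesis using R(2) by (metis matrix_vector_mul_assoc matrix_vector_mult_0_right)
qed

text \<open>A maximal eigenvalue \<open>a\<close> of \<open>S - T\<close>, with unit eigenvector \<open>x\<close>, satisfies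
  \<open>0 = |S x|\<^sup>2 - |T x|\<^sup>2 = a * (x \<bullet> (S + T) x)\<close>, hence vanishes.\<close>

lemma pos_semidef_sqrt_diff_le:
  fixes S T :: "real^'n^'n"
  assumes S: "pos_semidef S" and T: "pos_semidef T" and eq: "S ** S = T ** T"
  shows "(S *v y) \<bullet> y \<le> (T *v y) \<bullet> y"
proof -
  have adj: "(S *v x) \<bullet> y = x \<bullet> (S *v y)" "(T *v x) \<bullet> y = x \<bullet> (T *v y)" for x y
    using S T by (auto simp: pos_semidef_def intro: symmetric_matrix_inner)
  have lin: "linear ((*v) (S - T))" by (rule matrix_vector_mul_linear)
  have sd: "((S - T) *v x) \<bullet> y = x \<bullet> ((S - T) *v y)" for x y
    by (simp add: matrix_vector_mult_diff_rdistrib inner_diff_left inner_diff_right adj)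
  have "axis undefined 1 \<noteq> (0 :: real^'n)" by (simp add: axis_eq_0_iff)
  then have "(UNIV :: (real^'n) set) \<noteq> {0}" by (metis UNIV_I singletonD)
  from self_adjoint_has_max_eigenvector[OF lin sd subspace_UNIV UNIV_I this]
  obtain x a where x: "norm x = 1" and ev: "(S - T) *v x = a *\<^sub>R x"
    and max: "\<And>y. ((S - T) *v y) \<bullet> y \<le> a * (y \<bullet> y)" by (metis UNIV_I)
  have STx: "S *v x = T *v x + a *\<^sub>R x" using ev by (simp add: matrix_vector_mult_diff_rdistrib algebra_simps)
  have "(S *v x) \<bullet> (S *v x) = (T *v x) \<bullet> (T *v x)"
    using eq by (metis adj matrix_vector_mul_assoc)
  then have "a * ((S *v x) \<bullet> x + (T *v x) \<bullet> x) = 0"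
    unfolding STx by (simp add: inner_add_left inner_add_right inner_commute algebra_simps)
  moreover have "(S *v x) \<bullet> x \<ge> 0" "(T *v x) \<bullet> x \<ge> 0" using S T by (auto simp: pos_semidef_def)
  ultimately have "a = 0 \<or> ((S *v x) \<bullet> x = 0 \<and> (T *v x) \<bullet> x = 0)" by auto
  then have "a = 0"
    using pos_semidef_form_zero[OF S, of x] pos_semidef_form_zero[OF T, of x] STx x by (metis add_cancel_right_left
        norm_zero scaleR_eq_0_iff zero_neq_one)
  with max[of y] show ?thesis by (simp add: matrix_vector_mult_diff_rdistrib inner_diff_left)
qed

text \<open>Polarization; symmetry makes the two cross terms equal.\<close>

lemma symmetric_form_zero_imp_zero:
  fixes D :: "real^'n^'n"
  assumes D: "transpose D = D" and z: "\<And>y. (D *v y) \<bullet> y = 0"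
  shows "D = 0"
proof -
  have "(D *v x) \<bullet> y = 0" for x y
    using z[of "x + y"] z[of x] z[of y] symmetric_matrix_inner[OF D, of y x]
    by (simp add: matrix_vector_right_distrib inner_add_left inner_add_right inner_commute)
  then have "D *v x = 0" for x by (metis inner_eq_zero_iff)
  then show ?thesis by (simp add: matrix_eq)
qed

lemma pos_semidef_sqrt_unique:
  fixes S T :: "real^'n^'n"
  assumes S: "pos_semidef S" and T: "pos_semidef T" and eq: "S ** S = T ** T"
  shows "S = T"
proof -
  have "S - T = 0"
  proof (rule symmetric_form_zero_imp_zero)
    show "transpose (S - T) = S - T"
      using S T by (simp add: pos_semidef_def transpose_def vec_eq_iff)
    show "((S - T) *v y) \<bullet> y = 0" for y
      using pos_semidef_sqrt_diff_le[OF S T eq, of y] pos_semidef_sqrt_diff_le[OF T S eq[symmetric], of y]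
      by (simp add: matrix_vector_mult_diff_rdistrib inner_diff_left)
  qed
  then show ?thesis by simp
qed

text \<open>Existence and uniqueness of the root make the definite description in
  \<open>matrix_sqrt\<close> meaningful.\<close>

lemma matrix_sqrt:
  assumes "pos_semidef A"
  shows pos_semidef_matrix_sqrt: "pos_semidef (matrix_sqrt A)"
    and matrix_sqrt_square: "matrix_sqrt A ** matrix_sqrt A = A"
proof -
  have "\<exists>!S. pos_semidef S \<and> S ** S = A"
    using pos_semidef_sqrt_exists[OF assms] pos_semidef_sqrt_unique by metis
  from theI'[OF this] show "pos_semidef (matrix_sqrt A)" "matrix_sqrt A ** matrix_sqrt A = A"
    by (auto simp: matrix_sqrt_def)
qed

text \<open>AM-GM, from \<open>ln t \<le> t - 1\<close> at \<open>t = a i / s\<close> with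
  \<open>s\<close> the mean. It trades the product of the diagonal entries, which governs a volume,
  for the trace, whose expectation is easy.\<close>

lemma prod_le_mean_power:
  fixes a :: "'i \<Rightarrow> real"
  assumes I: "finite I" "I \<noteq> {}" and a: "\<And>i. i \<in> I \<Longrightarrow> 0 < a i"
  shows "prod a I \<le> (sum a I / card I) ^ card I"
proof -
  define s where "s = sum a I / card I"
  have c: "card I > 0" using I by (simp add: card_gt_0_iff)
  have s: "s > 0" using I a c by (auto simp: s_def intro!: divide_pos_pos sum_pos)
  have "(\<Sum>i\<in>I. ln (a i)) \<le> (\<Sum>i\<in>I. ln s + (a i / s - 1))"
  proof (rule sum_mono)
    fix i assume "i \<in> I"
    then show "ln (a i) \<le> ln s + (a i / s - 1)"
      using a[of i] s ln_le_minus_one[of "a i / s"] by (simp add: ln_div)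
  qed
  also have "\<dots> = card I * ln s + (sum a I / s - card I)"
    by (simp add: sum.distrib sum_subtractf sum_divide_distrib[symmetric])
  also have "sum a I / s = card I" using c s by (auto simp: s_def)
  finally have le: "(\<Sum>i\<in>I. ln (a i)) \<le> card I * ln s" by simp
  have "prod a I = exp (\<Sum>i\<in>I. ln (a i))" using a I by (simp add: exp_sum)
  also have "\<dots> \<le> exp (card I * ln s)" using le by simp
  also have "\<dots> = s ^ card I" using s by (simp add: exp_of_nat_mult)
  finally show ?thesis by (simp add: s_def)
qed

subsection \<open>Gram matrices, leverages and least squares\<close>

lemma matrix_inv:
  assumes "invertible A"
  shows matrix_inv_right: "A ** matrix_inv A = mat 1"
    and matrix_inv_left: "matrix_inv A ** A = mat 1"
proof -
  have "\<exists>B. A ** B = mat 1 \<and> B ** A = mat 1" using assms by (simp add: invertible_def)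
  from someI_ex[OF this] show "A ** matrix_inv A = mat 1" "matrix_inv A ** A = mat 1"
    by (auto simp: matrix_inv_def)
qed

lemma matrix_inv_mult_vec [simp]:
  assumes "invertible A"
  shows "A *v (matrix_inv A *v x) = x" and "matrix_inv A *v (A *v x) = x"
  using assms by (simp_all add: matrix_vector_mul_assoc matrix_inv)

lemma matrix_inv_unique:
  fixes A B :: "real^'n^'n"
  assumes "A ** B = mat 1"
  shows "invertible A" "matrix_inv A = B"
proof -
  have "B ** A = mat 1" using assms matrix_left_right_inverse by blast
  with assms show "invertible A" by (auto simp: invertible_def)
  from matrix_inv_left[OF this] show "matrix_inv A = B"
    using assms by (metis matrix_mul_assoc matrix_mul_lid matrix_mul_rid)
qed

lemma transpose_matrix_inv:
  fixes A :: "real^'n^'n"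
  assumes "transpose A = A" "invertible A"
  shows "transpose (matrix_inv A) = matrix_inv A"
proof (rule matrix_inv_unique(2)[symmetric])
  show "A ** transpose (matrix_inv A) = mat 1"
    using matrix_inv_left[OF assms(2)] by (metis assms(1) matrix_transpose_mul transpose_mat)
qed

lemma pos_semidef_matrix_inv_inner:
  "pos_semidef A \<Longrightarrow> invertible A \<Longrightarrow> (matrix_inv A *v x) \<bullet> y = x \<bullet> (matrix_inv A *v y)"
  by (simp add: pos_semidef_def symmetric_matrix_inner transpose_matrix_inv)

lemma pos_semidef_matrix_inv_nonneg:
  assumes "pos_semidef A" "invertible A"
  shows "0 \<le> (matrix_inv A *v x) \<bullet> x"
proof -
  have "0 \<le> (A *v (matrix_inv A *v x)) \<bullet> (matrix_inv A *v x)"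
    using assms(1) unfolding pos_semidef_def by blast
  then show ?thesis using assms(2) by (simp add: inner_commute)
qed

lemma pos_semidef_matrix_inv_pos:
  assumes "pos_semidef A" "invertible A" "x \<noteq> 0"
  shows "0 < (matrix_inv A *v x) \<bullet> x"
proof -
  have "(matrix_inv A *v x) \<bullet> x \<noteq> 0"
  proof
    assume "(matrix_inv A *v x) \<bullet> x = 0"
    then have "(A *v (matrix_inv A *v x)) \<bullet> (matrix_inv A *v x) = 0"
      using assms(2) by (simp add: inner_commute)
    then have "A *v (matrix_inv A *v x) = 0" by (rule pos_semidef_form_zero[OF assms(1)])
    then show False using assms(2,3) by simp
  qed
  with pos_semidef_matrix_inv_nonneg[OF assms(1,2), of x] show ?thesis by simp
qed

lemma pos_semidef_invertible_iff:
  assumes "pos_semidef A"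
  shows "invertible A \<longleftrightarrow> (\<forall>x. (A *v x) \<bullet> x = 0 \<longrightarrow> x = 0)"
proof
  assume inv: "invertible A"
  show "\<forall>x. (A *v x) \<bullet> x = 0 \<longrightarrow> x = 0"
    using pos_semidef_form_zero[OF assms] matrix_inv_mult_vec(2)[OF inv]
    by (metis matrix_vector_mult_0_right)
next
  assume *: "\<forall>x. (A *v x) \<bullet> x = 0 \<longrightarrow> x = 0"
  then have "\<forall>x. A *v x = 0 \<longrightarrow> x = 0" by auto
  then show "invertible A"
    by (simp add: invertible_left_inverse matrix_left_invertible_ker)
qed

lemma outer_square_nth: "outer_square x $ i $ j = x $ i * x $ j"
  by (simp add: outer_square_def matrix_matrix_mult_def columnvector_def rowvector_def)

lemma outer_square_mult_vec: "outer_square x *v v = (x \<bullet> v) *\<^sub>R x"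
  by (simp add: vec_eq_iff matrix_vector_mult_def outer_square_nth inner_vec_def sum_distrib_left
      mult_ac)

text \<open>Unnormalized and over an arbitrary index set, so that adding the test point is
  \<open>insert j I\<close>, a rank one update.\<close>

definition gram :: "'i set \<Rightarrow> ('i \<Rightarrow> real^'n) \<Rightarrow> real^'n^'n" where
  "gram I xs = (\<Sum>i\<in>I. outer_square (xs i))"

lemma sum_matrix_mult_vec:
  fixes F :: "'i \<Rightarrow> real^'n^'m"
  shows "(\<Sum>i\<in>I. F i) *v v = (\<Sum>i\<in>I. F i *v v)"
  by (induction I rule: infinite_finite_induct)
     (auto simp: matrix_vector_mult_add_rdistrib)

lemma gram_mult_vec: "gram I xs *v v = (\<Sum>i\<in>I. (xs i \<bullet> v) *\<^sub>R xs i)"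
  by (simp add: gram_def sum_matrix_mult_vec outer_square_mult_vec)

lemma gram_form: "(gram I xs *v v) \<bullet> v = (\<Sum>i\<in>I. (xs i \<bullet> v)\<^sup>2)"
  by (simp add: gram_mult_vec inner_sum_left power2_eq_square)

lemma transpose_gram: "transpose (gram I xs) = gram I xs"
  by (simp add: vec_eq_iff transpose_def gram_def outer_square_nth mult.commute)

lemma pos_semidef_gram: "pos_semidef (gram I xs)"
  by (simp add: pos_semidef_def transpose_gram gram_form sum_nonneg)

lemma trace_gram: "trace (gram I xs) = (\<Sum>i\<in>I. (norm (xs i))\<^sup>2)"
proof -
  have "trace (gram I xs) = (\<Sum>j\<in>UNIV. \<Sum>i\<in>I. xs i $ j * xs i $ j)"
    by (simp add: trace_def gram_def outer_square_nth)
  also have "\<dots> = (\<Sum>i\<in>I. \<Sum>j\<in>UNIV. xs i $ j * xs i $ j)" by (rule sum.swap)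
  finally show ?thesis by (simp add: power2_norm_eq_inner inner_vec_def)
qed

lemma gram_linear_image:
  fixes W :: "real^'n^'n"
  assumes "transpose W = W"
  shows "gram I (\<lambda>i. W *v xs i) = W ** gram I xs ** W"
proof -
  have "gram I (\<lambda>i. W *v xs i) *v v = (W ** gram I xs ** W) *v v" for v
    by (simp add: matrix_vector_mul_assoc[symmetric] gram_mult_vec symmetric_matrix_inner[OF assms]
        linear_sum[OF matrix_vector_mul_linear] linear_scale[OF matrix_vector_mul_linear])
  then show ?thesis by (simp add: matrix_eq)
qed

lemma invertible_gram_superset:
  assumes "invertible (gram I xs)" "I \<subseteq> J" "finite J"
  shows "invertible (gram J xs)"
proof -
  have "v = 0" if "(gram J xs *v v) \<bullet> v = 0" for v
  proof -
    have "\<forall>i\<in>J. (xs i \<bullet> v)\<^sup>2 = 0"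
      using that assms(3) by (simp add: gram_form sum_nonneg_eq_0_iff)
    then have "(gram I xs *v v) \<bullet> v = 0" using assms(2)
      by (auto simp: gram_form subset_iff intro!: sum.neutral)
    then show ?thesis using assms(1) pos_semidef_invertible_iff[OF pos_semidef_gram] by blast
  qed
  then show ?thesis using pos_semidef_invertible_iff[OF pos_semidef_gram] by blast
qed

definition leverage :: "'i set \<Rightarrow> ('i \<Rightarrow> real^'n) \<Rightarrow> real^'n \<Rightarrow> real" where
  "leverage I xs x = (matrix_inv (gram I xs) *v x) \<bullet> x"

definition lsq :: "'i set \<Rightarrow> ('i \<Rightarrow> real^'n) \<Rightarrow> ('i \<Rightarrow> real) \<Rightarrow> real^'n" where
  "lsq I xs ys = matrix_inv (gram I xs) *v (\<Sum>i\<in>I. ys i *\<^sub>R xs i)"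

lemma leverage_nonneg: "invertible (gram I xs) \<Longrightarrow> 0 \<le> leverage I xs x"
  by (simp add: leverage_def pos_semidef_matrix_inv_nonneg pos_semidef_gram)

lemma gram_insert: "finite I \<Longrightarrow> j \<notin> I \<Longrightarrow> gram (insert j I) xs = outer_square (xs j) + gram I xs"
  by (simp add: gram_def)

text \<open>Sherman-Morrison on the added vector itself: the enlarged Gram matrix sends
  \<open>w\<close> to \<open>(1 + u) *\<^sub>R xs j\<close>.\<close>

lemma gram_insert_inverse:
  assumes inv: "invertible (gram I xs)" and j: "finite I" "j \<notin> I"
  shows "matrix_inv (gram (insert j I) xs) *v xs j =
           (1 / (1 + leverage I xs (xs j))) *\<^sub>R (matrix_inv (gram I xs) *v xs j)"
proof -
  define w where "w = matrix_inv (gram I xs) *v xs j"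
  define u where "u = leverage I xs (xs j)"
  have u: "u \<ge> 0" "xs j \<bullet> w = u"
    using leverage_nonneg[OF inv] by (auto simp: u_def w_def leverage_def inner_commute)
  have inv': "invertible (gram (insert j I) xs)"
    using inv j by (intro invertible_gram_superset[OF inv]) auto
  have "gram (insert j I) xs *v w = (1 + u) *\<^sub>R xs j"
    using inv j u(2) by (simp add: gram_insert matrix_vector_mult_add_rdistrib outer_square_mult_vec
        w_def[symmetric] scaleR_add_left) (simp add: w_def)
  then have "gram (insert j I) xs *v ((1 / (1 + u)) *\<^sub>R w) = xs j"
    using u(1) by (simp add: matrix_vector_mult_scaleR)
  then show ?thesis using matrix_inv_mult_vec(2)[OF inv'] unfolding w_def u_def by metis
qed

lemma leverage_insert:
  assumes "invertible (gram I xs)" "finite I" "j \<notin> I"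
  shows "leverage (insert j I) xs (xs j) = leverage I xs (xs j) / (1 + leverage I xs (xs j))"
  using gram_insert_inverse[OF assms] by (simp add: leverage_def[of "insert j I"]) (simp add: leverage_def)

text \<open>Since the inverse is symmetric, only its action on \<open>xs j\<close> matters. The
  factor \<open>1 + u\<close> is the standard deviation of the predictor at the test point, so the
  predictor's normalized residual is an ordinary in-sample residual of the enlarged sample.\<close>

lemma lsq_insert_residual:
  assumes inv: "invertible (gram I xs)" and j: "finite I" "j \<notin> I"
  shows "ys j - lsq (insert j I) xs ys \<bullet> xs j =
           (ys j - lsq I xs ys \<bullet> xs j) / (1 + leverage I xs (xs j))"
proof -
  define u where "u = leverage I xs (xs j)"
  define b where "b = (\<Sum>i\<in>I. ys i *\<^sub>R xs i)"
  have u: "u \<ge> 0" using leverage_nonneg[OF inv] by (auto simp: u_def)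
  have inv': "invertible (gram (insert j I) xs)"
    using inv j by (intro invertible_gram_superset[OF inv]) auto
  have "lsq (insert j I) xs ys \<bullet> xs j = (b + ys j *\<^sub>R xs j) \<bullet> (matrix_inv (gram (insert j I) xs) *v xs j)"
    using j by (simp add: lsq_def pos_semidef_matrix_inv_inner[OF pos_semidef_gram inv'] b_def add.commute)
  also have "\<dots> = (lsq I xs ys \<bullet> xs j + ys j * u) / (1 + u)"
    unfolding gram_insert_inverse[OF inv j]
    by (simp add: inner_add_left lsq_def b_def u_def leverage_def
        pos_semidef_matrix_inv_inner[OF pos_semidef_gram inv] add_divide_distrib inner_commute
        matrix_vector_right_distrib matrix_vector_mult_scaleR inner_add_right)
  finally show ?thesis using u by (simp add: u_def[symmetric] field_simps)
qed

text \<open>The trace of the hat matrix, written as the trace of \<open>B ** gram I xs\<close> with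
  \<open>B\<close> the inverse Gram matrix.\<close>

lemma sum_leverage:
  fixes xs :: "'i \<Rightarrow> real^'n"
  assumes inv: "invertible (gram I xs)"
  shows "(\<Sum>i\<in>I. leverage I xs (xs i)) = CARD('n)"
proof -
  define B where "B = matrix_inv (gram I xs)"
  have "trace (B ** gram I xs) = (\<Sum>i\<in>I. leverage I xs (xs i))"
  proof -
    have "trace (B ** gram I xs) = (\<Sum>a\<in>UNIV. \<Sum>b\<in>UNIV. \<Sum>i\<in>I. B $ a $ b * (xs i $ b * xs i $ a))"
      by (simp add: trace_def matrix_matrix_mult_def gram_def outer_square_nth sum_distrib_left)
    also have "\<dots> = (\<Sum>i\<in>I. \<Sum>a\<in>UNIV. \<Sum>b\<in>UNIV. B $ a $ b * (xs i $ b * xs i $ a))"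
    proof -
      have "(\<Sum>a\<in>UNIV. \<Sum>b\<in>UNIV. \<Sum>i\<in>I. B $ a $ b * (xs i $ b * xs i $ a)) =
          (\<Sum>a\<in>UNIV. \<Sum>i\<in>I. \<Sum>b\<in>UNIV. B $ a $ b * (xs i $ b * xs i $ a))"
        by (intro sum.cong refl sum.swap)
      also have "\<dots> = (\<Sum>i\<in>I. \<Sum>a\<in>UNIV. \<Sum>b\<in>UNIV. B $ a $ b * (xs i $ b * xs i $ a))"
        by (rule sum.swap)
      finally show ?thesis .
    qed
    also have "\<dots> = (\<Sum>i\<in>I. leverage I xs (xs i))"
      by (simp add: leverage_def B_def[symmetric] inner_vec_def matrix_vector_mult_def
          sum_distrib_right mult.assoc)
    finally show ?thesis .
  qed
  moreover have "trace (B ** gram I xs) = CARD('n)"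
    unfolding B_def matrix_inv_left[OF inv] by (simp add: trace_def mat_def)
  ultimately show ?thesis by simp
qed

text \<open>Pythagoras: by the normal equations the cross term \<open>orth\<close> vanishes.\<close>

lemma lsq_minimal:
  assumes inv: "invertible (gram I xs)"
  shows "(\<Sum>i\<in>I. (ys i - lsq I xs ys \<bullet> xs i)\<^sup>2) \<le> (\<Sum>i\<in>I. (ys i - \<theta> \<bullet> xs i)\<^sup>2)"
proof -
  define h where "h = lsq I xs ys"
  define d where "d = \<theta> - h"
  have "gram I xs *v h = (\<Sum>i\<in>I. ys i *\<^sub>R xs i)" using inv by (simp add: h_def lsq_def)
  then have "(gram I xs *v h) \<bullet> d = (\<Sum>i\<in>I. ys i *\<^sub>R xs i) \<bullet> d" by simp
  then have orth: "(\<Sum>i\<in>I. (ys i - h \<bullet> xs i) * (d \<bullet> xs i)) = 0"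
    by (simp add: gram_mult_vec inner_sum_left inner_sum_right inner_commute sum_subtractf algebra_simps)
  have "(\<Sum>i\<in>I. (ys i - \<theta> \<bullet> xs i)\<^sup>2) =
      (\<Sum>i\<in>I. (ys i - h \<bullet> xs i)\<^sup>2 - 2 * ((ys i - h \<bullet> xs i) * (d \<bullet> xs i)) + (d \<bullet> xs i)\<^sup>2)"
    by (intro sum.cong refl) (simp add: d_def inner_diff_left power2_eq_square algebra_simps)
  also have "\<dots> = (\<Sum>i\<in>I. (ys i - h \<bullet> xs i)\<^sup>2) + (\<Sum>i\<in>I. (d \<bullet> xs i)\<^sup>2)"
    using orth by (simp add: sum.distrib sum_subtractf sum_distrib_left[symmetric])
  also have "\<dots> \<ge> (\<Sum>i\<in>I. (ys i - h \<bullet> xs i)\<^sup>2)" by (simp add: sum_nonneg)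
  finally show ?thesis by (simp add: h_def)
qed

subsection \<open>Measurability of matrix operations\<close>

lemma borel_measurable_vec_nth [measurable]:
  fixes f :: "'a \<Rightarrow> ('b::euclidean_space)^'n"
  assumes [measurable]: "f \<in> borel_measurable M"
  shows "(\<lambda>x. f x $ i) \<in> borel_measurable M"
proof -
  have "(\<lambda>v::'b^'n. v $ i) \<in> borel_measurable borel"
    by (intro borel_measurable_continuous_onI continuous_on_component continuous_on_id)
  from measurable_compose[OF assms this] show ?thesis .
qed

lemma borel_measurable_vec_lambda [measurable (raw)]:
  fixes f :: "'n::finite \<Rightarrow> 'a \<Rightarrow> 'b::euclidean_space"
  assumes [measurable]: "\<And>i. f i \<in> borel_measurable M"
  shows "(\<lambda>x. \<chi> i. f i x) \<in> borel_measurable M"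
proof (rule borel_measurable_euclidean_space[THEN iffD2], rule ballI)
  fix b :: "'b^'n" assume "b \<in> Basis"
  then obtain j c where "b = axis j c" by (auto simp: Basis_vec_def)
  then show "(\<lambda>x. (\<chi> i. f i x) \<bullet> b) \<in> borel_measurable M" by (simp add: inner_axis)
qed

lemma borel_measurable_matrix_vector_mult [measurable (raw)]:
  fixes f :: "'a \<Rightarrow> real^'n^'m"
  assumes [measurable]: "f \<in> borel_measurable M" "g \<in> borel_measurable M"
  shows "(\<lambda>x. f x *v g x) \<in> borel_measurable M"
  unfolding matrix_vector_mult_def by measurable

lemma borel_measurable_det [measurable (raw)]:
  fixes f :: "'a \<Rightarrow> real^'n^'n"
  assumes [measurable]: "f \<in> borel_measurable M"
  shows "(\<lambda>x. det (f x)) \<in> borel_measurable M"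
  unfolding det_def by measurable

lemma borel_measurable_outer_square [measurable (raw)]:
  fixes f :: "'a \<Rightarrow> real^'b"
  assumes [measurable]: "f \<in> borel_measurable M"
  shows "(\<lambda>x. outer_square (f x)) \<in> borel_measurable M"
proof -
  have eq: "outer_square v = (\<chi> i j. v $ i * v $ j)" for v :: "real^'b"
    by (simp add: vec_eq_iff outer_square_nth)
  show ?thesis unfolding eq by measurable
qed

text \<open>On singular matrices \<^const>\<open>matrix_inv\<close> is a fixed unspecified matrix, so that Cramer's rule
  still gives measurability everywhere.\<close>
lemma borel_measurable_matrix_inv_mult [measurable (raw)]:
  fixes f :: "'a \<Rightarrow> real^'n^'n"
  assumes [measurable]: "f \<in> borel_measurable M" "g \<in> borel_measurable M"
  shows "(\<lambda>x. matrix_inv (f x) *v g x) \<in> borel_measurable M"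
proof -
  define Z :: "real^'n^'n" where "Z = (SOME B. False)"
  have "matrix_inv A *v b = (if det A \<noteq> 0
      then (\<chi> k. det (\<chi> i j. if j = k then b $ i else A $ i $ j) / det A) else Z *v b)"
    for A :: "real^'n^'n" and b
  proof (cases "det A = 0")
    case True
    then have "\<not> (\<exists>B. A ** B = mat 1 \<and> B ** A = mat 1)"
      using invertible_det_nz[of A] by (auto simp: invertible_def)
    then have "(\<lambda>B. A ** B = mat 1 \<and> B ** A = mat 1) = (\<lambda>B. False)" by auto
    then have "matrix_inv A = Z" unfolding matrix_inv_def Z_def by simp
    then show ?thesis using True by simp
  next
    case False
    then have "A *v (matrix_inv A *v b) = b" by (simp add: invertible_det_nz)
    then show ?thesis using cramer[OF False, of "matrix_inv A *v b" b] False by simp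
  qed
  note eq = this
  show ?thesis unfolding eq by measurable
qed

lemma borel_measurable_gram [measurable (raw)]:
  assumes [measurable]: "\<And>i. i \<in> I \<Longrightarrow> (\<lambda>x. xs x i) \<in> borel_measurable M"
  shows "(\<lambda>x. gram I (xs x)) \<in> borel_measurable M"
  unfolding gram_def by measurable

lemma borel_measurable_leverage [measurable (raw)]:
  assumes [measurable]: "\<And>i. i \<in> I \<Longrightarrow> (\<lambda>x. xs x i) \<in> borel_measurable M" "g \<in> borel_measurable M"
  shows "(\<lambda>x. leverage I (xs x) (g x)) \<in> borel_measurable M"
  unfolding leverage_def by measurable

lemma borel_measurable_lsq [measurable (raw)]:
  assumes [measurable]: "\<And>i. i \<in> I \<Longrightarrow> (\<lambda>x. xs x i) \<in> borel_measurable M"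
    "\<And>i. i \<in> I \<Longrightarrow> (\<lambda>x. ys x i) \<in> borel_measurable M"
  shows "(\<lambda>x. lsq I (xs x) (ys x)) \<in> borel_measurable M"
  unfolding lsq_def by measurable

subsection \<open>Ellipsoids and radial integrals\<close>

lemma sqrt_prod: "sqrt (prod a B) = (\<Prod>b\<in>B. sqrt (a b))"
  by (induction B rule: infinite_finite_induct) (simp_all add: real_sqrt_mult)

text \<open>The diagonal scaling \<open>T\<close> pulls the ellipsoid back to a ball; the volume
  changes by the product of the scale factors \<open>c j\<close>.\<close>

lemma emeasure_coordinate_ellipsoid:
  fixes a :: "'a::euclidean_space \<Rightarrow> real"
  assumes a: "\<And>j. j \<in> Basis \<Longrightarrow> 0 < a j" and s: "0 \<le> s"
  shows "emeasure lborel {\<eta>::'a. (\<Sum>j\<in>Basis. a j * (\<eta> \<bullet> j)\<^sup>2) \<le> s\<^sup>2} =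
           ennreal (unit_ball_vol DIM('a) * s ^ DIM('a) / sqrt (\<Prod>j\<in>Basis. a j))"
proof -
  define c where "c = (\<lambda>j. 1 / sqrt (a j))"
  define T where "T = (\<lambda>x::'a. 0 + (\<Sum>j\<in>Basis. (c j * (x \<bullet> j)) *\<^sub>R j))"
  define K where "K = {\<eta>::'a. (\<Sum>j\<in>Basis. a j * (\<eta> \<bullet> j)\<^sup>2) \<le> s\<^sup>2}"
  have [measurable]: "K \<in> sets borel" "T \<in> borel_measurable borel"
    unfolding K_def T_def by measurable
  have c: "c j \<noteq> 0" if "j \<in> Basis" for j using a[OF that] by (simp add: c_def)
  have lb: "lborel = density (distr lborel borel T) (\<lambda>_. (\<Prod>j\<in>Basis. \<bar>c j\<bar>))"
    unfolding T_def by (rule lborel_affine_euclidean) (rule c)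
  have "T -` K = cball 0 s"
  proof -
    have "(\<Sum>j\<in>Basis. a j * (T x \<bullet> j)\<^sup>2) = (norm x)\<^sup>2" for x
    proof -
      have "(\<Sum>j\<in>Basis. a j * (T x \<bullet> j)\<^sup>2) = (\<Sum>j\<in>Basis. (x \<bullet> j) * (x \<bullet> j))"
      proof (rule sum.cong[OF refl])
        fix j :: 'a assume j: "j \<in> Basis"
        then have "T x \<bullet> j = c j * (x \<bullet> j)"
          by (simp add: T_def inner_sum_left inner_Basis if_distrib cong: if_cong)
        then show "a j * (T x \<bullet> j)\<^sup>2 = (x \<bullet> j) * (x \<bullet> j)"
          using a[OF j] by (simp add: c_def power_divide power_mult_distrib power2_eq_square)
      qed
      then show ?thesis by (simp add: power2_norm_eq_inner euclidean_inner[of x x])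
    qed
    then show ?thesis using s by (auto simp: K_def power2_le_iff_abs_le)
  qed
  then have "emeasure (distr lborel borel T) K = ennreal (unit_ball_vol DIM('a) * s ^ DIM('a))"
    using s by (simp add: emeasure_distr emeasure_cball)
  moreover have "emeasure lborel K = ennreal (\<Prod>j\<in>Basis. \<bar>c j\<bar>) * emeasure (distr lborel borel T) K"
    by (subst lb) (simp add: emeasure_density nn_integral_cmult prod_ennreal)
  moreover have "(\<Prod>j\<in>Basis. \<bar>c j\<bar>) = 1 / sqrt (\<Prod>j\<in>Basis. a j)"
    using a by (simp add: c_def prod_dividef sqrt_prod abs_of_pos cong: prod.cong)
  moreover have "0 \<le> (\<Prod>j\<in>Basis. a j)" using a by (intro prod_nonneg) (auto intro: less_imp_le)
  ultimately show ?thesis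
    using s by (simp add: K_def ennreal_mult[symmetric])
qed

text \<open>Reflecting one coordinate preserves Lebesgue measure, so the integral equals its own
  negative. This removes the off-diagonal terms of a quadratic form on a set symmetric in each
  coordinate.\<close>

lemma integral_reflected_coordinate:
  fixes f :: "'a::euclidean_space \<Rightarrow> real"
  assumes i: "i \<in> Basis" and [measurable]: "f \<in> borel_measurable borel"
    and odd: "\<And>x. f (x - (2 * (x \<bullet> i)) *\<^sub>R i) = - f x"
  shows "(\<integral>x. f x \<partial>lborel) = 0"
proof -
  define c where "c = (\<lambda>j. if j = i then - 1 else 1 :: real)"
  define T where "T = (\<lambda>x::'a. 0 + (\<Sum>j\<in>Basis. (c j * (x \<bullet> j)) *\<^sub>R j))"
  have [measurable]: "T \<in> borel_measurable borel" unfolding T_def by measurable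
  have "lborel = density (distr lborel borel T) (\<lambda>_. (\<Prod>j\<in>Basis. \<bar>c j\<bar>))"
    unfolding T_def by (rule lborel_affine_euclidean) (simp add: c_def)
  also have "(\<Prod>j\<in>Basis. \<bar>c j\<bar>) = 1" by (rule prod.neutral) (simp add: c_def)
  finally have lb: "lborel = distr lborel borel T" by (simp add: density_1)
  have T: "T x = x - (2 * (x \<bullet> i)) *\<^sub>R i" for x
  proof (rule euclidean_eqI)
    fix b :: 'a assume b: "b \<in> Basis"
    then have "T x \<bullet> b = c b * (x \<bullet> b)"
      by (simp add: T_def inner_sum_left inner_Basis if_distrib cong: if_cong)
    then show "T x \<bullet> b = (x - (2 * (x \<bullet> i)) *\<^sub>R i) \<bullet> b"
      using b i by (simp add: c_def inner_diff_left inner_Basis)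
  qed
  have "(\<integral>x. f x \<partial>lborel) = (\<integral>x. f (T x) \<partial>lborel)"
    by (subst lb) (simp add: integral_distr)
  also have "\<dots> = - (\<integral>x. f x \<partial>lborel)" by (simp add: T odd)
  finally show ?thesis by simp
qed

text \<open>Averaging over coordinate reflections replaces the form by its diagonal part; Markov's
  inequality on the ellipsoid of the diagonal part then bounds the volume from below.\<close>
lemma emeasure_ellipsoid_ge:
  fixes f :: "'a::euclidean_space \<Rightarrow> 'a"
  assumes lin: "linear f" and psd: "\<And>x. 0 \<le> f x \<bullet> x" and pos: "\<And>j. j \<in> Basis \<Longrightarrow> 0 < f j \<bullet> j"
    and r: "0 < r"
  shows "ennreal (unit_ball_vol DIM('a) * (r / sqrt 2) ^ DIM('a)
           / sqrt ((\<Sum>j\<in>Basis. f j \<bullet> j) / DIM('a)) ^ DIM('a) / 2)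
         \<le> emeasure lborel {\<eta>. f \<eta> \<bullet> \<eta> \<le> r\<^sup>2}"
proof -
  define a where "a = (\<lambda>j. f j \<bullet> j)"
  \<comment> \<open>The factor \<open>sqrt 2\<close> prepares Markov's inequality: the diagonal form
    is at most \<open>r\<^sup>2 / 2\<close> on \<open>K\<close>, so the part of \<open>K\<close>
    where the full form exceeds \<open>r\<^sup>2\<close> has at most half the volume.\<close>
  define K where "K = {\<eta>::'a. (\<Sum>j\<in>Basis. a j * (\<eta> \<bullet> j)\<^sup>2) \<le> (r / sqrt 2)\<^sup>2}"
  have f_meas[measurable]: "f \<in> borel_measurable borel"
    by (intro borel_measurable_continuous_onI linear_continuous_on linear_conv_bounded_linear[THEN iffD1] lin)
  have K[measurable]: "K \<in> sets borel" unfolding K_def by measurable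
  have a: "0 < a j" if "j \<in> Basis" for j using pos[OF that] by (simp add: a_def)
  have eK: "emeasure lborel K = ennreal (unit_ball_vol DIM('a) * (r / sqrt 2) ^ DIM('a) / sqrt (\<Prod>j\<in>Basis. a j))"
    unfolding K_def using a r by (intro emeasure_coordinate_ellipsoid) auto
  then have fin: "emeasure lborel K < \<infinity>" by simp
  have coord: "\<bar>\<eta> \<bullet> j\<bar> \<le> r / sqrt (a j)" if "\<eta> \<in> K" "j \<in> Basis" for \<eta> j
  proof -
    have "a j * (\<eta> \<bullet> j)\<^sup>2 \<le> (\<Sum>j\<in>Basis. a j * (\<eta> \<bullet> j)\<^sup>2)"
      using that a by (intro member_le_sum) (auto intro!: mult_nonneg_nonneg less_imp_le[OF a])
    also have "\<dots> \<le> r\<^sup>2 / 2" using that by (simp add: K_def power_divide)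
    also have "\<dots> \<le> r\<^sup>2" by simp
    finally have "(\<eta> \<bullet> j)\<^sup>2 \<le> (r / sqrt (a j))\<^sup>2"
      using a[OF that(2)] by (simp add: power_divide field_simps)
    then show ?thesis using r a[OF that(2)] by (metis abs_le_square_iff abs_of_nonneg divide_nonneg_nonneg less_imp_le real_sqrt_ge_zero)
  qed
  define g where "g = (\<lambda>i j (\<eta>::'a). indicator K \<eta> * ((\<eta> \<bullet> i) * (\<eta> \<bullet> j)) :: real)"
  have g_int: "integrable lborel (g i j)" if "i \<in> Basis" "j \<in> Basis" for i j
  proof (rule Bochner_Integration.integrable_bound[where f="\<lambda>\<eta>. (r / sqrt (a i)) * (r / sqrt (a j)) * indicator K \<eta>"])
    show "integrable lborel (\<lambda>\<eta>. (r / sqrt (a i)) * (r / sqrt (a j)) * indicator K \<eta> :: real)"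
      using fin by (intro integrable_mult_right integrable_real_indicator) auto
    show "g i j \<in> borel_measurable lborel" unfolding g_def by measurable
    show "AE \<eta> in lborel. norm (g i j \<eta>) \<le> norm (r / sqrt (a i) * (r / sqrt (a j)) * indicator K \<eta> :: real)"
    proof (rule AE_I2)
      fix \<eta> :: 'a
      show "norm (g i j \<eta>) \<le> norm (r / sqrt (a i) * (r / sqrt (a j)) * indicator K \<eta> :: real)"
      proof (cases "\<eta> \<in> K")
        case True
        have "\<bar>\<eta> \<bullet> i\<bar> * \<bar>\<eta> \<bullet> j\<bar> \<le> r / sqrt (a i) * (r / sqrt (a j))"
          using coord[OF True that(1)] coord[OF True that(2)] by (intro mult_mono) (auto intro: order_trans[OF abs_ge_zero])
        then show ?thesis using True a[OF that(1)] a[OF that(2)] r by (simp add: g_def abs_mult abs_of_pos)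
      qed (simp add: g_def)
    qed
  qed
  have g0: "(\<integral>\<eta>. g i j \<eta> \<partial>lborel) = 0" if "i \<in> Basis" "j \<in> Basis" "i \<noteq> j" for i j
  proof (rule integral_reflected_coordinate[OF that(1)])
    show "g i j \<in> borel_measurable borel" unfolding g_def by measurable
    fix x :: 'a
    let ?y = "x - (2 * (x \<bullet> i)) *\<^sub>R i"
    have y: "?y \<bullet> b = (if b = i then - (x \<bullet> b) else x \<bullet> b)" if "b \<in> Basis" for b
      using that \<open>i \<in> Basis\<close> by (simp add: inner_diff_left inner_Basis)
    have "(\<Sum>b\<in>Basis. a b * (?y \<bullet> b)\<^sup>2) = (\<Sum>b\<in>Basis. a b * (x \<bullet> b)\<^sup>2)"
      by (intro sum.cong refl) (simp add: y)
    then have "?y \<in> K \<longleftrightarrow> x \<in> K" by (simp add: K_def)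
    then show "g i j ?y = - g i j x"
      using that by (simp only: g_def indicator_def y if_True if_False) (simp add: y)
  qed
  have form: "f \<eta> \<bullet> \<eta> = (\<Sum>i\<in>Basis. \<Sum>j\<in>Basis. (f i \<bullet> j) * ((\<eta> \<bullet> i) * (\<eta> \<bullet> j)))" for \<eta>
  proof -
    have "f \<eta> = f (\<Sum>i\<in>Basis. (\<eta> \<bullet> i) *\<^sub>R i)" by (simp add: euclidean_representation)
    also have "\<dots> = (\<Sum>i\<in>Basis. (\<eta> \<bullet> i) *\<^sub>R f i)" using lin by (simp add: linear_sum linear_scale)
    finally have "f \<eta> \<bullet> \<eta> = (\<Sum>i\<in>Basis. (\<eta> \<bullet> i) * (f i \<bullet> \<eta>))" by (simp add: inner_sum_left)
    also have "\<dots> = (\<Sum>i\<in>Basis. \<Sum>j\<in>Basis. (f i \<bullet> j) * ((\<eta> \<bullet> i) * (\<eta> \<bullet> j)))"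
      by (intro sum.cong refl, subst euclidean_inner) (simp add: sum_distrib_left mult_ac)
    finally show ?thesis .
  qed
  have F_eq: "indicator K \<eta> * (f \<eta> \<bullet> \<eta>) = (\<Sum>i\<in>Basis. \<Sum>j\<in>Basis. (f i \<bullet> j) * g i j \<eta>)" for \<eta>
    unfolding form g_def by (simp add: sum_distrib_left mult_ac)
  have F_int: "integrable lborel (\<lambda>\<eta>. indicator K \<eta> * (f \<eta> \<bullet> \<eta>))"
    unfolding F_eq by (intro Bochner_Integration.integrable_sum integrable_mult_right g_int)
  have "(\<integral>\<eta>. indicator K \<eta> * (f \<eta> \<bullet> \<eta>) \<partial>lborel) = (\<Sum>i\<in>Basis. \<Sum>j\<in>Basis. (f i \<bullet> j) * (\<integral>\<eta>. g i j \<eta> \<partial>lborel))"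
    unfolding F_eq by (simp add: g_int Bochner_Integration.integral_sum Bochner_Integration.integrable_sum)
  also have "\<dots> = (\<Sum>i\<in>Basis. \<Sum>j\<in>Basis. if j = i then a i * (\<integral>\<eta>. g i i \<eta> \<partial>lborel) else 0)"
    by (intro sum.cong refl) (auto simp: g0 a_def)
  also have "\<dots> = (\<Sum>i\<in>Basis. a i * (\<integral>\<eta>. g i i \<eta> \<partial>lborel))" by simp
  also have "\<dots> = (\<integral>\<eta>. (\<Sum>i\<in>Basis. a i * g i i \<eta>) \<partial>lborel)"
    by (simp add: g_int Bochner_Integration.integral_sum)
  also have "\<dots> \<le> (\<integral>\<eta>. r\<^sup>2 / 2 * indicator K \<eta> \<partial>lborel)"
  proof (rule integral_mono)
    show "integrable lborel (\<lambda>\<eta>. \<Sum>i\<in>Basis. a i * g i i \<eta>)"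
      by (intro Bochner_Integration.integrable_sum integrable_mult_right g_int)
    show "integrable lborel (\<lambda>\<eta>. r\<^sup>2 / 2 * indicator K \<eta> :: real)"
      using fin by (intro integrable_mult_right integrable_real_indicator) auto
    show "(\<Sum>i\<in>Basis. a i * g i i \<eta>) \<le> r\<^sup>2 / 2 * indicator K \<eta>" for \<eta>
      by (cases "\<eta> \<in> K") (auto simp: g_def K_def power_divide power2_eq_square)
  qed
  also have "\<dots> = r\<^sup>2 / 2 * measure lborel K" by simp
  finally have mean: "(\<integral>\<eta>. indicator K \<eta> * (f \<eta> \<bullet> \<eta>) \<partial>lborel) \<le> r\<^sup>2 / 2 * measure lborel K" .
  define L where "L = {\<eta>. r\<^sup>2 < indicator K \<eta> * (f \<eta> \<bullet> \<eta>)}"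
  have [measurable]: "L \<in> sets borel" unfolding L_def by measurable
  have LK: "L \<subseteq> K"
    unfolding L_def using r by (auto simp: indicator_def split: if_splits)
  have "r\<^sup>2 * measure lborel L = (\<integral>\<eta>. r\<^sup>2 * indicator L \<eta> \<partial>lborel)" by simp
  also have "\<dots> \<le> (\<integral>\<eta>. indicator K \<eta> * (f \<eta> \<bullet> \<eta>) \<partial>lborel)"
  proof (rule integral_mono[OF _ F_int])
    show "integrable lborel (\<lambda>\<eta>. r\<^sup>2 * indicator L \<eta> :: real)"
      using emeasure_mono[OF LK, of lborel] fin by (intro integrable_mult_right integrable_real_indicator) auto
    show "r\<^sup>2 * indicator L \<eta> \<le> indicator K \<eta> * (f \<eta> \<bullet> \<eta>)" for \<eta>
      using psd[of \<eta>] by (auto simp: L_def indicator_def)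
  qed
  also note mean
  finally have "measure lborel L \<le> measure lborel K / 2" using r by simp
  moreover have "measure lborel (K - L) = measure lborel K - measure lborel L"
    using LK fin by (intro measure_Diff) auto
  ultimately have "measure lborel K / 2 \<le> measure lborel (K - L)" by simp
  then have "ennreal (measure lborel K / 2) \<le> ennreal (measure lborel (K - L))" by (rule ennreal_leI)
  also have "\<dots> = emeasure lborel (K - L)"
    using emeasure_mono[of "K - L" K lborel] fin by (intro emeasure_eq_ennreal_measure[symmetric]) (auto simp: top_unique)
  also have "\<dots> \<le> emeasure lborel {\<eta>. f \<eta> \<bullet> \<eta> \<le> r\<^sup>2}"
    by (intro emeasure_mono) (auto simp: L_def indicator_def split: if_splits)
  finally have main: "ennreal (measure lborel K / 2) \<le> emeasure lborel {\<eta>. f \<eta> \<bullet> \<eta> \<le> r\<^sup>2}" .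
  have sa: "0 < sum a Basis" using a by (intro sum_pos) auto
  have pa: "0 < prod a Basis" using a by (intro prod_pos) auto
  have "prod a Basis \<le> (sum a Basis / DIM('a)) ^ DIM('a)"
    using a by (intro prod_le_mean_power) auto
  then have "sqrt (prod a Basis) \<le> sqrt (sum a Basis / DIM('a)) ^ DIM('a)"
    by (metis real_sqrt_le_iff real_sqrt_power)
  moreover have "measure lborel K = unit_ball_vol DIM('a) * (r / sqrt 2) ^ DIM('a) / sqrt (prod a Basis)"
    using eK r pa by (simp add: measure_def)
  ultimately have "unit_ball_vol DIM('a) * (r / sqrt 2) ^ DIM('a) / sqrt (sum a Basis / DIM('a)) ^ DIM('a) \<le> measure lborel K"
    using pa r sa by (simp only:) (intro divide_left_mono, auto intro!: mult_pos_pos)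
  then have "ennreal (unit_ball_vol DIM('a) * (r / sqrt 2) ^ DIM('a) / sqrt (sum a Basis / DIM('a)) ^ DIM('a) / 2)
     \<le> ennreal (measure lborel K / 2)" by (intro ennreal_leI divide_right_mono) auto
  then show ?thesis using main unfolding a_def by (rule order_trans)
qed

lemma sum_Basis_matrix_form:
  fixes A :: "real^'n^'n"
  shows "(\<Sum>j\<in>Basis. (A *v j) \<bullet> j) = trace A"
proof -
  have "(\<Sum>j\<in>Basis. (A *v j) \<bullet> j) = (\<Sum>i\<in>UNIV. (A *v axis i 1) \<bullet> axis i 1)"
  proof -
    have B: "(Basis :: (real^'n) set) = (\<lambda>i. axis i 1) ` UNIV" by (auto simp: Basis_vec_def)
    have "inj (\<lambda>i::'n. axis i (1::real))" by (simp add: inj_def axis_eq_axis)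
    then show ?thesis by (simp only: B sum.reindex o_def)
  qed
  then show ?thesis by (simp add: inner_axis matrix_vector_mul_component trace_def)
qed

lemma nn_integral_lborel_shift:
  fixes a :: "'a::euclidean_space"
  assumes [measurable]: "f \<in> borel_measurable borel"
  shows "(\<integral>\<^sup>+x. f (a + x) \<partial>lborel) = (\<integral>\<^sup>+x. f x \<partial>lborel)"
proof -
  have "(\<integral>\<^sup>+x. f x \<partial>lborel) = (\<integral>\<^sup>+x. f x \<partial>distr lborel borel ((+) a))"
    by (simp add: lborel_distr_plus)
  also have "\<dots> = (\<integral>\<^sup>+x. f (a + x) \<partial>lborel)" by (subst nn_integral_distr) auto
  finally show ?thesis ..
qed

text \<open>With \<open>w = sqrt (p / u) *\<^sub>R (matrix_inv A *v x)\<close>, both translates by \<open>\<plusminus>w/2\<close> of the ellipsoid shrunk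
  by the factor \<open>1/2\<close> lie in the ellipsoid, and at each point one of the two translations
  makes \<open>\<bar>\<theta> \<bullet> x\<bar>\<close> at least \<open>sqrt (p * u) / 2\<close>.\<close>
lemma ellipsoid_moment_lower_bound:
  fixes A :: "real^'n^'n" and x :: "real^'n"
  assumes A: "pos_semidef A" "invertible A" and p: "0 < p" and m: "0 \<le> m"
  defines "u \<equiv> (matrix_inv A *v x) \<bullet> x"
  shows "ennreal ((sqrt (p * u) / 2) powr m * (unit_ball_vol CARD('n) * (sqrt p / 2 / sqrt 2) ^ CARD('n) / sqrt (trace A / CARD('n)) ^ CARD('n)) / 4)
     \<le> (\<integral>\<^sup>+\<theta>. indicator {\<theta>. (A *v \<theta>) \<bullet> \<theta> \<le> p} \<theta> * ennreal (\<bar>\<theta> \<bullet> x\<bar> powr m) \<partial>lborel)"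
proof (cases "x = 0")
  case True
  then show ?thesis by (simp add: u_def)
next
  case False
  then have u: "u > 0" unfolding u_def by (rule pos_semidef_matrix_inv_pos[OF A])
  define F where "F = (\<lambda>\<theta>. indicator {\<theta>. (A *v \<theta>) \<bullet> \<theta> \<le> p} \<theta> * ennreal (\<bar>\<theta> \<bullet> x\<bar> powr m))"
  have [measurable]: "F \<in> borel_measurable borel" unfolding F_def by measurable
  define h where "h = (sqrt (p / u) / 2) *\<^sub>R (matrix_inv A *v x)"
  define H where "H = {\<eta>. (A *v \<eta>) \<bullet> \<eta> \<le> (sqrt p / 2)\<^sup>2}"
  have [measurable]: "H \<in> sets borel" unfolding H_def by measurable
  define c where "c = (sqrt (p * u) / 2) powr m"
  have hx: "h \<bullet> x = sqrt (p * u) / 2"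
    using u p by (simp add: h_def u_def[symmetric] real_sqrt_mult real_sqrt_divide field_simps)
  have hh: "(A *v h) \<bullet> h = p / 4"
    proof -
    define s where "s = sqrt (p / u)"
    have "(A *v h) \<bullet> h = (s / 2) * ((s / 2) * (x \<bullet> (matrix_inv A *v x)))"
      using A(2) by (simp add: h_def s_def matrix_vector_mult_scaleR)
    also have "x \<bullet> (matrix_inv A *v x) = u" by (simp add: u_def inner_commute)
    also have "s / 2 * (s / 2 * u) = s\<^sup>2 * u / 4" by (simp add: power2_eq_square)
    also have "s\<^sup>2 = p / u" using u p by (simp add: s_def)
    also have "p / u * u / 4 = p / 4" using u by simp
    finally show ?thesis .
  qed
  \<comment> \<open>Parallelogram inequality for a nonnegative form: two vectors of level
    \<open>p / 4\<close> have a sum of level at most \<open>p\<close>.\<close>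
  have sub: "(A *v (a + b)) \<bullet> (a + b) \<le> 2 * ((A *v a) \<bullet> a) + 2 * ((A *v b) \<bullet> b)" for a b
  proof -
    have "0 \<le> (A *v (a - b)) \<bullet> (a - b)" using A(1) unfolding pos_semidef_def by blast
    then show ?thesis
      by (simp add: matrix_vector_right_distrib matrix_vector_mult_diff_distrib
          inner_add_left inner_add_right inner_diff_left inner_diff_right)
  qed
  have low: "ennreal c * indicator H \<eta> \<le> F (h + \<eta>) + F (- h + \<eta>)" for \<eta>
  proof (cases "\<eta> \<in> H")
    case True
    then have e: "(A *v \<eta>) \<bullet> \<eta> \<le> p / 4" using p by (simp add: H_def power_divide)
    have "(A *v (- h)) \<bullet> (- h) = p / 4" using hh by (simp add: vec.neg)
    then have in1: "(A *v (h + \<eta>)) \<bullet> (h + \<eta>) \<le> p" "(A *v (- h + \<eta>)) \<bullet> (- h + \<eta>) \<le> p"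
      using sub[of h \<eta>] sub[of "- h" \<eta>] hh e by linarith+
    show ?thesis
    proof (cases "0 \<le> \<eta> \<bullet> x")
      case True
      then have "sqrt (p * u) / 2 \<le> \<bar>(h + \<eta>) \<bullet> x\<bar>" unfolding inner_add_left hx by linarith
      then have "c \<le> \<bar>(h + \<eta>) \<bullet> x\<bar> powr m"
        unfolding c_def using u p m by (intro powr_mono2) auto
      then have "ennreal c \<le> F (h + \<eta>)" using in1 by (simp add: F_def ennreal_leI)
      then show ?thesis using \<open>\<eta> \<in> H\<close> by (simp add: add_increasing2)
    next
      case False
      then have "sqrt (p * u) / 2 \<le> \<bar>(- h + \<eta>) \<bullet> x\<bar>"
        unfolding inner_add_left inner_minus_left hx by linarith
      then have "c \<le> \<bar>(- h + \<eta>) \<bullet> x\<bar> powr m"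
        unfolding c_def using u p m by (intro powr_mono2) auto
      then have "ennreal c \<le> F (- h + \<eta>)" using in1 by (simp add: F_def ennreal_leI)
      then show ?thesis using \<open>\<eta> \<in> H\<close> by (simp add: add_increasing)
    qed
  qed simp
  have "ennreal c * emeasure lborel H = (\<integral>\<^sup>+\<eta>. ennreal c * indicator H \<eta> \<partial>lborel)"
    by (simp add: nn_integral_cmult)
  also have "\<dots> \<le> (\<integral>\<^sup>+\<eta>. F (h + \<eta>) + F (- h + \<eta>) \<partial>lborel)"
    by (intro nn_integral_mono low)
  also have "\<dots> = 2 * (\<integral>\<^sup>+\<theta>. F \<theta> \<partial>lborel)"
    using nn_integral_lborel_shift[of F "h"] nn_integral_lborel_shift[of F "- h"]
    by (simp add: nn_integral_add mult_2)
  \<comment> \<open>One half comes from using two translates for a single integral, another from the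
    volume bound for \<open>H\<close>: hence the 4 in the statement.\<close>
  finally have "ennreal (1/2) * (ennreal c * emeasure lborel H) \<le> ennreal (1/2) * (2 * (\<integral>\<^sup>+\<theta>. F \<theta> \<partial>lborel))"
    by (rule mult_left_mono) simp
  also have "\<dots> = ennreal (1/2 * 2) * (\<integral>\<^sup>+\<theta>. F \<theta> \<partial>lborel)"
    by (subst ennreal_mult) (auto simp: mult.assoc simp del: ennreal_half)
  finally have "ennreal (1/2) * (ennreal c * emeasure lborel H) \<le> (\<integral>\<^sup>+\<theta>. F \<theta> \<partial>lborel)" by simp
  moreover define V where "V = unit_ball_vol CARD('n) * (sqrt p / 2 / sqrt 2) ^ CARD('n) / sqrt (trace A / CARD('n)) ^ CARD('n)"
  moreover have "ennreal (V / 2) \<le> emeasure lborel H"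
  proof -
    have psd: "0 \<le> (A *v y) \<bullet> y" for y using A(1) unfolding pos_semidef_def by blast
    have "0 < (A *v j) \<bullet> j" if "j \<in> Basis" for j
      using psd[of j] that pos_semidef_invertible_iff[OF A(1)] A(2) nonzero_Basis
      by (metis order_le_less)
    from emeasure_ellipsoid_ge[OF matrix_vector_mul_linear psd this, of "sqrt p / 2"] p
    show ?thesis by (simp add: H_def V_def sum_Basis_matrix_form)
  qed
  moreover have c: "0 \<le> c" by (simp add: c_def)
  ultimately have "ennreal (1/2) * (ennreal c * ennreal (V / 2)) \<le> (\<integral>\<^sup>+\<theta>. F \<theta> \<partial>lborel)"
    by (meson order_trans mult_left_mono zero_le)
  moreover have "ennreal (1/2) * (ennreal c * ennreal (V / 2)) = ennreal (c * V / 4)"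
    using c by (simp add: ennreal_mult''[symmetric] ennreal_mult'[symmetric] del: ennreal_half)
  ultimately show ?thesis by (simp only: F_def c_def V_def)
qed

text \<open>Dyadic balls: their volumes grow by \<open>2 ^ d\<close> per step, the integrand decays
  at least by \<open>2 ^ (d + 1)\<close>, and the remaining ratio 1/2 is summable. Asking for
  \<open>d + 1\<close> rather than just more than \<open>d\<close> makes the bound independent of
  \<open>q\<close>.\<close>

lemma nn_integral_radial_power_le:
  fixes D q :: real
  assumes D: "0 < D" and q: "real DIM('a) + 1 \<le> q"
  shows "(\<integral>\<^sup>+\<theta>. ennreal (if norm \<theta> \<le> D then 1 else (D / norm \<theta>) powr q) \<partial>(lborel :: 'a::euclidean_space measure))
     \<le> ennreal (2 ^ (DIM('a) + 2) * D ^ DIM('a) * unit_ball_vol DIM('a))"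
proof -
  define d where "d = DIM('a)"
  \<comment> \<open>The prefactor \<open>2 ^ (d + 1)\<close> accounts for the index shift: a point
    whose least index is \<open>j > 0\<close> is only known to have norm above
    \<open>2 ^ (j - 1) * D\<close>. The geometric series adds the last factor 2.\<close>
  define c where "c = (\<lambda>j::nat. 2 ^ (d + 1) * ((1/2) ^ (d + 1)) ^ j :: real)"
  have pw: "ennreal (if norm \<theta> \<le> D then 1 else (D / norm \<theta>) powr q)
      \<le> (\<Sum>j. ennreal (c j) * indicator (cball 0 (2 ^ j * D)) \<theta>)" for \<theta> :: 'a
  proof -
    obtain j0 where j0: "norm \<theta> / D < 2 ^ j0" using real_arch_pow[of 2 "norm \<theta> / D"] by auto
    define j where "j = (LEAST j. norm \<theta> \<le> 2 ^ j * D)"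
    have ex: "norm \<theta> \<le> 2 ^ j0 * D" using j0 D by (simp add: field_simps)
    then have j: "norm \<theta> \<le> 2 ^ j * D" unfolding j_def by (rule LeastI)
    have "(if norm \<theta> \<le> D then 1 else (D / norm \<theta>) powr q) \<le> c j"
    proof (cases "norm \<theta> \<le> D")
      case True
      then have "j = 0" unfolding j_def by (intro Least_equality) auto
      have "(1::real) \<le> 2 ^ (d + 1)" by (rule one_le_power) simp
      then show ?thesis using True \<open>j = 0\<close> by (simp add: c_def)
    next
      case False
      then have "j \<noteq> 0" using j by (metis mult_1 power_0)
      then obtain i where i: "j = Suc i" by (metis not0_implies_Suc)
      have "i < j" by (simp add: i)
      then have "\<not> norm \<theta> \<le> 2 ^ i * D" unfolding j_def by (rule not_less_Least)
      moreover have np: "0 < norm \<theta>" using False D by linarith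
      ultimately have 1: "D / norm \<theta> \<le> (1/2) ^ i" using D by (simp add: field_simps power_one_over)
      have pos: "0 < D / norm \<theta>" "D / norm \<theta> \<le> 1" using False D np by auto
      have "(D / norm \<theta>) powr q \<le> (D / norm \<theta>) powr (real (d + 1))"
        using pos q by (intro powr_mono') (auto simp: d_def)
      also have "\<dots> = (D / norm \<theta>) ^ (d + 1)" using pos by (simp only: powr_realpow)
      also have "\<dots> \<le> ((1/2) ^ i) ^ (d + 1)" using 1 pos by (intro power_mono) auto
      also have "\<dots> = c j" unfolding c_def i
        by (simp add: power_mult_distrib power_mult[symmetric] mult.commute power_one_over)
      finally show ?thesis using False by simp
    qed
    then have "ennreal (if norm \<theta> \<le> D then 1 else (D / norm \<theta>) powr q)
        \<le> ennreal (c j) * indicator (cball 0 (2 ^ j * D)) \<theta>"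
      using j by (simp add: ennreal_leI)
    also have "\<dots> = (\<Sum>i\<in>{j}. ennreal (c i) * indicator (cball 0 (2 ^ i * D)) \<theta>)"
      by (simp only: sum.insert[OF finite.emptyI] empty_iff not_False_eq_True sum.empty add_0_right)
    also have "\<dots> \<le> (\<Sum>i. ennreal (c i) * indicator (cball 0 (2 ^ i * D)) \<theta>)"
      by (intro sum_le_suminf) auto
    finally show ?thesis .
  qed
  define V where "V = 2 ^ (d + 1) * D ^ d * unit_ball_vol d"
  have V: "V \<ge> 0" using D by (simp add: V_def)
  have "(\<integral>\<^sup>+\<theta>. ennreal (if norm \<theta> \<le> D then 1 else (D / norm \<theta>) powr q) \<partial>(lborel :: 'a measure))
      \<le> (\<integral>\<^sup>+\<theta>. (\<Sum>j. ennreal (c j) * indicator (cball 0 (2 ^ j * D)) \<theta>) \<partial>(lborel :: 'a measure))"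
    by (intro nn_integral_mono pw)
  also have "\<dots> = (\<Sum>j. ennreal (c j) * emeasure lborel (cball (0::'a) (2 ^ j * D)))"
  proof -
    have [measurable]: "cball (0::'a) s \<in> sets borel" for s by simp
    show ?thesis by (subst nn_integral_suminf) (measurable, simp add: nn_integral_cmult_indicator)
  qed
  also have "\<dots> = (\<Sum>j. ennreal (V * (1/2) ^ j))"
  proof (rule arg_cong[where f=suminf], rule ext)
    fix j
    have "ennreal (c j) * emeasure lborel (cball (0::'a) (2 ^ j * D)) =
        ennreal (c j * (unit_ball_vol d * (2 ^ j * D) ^ d))"
      using D by (simp add: emeasure_cball d_def c_def ennreal_mult)
    also have "c j * (unit_ball_vol d * (2 ^ j * D) ^ d) = V * ((1/2) ^ (d * j) * (2 ^ (j * d)) * (1/2) ^ j)"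
    proof -
      have "((1/2) ^ (d + 1)) ^ j = (1/2) ^ (d * j) * ((1/2) ^ j :: real)"
        by (simp only: power_mult[symmetric] power_add[symmetric]) (simp add: algebra_simps)
      then show ?thesis
        by (simp only: c_def V_def power_mult_distrib power_mult[symmetric] mult_ac)
    qed
    also have "\<dots> = V * (1/2) ^ j" by (simp add: mult.commute[of d j] power_one_over)
    finally show "ennreal (c j) * emeasure lborel (cball (0::'a) (2 ^ j * D)) = ennreal (V * (1/2) ^ j)" .
  qed
  also have "\<dots> = ennreal (\<Sum>j. V * (1/2) ^ j)"
    using V by (intro suminf_ennreal2) (auto intro!: summable_mult summable_geometric)
  also have "(\<Sum>j. V * (1/2) ^ j) = V * 2"
    by (subst suminf_mult) (auto simp: suminf_geometric)
  finally show ?thesis by (simp add: V_def d_def mult_ac)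
qed

text \<open>Integrate \<open>exp (- y) = (\<integral>t\<ge>y. exp (- t))\<close> and use \<open>t powr \<beta> \<le> 1 - \<beta> + \<beta> * t\<close>.\<close>
lemma (in prob_space) laplace_transform_small_ball:
  fixes Z :: "'a \<Rightarrow> real"
  assumes [measurable]: "Z \<in> borel_measurable M" and Z: "\<And>\<omega>. \<omega> \<in> space M \<Longrightarrow> 0 \<le> Z \<omega>"
    and small: "\<And>t. 0 < t \<Longrightarrow> prob {\<omega> \<in> space M. Z \<omega> \<le> t} \<le> c * t powr \<beta>"
    and \<beta>: "0 < \<beta>" "\<beta> \<le> 1" and c: "0 \<le> c"
  shows "(\<integral>\<^sup>+\<omega>. ennreal (exp (- Z \<omega>)) \<partial>M) \<le> ennreal c"
proof -
  have "(\<integral>\<^sup>+\<omega>. ennreal (exp (- Z \<omega>)) \<partial>M) =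
      (\<integral>\<^sup>+\<omega>. (\<integral>\<^sup>+t. indicator {0..} t * (ennreal (exp (- t)) * indicator {Z \<omega>..} t) \<partial>lborel) \<partial>M)"
  proof (intro nn_integral_cong)
    fix \<omega> assume \<omega>: "\<omega> \<in> space M"
    have "(\<integral>\<^sup>+t. ennreal (exp (- t)) * indicator {Z \<omega>..} t \<partial>lborel) = ennreal (0 - (- exp (- Z \<omega>)))"
    proof (rule nn_integral_FTC_atLeast[where F="\<lambda>t. - exp (- t)"])
      show "((\<lambda>t::real. - exp (- t)) \<longlongrightarrow> 0) at_top" by real_asymp
    qed (auto intro!: derivative_eq_intros)
    also have "(\<integral>\<^sup>+t. ennreal (exp (- t)) * indicator {Z \<omega>..} t \<partial>lborel) =
        (\<integral>\<^sup>+t. indicator {0..} t * (ennreal (exp (- t)) * indicator {Z \<omega>..} t) \<partial>lborel)"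
      using Z[OF \<omega>] by (intro nn_integral_cong) (auto simp: indicator_def)
    finally show "ennreal (exp (- Z \<omega>)) = (\<integral>\<^sup>+t. indicator {0..} t * (ennreal (exp (- t)) * indicator {Z \<omega>..} t) \<partial>lborel)"
      by simp
  qed
  also have "\<dots> = (\<integral>\<^sup>+t. (\<integral>\<^sup>+\<omega>. indicator {0..} t * (ennreal (exp (- t)) * indicator {Z \<omega>..} t) \<partial>M) \<partial>lborel)"
    by (rule pair_sigma_finite.Fubini'[symmetric])
       (auto simp: pair_sigma_finite_def lborel.sigma_finite_measure_axioms sigma_finite_measure_axioms indicator_def)
  also have "\<dots> \<le> (\<integral>\<^sup>+t. ennreal (c * ((1 - \<beta> + \<beta> * t) * exp (- t))) * indicator {0..} t \<partial>lborel)"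
  \<comment> \<open>The point \<open>t = 0\<close> is discarded because the small ball bound is
    given for \<open>0 < t\<close>.\<close>
  proof (rule nn_integral_mono_AE, rule AE_mp[OF AE_lborel_singleton[of 0]], rule AE_I2, rule impI)
    fix t :: real assume t0: "t \<noteq> 0"
    show "(\<integral>\<^sup>+\<omega>. indicator {0..} t * (ennreal (exp (- t)) * indicator {Z \<omega>..} t) \<partial>M) \<le>
        ennreal (c * ((1 - \<beta> + \<beta> * t) * exp (- t))) * indicator {0..} t"
    proof (cases "0 < t")
      case True
      have "(\<integral>\<^sup>+\<omega>. indicator {0..} t * (ennreal (exp (- t)) * indicator {Z \<omega>..} t) \<partial>M) =
          (\<integral>\<^sup>+\<omega>. ennreal (exp (- t)) * indicator {\<omega> \<in> space M. Z \<omega> \<le> t} \<omega> \<partial>M)"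
        using True by (intro nn_integral_cong) (auto simp: indicator_def)
      also have "\<dots> = ennreal (exp (- t)) * emeasure M {\<omega> \<in> space M. Z \<omega> \<le> t}"
        by (simp add: nn_integral_cmult)
      also have "\<dots> = ennreal (exp (- t) * prob {\<omega> \<in> space M. Z \<omega> \<le> t})"
        by (simp add: emeasure_eq_measure ennreal_mult)
      also have "\<dots> \<le> ennreal (c * ((1 - \<beta> + \<beta> * t) * exp (- t)))"
      proof (rule ennreal_leI)
        have "t powr \<beta> * 1 powr (1 - \<beta>) \<le> \<beta> * t + (1 - \<beta>) * 1"
          using \<beta> True by (intro Youngs_inequality_0) auto
        then have "c * t powr \<beta> \<le> c * (1 - \<beta> + \<beta> * t)" using c by (intro mult_left_mono) auto
        with small[OF True] have "prob {\<omega> \<in> space M. Z \<omega> \<le> t} \<le> c * (1 - \<beta> + \<beta> * t)" by linarith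
        then have "exp (- t) * prob {\<omega> \<in> space M. Z \<omega> \<le> t} \<le> exp (- t) * (c * (1 - \<beta> + \<beta> * t))"
          by (intro mult_left_mono) auto
        then show "exp (- t) * prob {\<omega> \<in> space M. Z \<omega> \<le> t} \<le> c * ((1 - \<beta> + \<beta> * t) * exp (- t))"
          by (simp add: mult_ac)
      qed
      finally show ?thesis using True by simp
    qed (use t0 in simp)
  qed
  \<comment> \<open>Against \<open>exp (- t)\<close> the affine majorant of
    \<open>t powr \<beta>\<close> integrates to exactly 1, so the constant stays \<open>c\<close>
    and no Gamma function appears.\<close>
  also have "\<dots> = ennreal (0 - (- c * (1 + \<beta> * 0) * exp (- 0)))"
  proof (rule nn_integral_FTC_atLeast[where F="\<lambda>t. - c * (1 + \<beta> * t) * exp (- t)"])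
    show "((\<lambda>t. - c * (1 + \<beta> * t) * exp (- t)) \<longlongrightarrow> 0) at_top" by real_asymp
    show "DERIV (\<lambda>t. - c * (1 + \<beta> * t) * exp (- t)) x :> c * ((1 - \<beta> + \<beta> * x) * exp (- x))" for x
      by (auto intro!: derivative_eq_intros simp: algebra_simps)
    show "0 \<le> c * ((1 - \<beta> + \<beta> * x) * exp (- x))" if "0 \<le> x" for x
      using that \<beta> c by auto
  qed measurable
  finally show ?thesis by simp
qed

subsection \<open>Second moment of the leverage\<close>

text \<open>Young's inequality twice, with the third weight on the number 1. As the right side is
  linear in \<open>x\<close> and \<open>y\<close>, it can be integrated with first moments only, in
  place of Hoelder's inequality.\<close>

lemma weighted_AM_GM_3:
  fixes a b x y :: real
  assumes "0 \<le> a" "0 \<le> b" "a + b \<le> 1" "0 < x" "0 < y"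
  shows "x powr a * y powr b \<le> a * x + b * y + (1 - a - b)"
proof (cases "a + b = 0")
  case True
  then have "a = 0" "b = 0" using assms by auto
  then show ?thesis using assms by simp
next
  case False
  define s where "s = a + b"
  have s: "0 < s" "s \<le> 1" using False assms by (auto simp: s_def)
  define z where "z = x powr (a / s) * y powr (b / s)"
  have z0: "0 < z" using assms by (simp add: z_def)
  have "a / s + b / s = 1" using s by (simp add: s_def add_divide_distrib[symmetric])
  then have z: "z \<le> a / s * x + b / s * y"
    unfolding z_def using assms s by (intro Youngs_inequality_0) auto
  have "z powr s * 1 powr (1 - s) \<le> s * z + (1 - s) * 1"
    using s z0 by (intro Youngs_inequality_0) auto
  also have "s * z \<le> s * (a / s * x + b / s * y)" using z s by (intro mult_left_mono) auto
  also have "\<dots> = a * x + b * y" using s by (simp add: field_simps)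
  also have "z powr s * 1 powr (1 - s) = x powr a * y powr b"
    using s assms by (simp add: z_def powr_mult powr_powr)
  finally show ?thesis by (simp add: s_def)
qed

lemma trace_pos:
  fixes A :: "real^'n^'n"
  assumes "pos_semidef A" "invertible A"
  shows "0 < trace A"
proof -
  have "0 < (A *v j) \<bullet> j" if "j \<in> Basis" for j
  proof -
    have "0 \<le> (A *v j) \<bullet> j" using assms(1) unfolding pos_semidef_def by blast
    then show ?thesis
      using that pos_semidef_invertible_iff[OF assms(1)] assms(2) nonzero_Basis by (metis order_le_less)
  qed
  then have "0 < (\<Sum>j\<in>(Basis :: (real^'n) set). (A *v j) \<bullet> j)" by (intro sum_pos) auto
  then show ?thesis by (simp add: sum_Basis_matrix_form)
qed

lemma nn_integral_PiM_component:
  assumes "\<And>i. i \<in> I \<Longrightarrow> prob_space (N i)" "i \<in> I" and [measurable]: "f \<in> borel_measurable (N i)"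
  shows "(\<integral>\<^sup>+z. f (z i) \<partial>PiM I N) = (\<integral>\<^sup>+x. f x \<partial>N i)"
proof -
  have "(\<integral>\<^sup>+x. f x \<partial>N i) = (\<integral>\<^sup>+x. f x \<partial>distr (PiM I N) (N i) (\<lambda>z. z i))"
    using assms by (subst distr_PiM_component) auto
  also have "\<dots> = (\<integral>\<^sup>+z. f (z i) \<partial>PiM I N)"
    using assms(2) by (subst nn_integral_distr) auto
  finally show ?thesis ..
qed

text \<open>\<open>\<xi>\<close> is to be the whitened covariate of an observation; observations
  stay abstract because those of the regression are pairs. The small ball condition is put in the
  form that the Laplace transform of \<open>(\<xi> b \<bullet> \<theta>)\<^sup>2\<close> uses,
  instead of distances to hyperplanes.\<close>

locale small_ball_sample = prob_space \<mu> for \<mu> :: "'b measure" +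
  fixes \<xi> :: "'b \<Rightarrow> real^'n" and C \<alpha> :: real and I :: "'i set"
  assumes \<xi>_measurable [measurable]: "\<xi> \<in> borel_measurable \<mu>"
    and C: "1 \<le> C" and \<alpha>: "0 < \<alpha>" "\<alpha> \<le> 1"
    and small_ball: "\<And>\<theta> t. \<theta> \<noteq> 0 \<Longrightarrow> 0 < t \<Longrightarrow>
          prob {b \<in> space \<mu>. \<bar>\<xi> b \<bullet> \<theta>\<bar> \<le> t * norm \<theta>} \<le> (C * t) powr \<alpha>"
    and finite_I: "finite I"
begin

abbreviation sample :: "('i \<Rightarrow> 'b) measure" where "sample \<equiv> PiM I (\<lambda>_. \<mu>)"
abbreviation G :: "('i \<Rightarrow> 'b) \<Rightarrow> real^'n^'n" where "G z \<equiv> gram I (\<lambda>i. \<xi> (z i))"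
text \<open>Serves both as the level of the ellipsoid and as the exponent with which the probability
  of \<open>\<theta>\<close> lying in it decays.\<close>

definition p :: real where "p = \<alpha> * card I"
abbreviation D :: real where "D \<equiv> sqrt 2 * C"

interpretation S: prob_space sample by (intro prob_space_PiM prob_space_axioms)
interpretation PS: product_sigma_finite "\<lambda>_::'i. \<mu>" by (rule product_sigma_finite.intro) (rule sigma_finite_measure_axioms)

lemma D_pos: "0 < D" using C by simp

text \<open>Passing to the halved square turns the exponent \<open>\<alpha>\<close> into
  \<open>\<alpha> / 2\<close> and the threshold into \<open>sqrt (2 * t)\<close>; the latter is the
  origin of \<open>sqrt 2\<close> in \<open>D\<close>.\<close>

lemma laplace_le:
  assumes "\<theta> \<noteq> 0"
  shows "(\<integral>\<^sup>+b. ennreal (exp (- ((\<xi> b \<bullet> \<theta>)\<^sup>2 / 2))) \<partial>\<mu>) \<le> ennreal ((D / norm \<theta>) powr \<alpha>)"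
proof (rule laplace_transform_small_ball[where \<beta> = "\<alpha> / 2"])
  fix t :: real assume t: "0 < t"
  have "(\<xi> b \<bullet> \<theta>)\<^sup>2 / 2 \<le> t \<longleftrightarrow> \<bar>\<xi> b \<bullet> \<theta>\<bar> \<le> (sqrt (2 * t) / norm \<theta>) * norm \<theta>" for b
  proof -
    have "(\<xi> b \<bullet> \<theta>)\<^sup>2 / 2 \<le> t \<longleftrightarrow> (\<xi> b \<bullet> \<theta>)\<^sup>2 \<le> (sqrt (2 * t))\<^sup>2" using t by auto
    also have "\<dots> \<longleftrightarrow> \<bar>\<xi> b \<bullet> \<theta>\<bar> \<le> sqrt (2 * t)"
      using t by (metis abs_le_square_iff abs_of_nonneg real_sqrt_ge_zero less_imp_le zero_less_mult_iff zero_less_numeral)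
    finally show ?thesis using assms by simp
  qed
  then have "prob {b \<in> space \<mu>. (\<xi> b \<bullet> \<theta>)\<^sup>2 / 2 \<le> t} \<le> (C * (sqrt (2 * t) / norm \<theta>)) powr \<alpha>"
    using small_ball[OF assms, of "sqrt (2 * t) / norm \<theta>"] t assms by simp
  also have "C * (sqrt (2 * t) / norm \<theta>) = (D / norm \<theta>) * t powr (1 / 2)"
    using t by (simp add: powr_half_sqrt real_sqrt_mult)
  also have "\<dots> powr \<alpha> = (D / norm \<theta>) powr \<alpha> * t powr (\<alpha> / 2)"
    by (simp only: powr_mult powr_powr) simp
  finally show "prob {b \<in> space \<mu>. (\<xi> b \<bullet> \<theta>)\<^sup>2 / 2 \<le> t} \<le> (D / norm \<theta>) powr \<alpha> * t powr (\<alpha> / 2)" .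
qed (use \<alpha> in auto)

text \<open>Chernoff's bound with parameter 1/2 and independence. For
  \<open>norm \<theta> \<le> D\<close> the trivial bound 1 is weakened by \<open>exp (p / 2)\<close>
  to give both cases the same prefactor.\<close>

lemma form_tail_le:
  "emeasure sample {z \<in> space sample. (G z *v \<theta>) \<bullet> \<theta> \<le> p}
     \<le> ennreal (exp (p / 2) * (if norm \<theta> \<le> D then 1 else (D / norm \<theta>) powr p))"
proof (cases "norm \<theta> \<le> D")
  case True
  have "emeasure sample {z \<in> space sample. (G z *v \<theta>) \<bullet> \<theta> \<le> p} \<le> 1" by (rule S.emeasure_le_1)
  also have "1 \<le> ennreal (exp (p / 2))" using \<alpha> by (simp add: p_def)
  finally show ?thesis using True by simp
next
  case False
  then have \<theta>: "\<theta> \<noteq> 0" using D_pos by auto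
  have "emeasure sample {z \<in> space sample. (G z *v \<theta>) \<bullet> \<theta> \<le> p}
      = (\<integral>\<^sup>+z. indicator {z \<in> space sample. (G z *v \<theta>) \<bullet> \<theta> \<le> p} z \<partial>sample)" by simp
  also have "\<dots> \<le> (\<integral>\<^sup>+z. ennreal (exp (p / 2)) * (\<Prod>i\<in>I. ennreal (exp (- ((\<xi> (z i) \<bullet> \<theta>)\<^sup>2 / 2)))) \<partial>sample)"
  proof (intro nn_integral_mono)
    fix z
    have "ennreal (exp (p / 2)) * (\<Prod>i\<in>I. ennreal (exp (- ((\<xi> (z i) \<bullet> \<theta>)\<^sup>2 / 2))))
        = ennreal (exp (p / 2 + - (((G z *v \<theta>) \<bullet> \<theta>) / 2)))"
      by (simp only: gram_form exp_add prod_ennreal exp_ge_zero ennreal_mult exp_sum[OF finite_I, symmetric]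
        sum_divide_distrib sum_negf)
    moreover have "1 \<le> ennreal (exp (p / 2 + - (((G z *v \<theta>) \<bullet> \<theta>) / 2)))" if "(G z *v \<theta>) \<bullet> \<theta> \<le> p"
      using that by simp
    ultimately show "indicator {z \<in> space sample. (G z *v \<theta>) \<bullet> \<theta> \<le> p} z
        \<le> ennreal (exp (p / 2)) * (\<Prod>i\<in>I. ennreal (exp (- ((\<xi> (z i) \<bullet> \<theta>)\<^sup>2 / 2))))"
      by (auto simp: indicator_def)
  qed
  also have "\<dots> = ennreal (exp (p / 2)) * (\<integral>\<^sup>+z. (\<Prod>i\<in>I. ennreal (exp (- ((\<xi> (z i) \<bullet> \<theta>)\<^sup>2 / 2)))) \<partial>sample)"
    by (rule nn_integral_cmult) measurable
  also have "(\<integral>\<^sup>+z. (\<Prod>i\<in>I. ennreal (exp (- ((\<xi> (z i) \<bullet> \<theta>)\<^sup>2 / 2)))) \<partial>sample)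
      = (\<Prod>i\<in>I. (\<integral>\<^sup>+b. ennreal (exp (- ((\<xi> b \<bullet> \<theta>)\<^sup>2 / 2))) \<partial>\<mu>))"
    by (rule PS.product_nn_integral_prod[OF finite_I, of "\<lambda>_ b. ennreal (exp (- ((\<xi> b \<bullet> \<theta>)\<^sup>2 / 2)))"]) measurable
  also have "\<dots> \<le> (\<Prod>i\<in>I. ennreal ((D / norm \<theta>) powr \<alpha>))"
    by (intro prod_mono_ennreal laplace_le[OF \<theta>])
  also have "\<dots> = ennreal ((D / norm \<theta>) powr p)"
    using C \<theta> by (simp add: p_def prod_ennreal powr_powr[symmetric] powr_realpow ennreal_power)
  finally have "emeasure sample {z \<in> space sample. (G z *v \<theta>) \<bullet> \<theta> \<le> p} \<le> ennreal (exp (p / 2)) * ennreal ((D / norm \<theta>) powr p)"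
    by (simp add: mult_left_mono)
  then show ?thesis using False by (simp add: ennreal_mult)
qed

text \<open>Fubini brings the expectation inside, where \<open>\<theta>\<close> is fixed and the
  tail bound applies. Cauchy-Schwarz spends \<open>m\<close> powers of the decay; the remaining
  \<open>p - m\<close> have to be integrable at infinity.\<close>

lemma ellipsoid_moment_upper_bound:
  fixes x :: "real^'n"
  assumes m: "0 \<le> m" "real CARD('n) + 1 \<le> p - m"
  shows "(\<integral>\<^sup>+z. (\<integral>\<^sup>+\<theta>. indicator {\<theta>. (G z *v \<theta>) \<bullet> \<theta> \<le> p} \<theta> * ennreal (\<bar>\<theta> \<bullet> x\<bar> powr m) \<partial>lborel) \<partial>sample)
    \<le> ennreal (exp (p / 2) * (D * norm x) powr m * (2 ^ (CARD('n) + 2) * D ^ CARD('n) * unit_ball_vol CARD('n)))"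
proof -
  interpret PR: pair_sigma_finite sample "lborel :: (real^'n) measure"
    by (simp add: pair_sigma_finite_def lborel.sigma_finite_measure_axioms S.sigma_finite_measure_axioms)
  define q where "q = (\<lambda>\<theta>::real^'n. if norm \<theta> \<le> D then 1 else (D / norm \<theta>) powr (p - m))"
  have "(\<integral>\<^sup>+z. (\<integral>\<^sup>+\<theta>. indicator {\<theta>. (G z *v \<theta>) \<bullet> \<theta> \<le> p} \<theta> * ennreal (\<bar>\<theta> \<bullet> x\<bar> powr m) \<partial>lborel) \<partial>sample)
    = (\<integral>\<^sup>+z. (\<integral>\<^sup>+\<theta>. (if (G z *v \<theta>) \<bullet> \<theta> \<le> p then ennreal (\<bar>\<theta> \<bullet> x\<bar> powr m) else 0) \<partial>lborel) \<partial>sample)"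
    by (intro nn_integral_cong) (auto simp: indicator_def)
  also have "\<dots> = (\<integral>\<^sup>+\<theta>. (\<integral>\<^sup>+z. (if (G z *v \<theta>) \<bullet> \<theta> \<le> p then ennreal (\<bar>\<theta> \<bullet> x\<bar> powr m) else 0) \<partial>sample) \<partial>lborel)"
    by (rule PR.Fubini'[symmetric]) measurable
  also have "\<dots> \<le> (\<integral>\<^sup>+\<theta>. ennreal (exp (p / 2) * (D * norm x) powr m) * ennreal (q \<theta>) \<partial>lborel)"
  proof (intro nn_integral_mono)
    fix \<theta> :: "real^'n"
    have "(\<integral>\<^sup>+z. (if (G z *v \<theta>) \<bullet> \<theta> \<le> p then ennreal (\<bar>\<theta> \<bullet> x\<bar> powr m) else 0) \<partial>sample)
        = (\<integral>\<^sup>+z. ennreal (\<bar>\<theta> \<bullet> x\<bar> powr m) * indicator {z \<in> space sample. (G z *v \<theta>) \<bullet> \<theta> \<le> p} z \<partial>sample)"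
      by (intro nn_integral_cong) (auto simp: indicator_def)
    also have "\<dots> = ennreal (\<bar>\<theta> \<bullet> x\<bar> powr m) * emeasure sample {z \<in> space sample. (G z *v \<theta>) \<bullet> \<theta> \<le> p}"
      by (rule nn_integral_cmult_indicator) measurable
    also have "\<dots> \<le> ennreal (\<bar>\<theta> \<bullet> x\<bar> powr m) * ennreal (exp (p / 2) * (if norm \<theta> \<le> D then 1 else (D / norm \<theta>) powr p))"
      by (intro mult_left_mono form_tail_le) auto
    also have "\<dots> = ennreal (\<bar>\<theta> \<bullet> x\<bar> powr m * (exp (p / 2) * (if norm \<theta> \<le> D then 1 else (D / norm \<theta>) powr p)))"
      by (subst ennreal_mult) auto
    also have "\<dots> \<le> ennreal (exp (p / 2) * (D * norm x) powr m * q \<theta>)"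
    proof (rule ennreal_leI)
      have "\<bar>\<theta> \<bullet> x\<bar> powr m \<le> (norm \<theta> * norm x) powr m"
        using m by (intro powr_mono2 Cauchy_Schwarz_ineq2) auto
      then have 1: "\<bar>\<theta> \<bullet> x\<bar> powr m \<le> norm \<theta> powr m * norm x powr m" by (simp add: powr_mult)
      have 2: "norm \<theta> powr m * (if norm \<theta> \<le> D then 1 else (D / norm \<theta>) powr p) \<le> D powr m * q \<theta>"
      proof (cases "norm \<theta> \<le> D")
        case True
        then show ?thesis using m by (auto simp: q_def intro!: powr_mono2)
      next
        case False
        then have np: "0 < norm \<theta>" using D_pos by linarith
        then have "norm \<theta> powr m * (D / norm \<theta>) powr p = D powr m * (D / norm \<theta>) powr (p - m)"
          using D_pos by (simp add: powr_divide powr_diff field_simps)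
        then show ?thesis using False by (simp add: q_def)
      qed
      have "\<bar>\<theta> \<bullet> x\<bar> powr m * (exp (p / 2) * (if norm \<theta> \<le> D then 1 else (D / norm \<theta>) powr p))
          \<le> (norm \<theta> powr m * norm x powr m) * (exp (p / 2) * (if norm \<theta> \<le> D then 1 else (D / norm \<theta>) powr p))"
        using 1 by (intro mult_right_mono) auto
      also have "\<dots> = (exp (p / 2) * norm x powr m) * (norm \<theta> powr m * (if norm \<theta> \<le> D then 1 else (D / norm \<theta>) powr p))"
        by (simp only: mult_ac)
      also have "\<dots> \<le> (exp (p / 2) * norm x powr m) * (D powr m * q \<theta>)"
        using 2 by (intro mult_left_mono) auto
      also have "\<dots> = exp (p / 2) * (D * norm x) powr m * q \<theta>"
        by (simp only: powr_mult mult_ac)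
      finally show "\<bar>\<theta> \<bullet> x\<bar> powr m * (exp (p / 2) * (if norm \<theta> \<le> D then 1 else (D / norm \<theta>) powr p)) \<le> exp (p / 2) * (D * norm x) powr m * q \<theta>" .
    qed
    also have "\<dots> = ennreal (exp (p / 2) * (D * norm x) powr m) * ennreal (q \<theta>)"
      by (subst ennreal_mult) (auto simp: q_def)
    finally show "(\<integral>\<^sup>+z. (if (G z *v \<theta>) \<bullet> \<theta> \<le> p then ennreal (\<bar>\<theta> \<bullet> x\<bar> powr m) else 0) \<partial>sample)
        \<le> ennreal (exp (p / 2) * (D * norm x) powr m) * ennreal (q \<theta>)" .
  qed
  also have "\<dots> = ennreal (exp (p / 2) * (D * norm x) powr m) * (\<integral>\<^sup>+\<theta>. ennreal (q \<theta>) \<partial>lborel)"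
    unfolding q_def by (rule nn_integral_cmult) measurable
  also have "\<dots> \<le> ennreal (exp (p / 2) * (D * norm x) powr m) *
      ennreal (2 ^ (CARD('n) + 2) * D ^ CARD('n) * unit_ball_vol CARD('n))"
    using nn_integral_radial_power_le[OF D_pos, where 'a="real^'n", of "p - m"] m
    unfolding q_def by (intro mult_left_mono) auto
  also have "\<dots> = ennreal (exp (p / 2) * (D * norm x) powr m * (2 ^ (CARD('n) + 2) * D ^ CARD('n) * unit_ball_vol CARD('n)))"
    using D_pos by (subst ennreal_mult) auto
  finally show ?thesis .
qed

text \<open>The form \<open>u\<^sup>2 = (u powr k / T powr (d/2)) powr (2/k) * T powr (d/k)\<close> is what allows to
  pay for the volume factor with the first moment of \<open>T\<close> only.\<close>
lemma leverage_second_moment_le: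
  fixes x :: "real^'n"
  assumes inv: "AE z in sample. invertible (G z)"
    and second: "(\<integral>\<^sup>+b. ennreal ((norm (\<xi> b))\<^sup>2) \<partial>\<mu>) \<le> ennreal CARD('n)"
    and n: "6 * CARD('n) \<le> p" "24 \<le> p"
  defines "\<delta> \<equiv> 3 * CARD('n) / p"
  shows "(\<integral>\<^sup>+z. ennreal ((leverage I (\<lambda>i. \<xi> (z i)) x)\<^sup>2) \<partial>sample)
     \<le> ennreal (1024 * exp 3 * (C\<^sup>2 / \<alpha>) powr (2 + \<delta>) * norm x ^ 4 / (card I)\<^sup>2)"
proof (cases "x = 0")
  case True
  then show ?thesis by (simp add: leverage_def)
next
  case False
  define d where "d = CARD('n)"
  define N where "N = real (card I)"
  \<comment> \<open>The \<open>p\<close> powers of decay are split into \<open>m = 2 * k\<close> for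
    the moment, that is the power \<open>k\<close> of the leverage, and \<open>k\<close> for the
    radial integral.\<close>
  define k where "k = p / 3"
  define m where "m = 2 * k"
  define u where "u = (\<lambda>z. leverage I (\<lambda>i. \<xi> (z i)) x)"
  define T where "T = (\<lambda>z. trace (G z) / d)"
  \<comment> \<open>The upper bound for the ellipsoid integral divided by the constant of the lower
    bound; the volume of the unit ball cancels. In \<open>2 ^ (d + 4)\<close>, the radial integral
    contributes \<open>2 ^ (d + 2)\<close> and the lower bound the factor 4.\<close>
  define a0 where "a0 = 2 ^ (d + 4) * exp (p / 2) * (8 * C\<^sup>2 / p) powr k * (16 * C\<^sup>2 / p) powr (d / 2) * norm x powr m"
  define U where "U = (\<lambda>z. u z powr k / T z powr (d / 2))"
  define V where "V = unit_ball_vol (real CARD('n))"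
  have p: "24 \<le> p" "0 < p" "6 * real d \<le> p" using n by (auto simp: d_def)
  have d: "1 \<le> real d" by (simp add: d_def Suc_leI)
  have N: "0 < N" using p \<alpha> by (simp add: p_def N_def zero_less_mult_iff)
  have k: "8 \<le> k" "2 * real d \<le> k" "0 < k" using p by (auto simp: k_def)
  have V: "0 < V" by (simp add: V_def)
  have [measurable]: "u \<in> borel_measurable sample" unfolding u_def by measurable
  have "trace (G z) = (\<Sum>i\<in>I. (norm (\<xi> (z i)))\<^sup>2)" for z by (rule trace_gram)
  then have T_eq: "T z = (\<Sum>i\<in>I. (norm (\<xi> (z i)))\<^sup>2) / d" for z by (simp add: T_def)
  have [measurable]: "T \<in> borel_measurable sample" unfolding T_eq[abs_def] by measurable
  have [measurable]: "U \<in> borel_measurable sample" unfolding U_def by measurable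
  have a0: "0 < a0"
  proof -
    have "0 < 8 * C\<^sup>2 / p" "0 < 16 * C\<^sup>2 / p" using C p by (auto intro!: divide_pos_pos)
    then have "0 < (8 * C\<^sup>2 / p) powr k" "0 < (16 * C\<^sup>2 / p) powr (d / 2)"
      unfolding powr_gt_zero by linarith+
    moreover have "0 < norm x powr m" using False by simp
    ultimately show ?thesis unfolding a0_def by (intro mult_pos_pos) auto
  qed
  have ET: "(\<integral>\<^sup>+z. ennreal (T z) \<partial>sample) \<le> ennreal N"
  proof -
    have "(\<integral>\<^sup>+z. ennreal (T z) \<partial>sample) = (\<integral>\<^sup>+z. (\<Sum>i\<in>I. ennreal (1 / d) * ennreal ((norm (\<xi> (z i)))\<^sup>2)) \<partial>sample)"
      by (intro nn_integral_cong)
         (simp add: T_eq sum_ennreal ennreal_mult[symmetric] sum_divide_distrib)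
    also have "\<dots> = (\<Sum>i\<in>I. (\<integral>\<^sup>+z. ennreal (1 / d) * ennreal ((norm (\<xi> (z i)))\<^sup>2) \<partial>sample))"
      by (rule nn_integral_sum) measurable
    also have "\<dots> = (\<Sum>i\<in>I. ennreal (1 / d) * (\<integral>\<^sup>+b. ennreal ((norm (\<xi> b))\<^sup>2) \<partial>\<mu>))"
    proof (rule sum.cong[OF refl])
      fix i assume i: "i \<in> I"
      have "(\<integral>\<^sup>+z. ennreal (1 / d) * ennreal ((norm (\<xi> (z i)))\<^sup>2) \<partial>sample) =
          ennreal (1 / d) * (\<integral>\<^sup>+z. ennreal ((norm (\<xi> (z i)))\<^sup>2) \<partial>sample)"
        using i by (intro nn_integral_cmult) measurable
      also have "(\<integral>\<^sup>+z. ennreal ((norm (\<xi> (z i)))\<^sup>2) \<partial>sample) = (\<integral>\<^sup>+b. ennreal ((norm (\<xi> b))\<^sup>2) \<partial>\<mu>)"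
        using i by (intro nn_integral_PiM_component[where f="\<lambda>b. ennreal ((norm (\<xi> b))\<^sup>2)"] prob_space_axioms) measurable
      finally show "(\<integral>\<^sup>+z. ennreal (1 / d) * ennreal ((norm (\<xi> (z i)))\<^sup>2) \<partial>sample)
          = ennreal (1 / d) * (\<integral>\<^sup>+b. ennreal ((norm (\<xi> b))\<^sup>2) \<partial>\<mu>)" .
    qed
    also have "\<dots> \<le> (\<Sum>i\<in>I. ennreal (1 / d) * ennreal d)"
      using second by (intro sum_mono mult_left_mono) (auto simp: d_def)
    also have "\<dots> = ennreal N"
      using d by (simp add: ennreal_mult[symmetric] N_def ennreal_of_nat_eq_real_of_nat)
    finally show ?thesis .
  qed
  have pos: "AE z in sample. 0 < u z \<and> 0 < T z"
    using inv
  proof eventually_elim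
    case (elim z)
    then show ?case
      using pos_semidef_matrix_inv_pos[OF pos_semidef_gram elim False] trace_pos[OF pos_semidef_gram elim] d
      by (simp add: u_def T_def leverage_def)
  qed
  have EU: "(\<integral>\<^sup>+z. ennreal (U z) \<partial>sample) \<le> ennreal a0"
  proof -
    define \<kappa> where "\<kappa> = (sqrt p / 2) powr m * (V * (sqrt p / 2 / sqrt 2) ^ d) / 4"
    have \<kappa>: "0 < \<kappa>"
    proof -
      have "0 < sqrt p / 2" using p(2) by (simp only: half_gt_zero_iff real_sqrt_gt_zero)
      moreover from this have "0 < (sqrt p / 2) powr m" unfolding powr_gt_zero by linarith
      ultimately show ?thesis
        unfolding \<kappa>_def using V by (intro mult_pos_pos divide_pos_pos zero_less_power) auto
    qed
    have "ennreal \<kappa> * (\<integral>\<^sup>+z. ennreal (U z) \<partial>sample) = (\<integral>\<^sup>+z. ennreal (\<kappa> * U z) \<partial>sample)"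
      using \<kappa> by (simp add: nn_integral_cmult[symmetric] ennreal_mult' )
    also have "\<dots> \<le> (\<integral>\<^sup>+z. (\<integral>\<^sup>+\<theta>. indicator {\<theta>. (G z *v \<theta>) \<bullet> \<theta> \<le> p} \<theta> * ennreal (\<bar>\<theta> \<bullet> x\<bar> powr m) \<partial>lborel) \<partial>sample)"
    proof (rule nn_integral_mono_AE)
      show "AE z in sample. ennreal (\<kappa> * U z) \<le> (\<integral>\<^sup>+\<theta>. indicator {\<theta>. (G z *v \<theta>) \<bullet> \<theta> \<le> p} \<theta> * ennreal (\<bar>\<theta> \<bullet> x\<bar> powr m) \<partial>lborel)"
        using inv pos
      proof eventually_elim
        case (elim z)
        then have u: "0 < u z" "0 < T z" by auto
        have "(sqrt (p * u z) / 2) powr m = (sqrt p / 2) powr m * u z powr k"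
        proof -
          have "sqrt (p * u z) / 2 = (sqrt p / 2) * u z powr (1/2)"
            using u by (simp add: real_sqrt_mult powr_half_sqrt)
          then show ?thesis by (simp only: powr_mult powr_powr m_def) simp
        qed
        moreover have "sqrt (T z) ^ d = T z powr (d / 2)"
        proof -
          have "sqrt (T z) ^ d = (T z powr (1/2)) powr real d"
            using u by (simp add: powr_half_sqrt powr_realpow)
          then show ?thesis by (simp add: powr_powr)
        qed
        ultimately have "\<kappa> * U z = (sqrt (p * u z) / 2) powr m * (V * (sqrt p / 2 / sqrt 2) ^ d / sqrt (T z) ^ d) / 4"
          by (simp add: \<kappa>_def U_def mult_ac)
        then show ?case
          using ellipsoid_moment_lower_bound[OF pos_semidef_gram elim(1) p(2), of m x] k
          by (simp add: m_def V_def d_def u_def leverage_def T_def)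
      qed
    qed
    also have "\<dots> \<le> ennreal (exp (p / 2) * (D * norm x) powr m * (2 ^ (d + 2) * D ^ d * V))"
    proof -
      have "real CARD('n) + 1 \<le> p - m" using k d by (simp add: m_def k_def d_def[symmetric])
      then show ?thesis
        using ellipsoid_moment_upper_bound[of m x] k unfolding V_def d_def by (simp add: m_def)
    qed
    also have "exp (p / 2) * (D * norm x) powr m * (2 ^ (d + 2) * D ^ d * V) = \<kappa> * a0"
    proof -
      have "(D * norm x) powr m = (sqrt p / 2) powr m * (8 * C\<^sup>2 / p) powr k * norm x powr m"
      proof -
        have "(8 * C\<^sup>2 / p) powr k = (2 * D / sqrt p) powr m"
        proof -
          have "8 * C\<^sup>2 / p = (2 * D / sqrt p) powr 2"
            using p C by (simp add: power_divide power_mult_distrib)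
          then show ?thesis by (simp only: powr_powr m_def)
        qed
        moreover have "D * norm x = (sqrt p / 2) * (2 * D / sqrt p) * norm x" using p by simp
        ultimately show ?thesis by (simp only: powr_mult)
      qed
      moreover have "D ^ d = (sqrt p / 2 / sqrt 2) ^ d * (16 * C\<^sup>2 / p) powr (d / 2)"
      proof -
        have "16 * C\<^sup>2 / p = (4 * C / sqrt p) powr 2"
          using p C by (simp add: power_divide power_mult_distrib)
        then have "(16 * C\<^sup>2 / p) powr (d / 2) = (4 * C / sqrt p) powr d" by (simp add: powr_powr)
        also have "\<dots> = (4 * C / sqrt p) ^ d" using p C by (simp add: powr_realpow)
        finally have "(sqrt p / 2 / sqrt 2) ^ d * (16 * C\<^sup>2 / p) powr (d / 2) = (sqrt p / 2 / sqrt 2 * (4 * C / sqrt p)) ^ d"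
          by (simp only: power_mult_distrib)
        also have "sqrt p / 2 / sqrt 2 * (4 * C / sqrt p) = 2 / sqrt 2 * C" using p by simp
        also have "2 / sqrt 2 = sqrt 2" by (rule real_div_sqrt) simp
        finally show ?thesis by simp
      qed
      ultimately show ?thesis by (simp add: \<kappa>_def a0_def power_add)
    qed
    also have "ennreal (\<kappa> * a0) = ennreal \<kappa> * ennreal a0" using \<kappa> a0 by (simp add: ennreal_mult)
    finally show ?thesis
      using \<kappa> by (simp add: ennreal_mult_le_mult_iff)
  qed
  \<comment> \<open>AM-GM is normalized at the bounds \<open>a0\<close> and \<open>N\<close> for the
    means of \<open>U\<close> and \<open>T\<close>, so that integrating it returns exactly
    \<open>\<Lambda>\<close>, the value that Hoelder's inequality would give.\<close>
  define \<Lambda> where "\<Lambda> = a0 powr (2 / k) * N powr (d / k)"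
  define w1 where "w1 = 2 / k"
  define w2 where "w2 = d / k"
  have w: "0 \<le> w1" "0 \<le> w2" "w1 + w2 \<le> 1"
  proof -
    have "2 + real d \<le> k" using k by linarith
    then have "(2 + real d) / k \<le> 1" using k by simp
    then show "w1 + w2 \<le> 1" by (simp add: w1_def w2_def add_divide_distrib)
  qed (use k in \<open>auto simp: w1_def w2_def\<close>)
  have \<Lambda>: "0 < \<Lambda>" using a0 N by (simp add: \<Lambda>_def)
  define c1 where "c1 = \<Lambda> * w1 / a0"
  define c2 where "c2 = \<Lambda> * w2 / N"
  define c3 where "c3 = \<Lambda> * (1 - w1 - w2)"
  have c: "0 \<le> c1" "0 \<le> c2" "0 \<le> c3" using \<Lambda> w a0 N by (auto simp: c1_def c2_def c3_def)
  have "(\<integral>\<^sup>+z. ennreal ((u z)\<^sup>2) \<partial>sample)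
      \<le> (\<integral>\<^sup>+z. ennreal c1 * ennreal (U z) + (ennreal c2 * ennreal (T z) + ennreal c3) \<partial>sample)"
  proof (rule nn_integral_mono_AE)
    show "AE z in sample. ennreal ((u z)\<^sup>2) \<le> ennreal c1 * ennreal (U z) + (ennreal c2 * ennreal (T z) + ennreal c3)"
      using pos
    proof eventually_elim
      case (elim z)
      have U: "0 < U z" using elim by (simp add: U_def)
      have "(u z)\<^sup>2 = \<Lambda> * ((U z / a0) powr w1 * (T z / N) powr w2)"
      proof -
        have "U z powr w1 * T z powr w2 = u z powr 2"
          using elim k by (simp add: U_def w1_def w2_def powr_divide powr_powr)
        then show ?thesis using elim U a0 N
          by (simp add: \<Lambda>_def w1_def[symmetric] w2_def[symmetric] powr_divide)
      qed
      also have "\<dots> \<le> \<Lambda> * (w1 * (U z / a0) + w2 * (T z / N) + (1 - w1 - w2))"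
        using \<Lambda> w U elim a0 N by (intro mult_left_mono weighted_AM_GM_3) auto
      also have "\<dots> = c1 * U z + (c2 * T z + c3)"
        by (simp add: c1_def c2_def c3_def algebra_simps)
      finally have "ennreal ((u z)\<^sup>2) \<le> ennreal (c1 * U z + (c2 * T z + c3))"
        by (rule ennreal_leI)
      also have "\<dots> = ennreal c1 * ennreal (U z) + (ennreal c2 * ennreal (T z) + ennreal c3)"
        using c U elim by (simp add: ennreal_mult)
      finally show ?case .
    qed
  qed
  also have "\<dots> = ennreal c1 * (\<integral>\<^sup>+z. ennreal (U z) \<partial>sample) +
      (ennreal c2 * (\<integral>\<^sup>+z. ennreal (T z) \<partial>sample) + ennreal c3)"
    by (simp add: nn_integral_add nn_integral_cmult S.emeasure_space_1)
  also have "\<dots> \<le> ennreal c1 * ennreal a0 + (ennreal c2 * ennreal N + ennreal c3)"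
    using EU ET by (intro add_mono mult_left_mono) auto
  also have "\<dots> = ennreal (c1 * a0 + (c2 * N + c3))"
    using c a0 N by (simp add: ennreal_mult[symmetric])
  also have "c1 * a0 + (c2 * N + c3) = \<Lambda>"
    using a0 N by (simp add: c1_def c2_def c3_def algebra_simps)
  also have "ennreal \<Lambda> \<le> ennreal (1024 * exp 3 * (C\<^sup>2 / \<alpha>) powr (2 + \<delta>) * norm x ^ 4 / N\<^sup>2)"
  proof (rule ennreal_leI)
    have \<delta>: "w2 = \<delta>" using p by (simp add: w2_def k_def \<delta>_def d_def)
    have \<delta>2: "w2 \<le> 1 / 2" using k by (simp add: w2_def field_simps)
    have kw: "k * w1 = 2" "p / 2 * w1 = 3" "d / 2 * w1 = w2" "m * w1 = 4"
      using k p by (auto simp: w1_def w2_def m_def) (simp add: k_def)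
    have A2: "(2::real) ^ (d + 4) = 2 powr (d + 4)"
      by (simp only: powr_realpow[of 2 "d + 4", symmetric] zero_less_numeral of_nat_add of_nat_numeral)
    have pN: "p = \<alpha> * N" by (simp add: p_def N_def)
    \<comment> \<open>The power \<open>w1 = 6 / p\<close> turns \<open>exp (p / 2)\<close> into
      \<open>exp 3\<close>. The powers of 2 collect to \<open>6 * w2 + 4 * w1 \<le> 4\<close>, and
      \<open>64 * 2 ^ 4 = 1024\<close>. The two powers \<open>N powr w2\<close> cancel, leaving the
      factor of order \<open>1 / N\<^sup>2\<close>.\<close>
    have "\<Lambda> = (2 powr (d + 4)) powr w1 * exp 3 * (8 * C\<^sup>2 / p) powr 2 * (16 * C\<^sup>2 / p) powr w2 * norm x powr 4 * N powr w2"
    proof -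
      have "exp (p / 2) powr w1 = exp 3" using kw(2) by (simp add: powr_def mult.commute)
      then show ?thesis
        by (simp only: \<Lambda>_def a0_def w1_def[symmetric] w2_def[symmetric] powr_mult powr_powr kw A2)
    qed
    also have "(2 powr (d + 4)) powr w1 = 2 powr (2 * w2 + 4 * w1)"
      using kw(3) by (simp add: powr_powr algebra_simps)
    also have "(8 * C\<^sup>2 / p) powr 2 = 64 * (C\<^sup>2 / \<alpha>) powr 2 / N\<^sup>2"
      using C N \<alpha> by (simp add: pN power_mult_distrib power_divide)
    also have "(16 * C\<^sup>2 / p) powr w2 = 2 powr (4 * w2) * (C\<^sup>2 / \<alpha>) powr w2 / N powr w2"
    proof -
      have "16 * C\<^sup>2 / p = 2 powr 4 * (C\<^sup>2 / \<alpha>) / N" using N \<alpha> by (simp add: pN)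
      then show ?thesis using N \<alpha> C by (simp only: powr_mult powr_divide powr_powr)
    qed
    also have "2 powr (2 * w2 + 4 * w1) * exp 3 * (64 * (C\<^sup>2 / \<alpha>) powr 2 / N\<^sup>2) *
        (2 powr (4 * w2) * (C\<^sup>2 / \<alpha>) powr w2 / N powr w2) * norm x powr 4 * N powr w2
      = 2 powr (6 * w2 + 4 * w1) * (64 * exp 3 * (C\<^sup>2 / \<alpha>) powr (2 + w2) * norm x ^ 4 / N\<^sup>2)"
    proof -
      have "2 powr (2 * w2) * 2 powr (4 * w2) = (2::real) powr (6 * w2)" by (simp flip: powr_add)
      then show ?thesis using N by (simp add: powr_add)
    qed
    also have "\<dots> \<le> 2 powr 4 * (64 * exp 3 * (C\<^sup>2 / \<alpha>) powr (2 + w2) * norm x ^ 4 / N\<^sup>2)"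
    proof (intro mult_right_mono powr_mono)
      have "w1 \<le> 1 / 4" using k by (simp add: w1_def field_simps)
      then show "6 * w2 + 4 * w1 \<le> 4" using \<delta>2 by linarith
    qed auto
    finally show "\<Lambda> \<le> 1024 * exp 3 * (C\<^sup>2 / \<alpha>) powr (2 + \<delta>) * norm x ^ 4 / N\<^sup>2"
      by (simp add: \<delta>)
  qed
  finally show ?thesis by (simp add: u_def N_def)
qed

end

subsection \<open>Exchangeability\<close>

lemma distr_PiM_restrict:
  assumes "\<And>i. i \<in> J \<Longrightarrow> prob_space (N i)" "I \<subseteq> J"
  shows "distr (PiM J N) (PiM I N) (\<lambda>z. restrict z I) = PiM I N"
  using distr_PiM_reindex[of J N "\<lambda>i. i" I] assms by auto

context prob_space
begin

text \<open>Transposing the coordinates \<open>i\<close> and \<open>j\<close> preserves the product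
  measure, so all summands have the same integral.\<close>

lemma nn_integral_PiM_exchangeable:
  fixes F :: "'i \<Rightarrow> ('i \<Rightarrow> 'a) \<Rightarrow> ennreal"
  assumes J: "finite J" "i \<in> J"
    and F: "\<And>j. j \<in> J \<Longrightarrow> F j \<in> borel_measurable (PiM J (\<lambda>_. M))"
    and exch: "\<And>j z. j \<in> J \<Longrightarrow> F i (\<lambda>l\<in>J. z (if l = i then j else if l = j then i else l)) = F j z"
  shows "of_nat (card J) * (\<integral>\<^sup>+z. F i z \<partial>PiM J (\<lambda>_. M)) = (\<integral>\<^sup>+z. (\<Sum>j\<in>J. F j z) \<partial>PiM J (\<lambda>_. M))"
proof -
  let ?P = "PiM J (\<lambda>_. M)"
  have "(\<integral>\<^sup>+z. F j z \<partial>?P) = (\<integral>\<^sup>+z. F i z \<partial>?P)" if j: "j \<in> J" for j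
  proof -
    define \<tau> where "\<tau> = (\<lambda>l. if l = i then j else if l = j then i else l)"
    have d: "distr ?P ?P (\<lambda>z. \<lambda>l\<in>J. z (\<tau> l)) = ?P"
      using J j by (intro distr_PiM_reindex prob_space_axioms) (auto simp: \<tau>_def inj_on_def split: if_splits)
    have m: "(\<lambda>z. \<lambda>l\<in>J. z (\<tau> l)) \<in> measurable ?P ?P"
      using J j by (intro measurable_restrict measurable_component_singleton) (auto simp: \<tau>_def)
    have "(\<integral>\<^sup>+z. F i z \<partial>?P) = (\<integral>\<^sup>+z. F i z \<partial>distr ?P ?P (\<lambda>z. \<lambda>l\<in>J. z (\<tau> l)))" by (simp add: d)
    also have "\<dots> = (\<integral>\<^sup>+z. F i (\<lambda>l\<in>J. z (\<tau> l)) \<partial>?P)"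
      by (rule nn_integral_distr[OF m]) (simp add: d F J)
    also have "\<dots> = (\<integral>\<^sup>+z. F j z \<partial>?P)" unfolding \<tau>_def by (simp only: exch[OF j])
    finally show ?thesis ..
  qed
  then have "(\<Sum>j\<in>J. \<integral>\<^sup>+z. F j z \<partial>?P) = (\<Sum>j\<in>J. \<integral>\<^sup>+z. F i z \<partial>?P)" by (intro sum.cong) auto
  moreover have "(\<integral>\<^sup>+z. (\<Sum>j\<in>J. F j z) \<partial>?P) = (\<Sum>j\<in>J. \<integral>\<^sup>+z. F j z \<partial>?P)"
    by (rule nn_integral_sum) (rule F)
  ultimately show ?thesis by simp
qed

end

lemma sum_swap_eq:
  assumes "i \<in> J" "j \<in> J"
  shows "(\<Sum>l\<in>J. h ((\<lambda>l\<in>J. z (if l = i then j else if l = j then i else l)) l)) = (\<Sum>l\<in>J. h (z l))"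
proof -
  have "bij_betw (\<lambda>l. if l = i then j else if l = j then i else l) J J"
    using assms by (intro bij_betw_byWitness[where f'="\<lambda>l. if l = i then j else if l = j then i else l"]) auto
  from sum.reindex_bij_betw[OF this, of "\<lambda>l. h (z l)"] show ?thesis by simp
qed

locale regression_pair = prob_space \<mu> for \<mu> :: "'b measure" +
  fixes X :: "'b \<Rightarrow> real^'n" and Y :: "'b \<Rightarrow> real"
  assumes X_measurable [measurable]: "X \<in> borel_measurable \<mu>"
    and Y_measurable [measurable]: "Y \<in> borel_measurable \<mu>"
begin

abbreviation lev :: "'i set \<Rightarrow> ('i \<Rightarrow> 'b) \<Rightarrow> 'b \<Rightarrow> real" where
  "lev I z b \<equiv> leverage I (\<lambda>i. X (z i)) (X b)"

abbreviation resid :: "'i set \<Rightarrow> ('i \<Rightarrow> 'b) \<Rightarrow> 'b \<Rightarrow> real" where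
  "resid I z b \<equiv> Y b - lsq I (\<lambda>i. X (z i)) (\<lambda>i. Y (z i)) \<bullet> X b"

lemma lev_exchange:
  assumes "i \<in> J" "j \<in> J" and w: "w = (\<lambda>l\<in>J. z (if l = i then j else if l = j then i else l))"
  shows "lev J w (w i) = lev J z (z j)" and "resid J w (w i) = resid J z (z j)"
proof -
  have "gram J (\<lambda>l. X (w l)) = gram J (\<lambda>l. X (z l))"
    unfolding gram_def w by (rule sum_swap_eq[OF assms(1,2)])
  moreover have "(\<Sum>l\<in>J. Y (w l) *\<^sub>R X (w l)) = (\<Sum>l\<in>J. Y (z l) *\<^sub>R X (z l))"
    unfolding w by (rule sum_swap_eq[OF assms(1,2), of "\<lambda>b. Y b *\<^sub>R X b"])
  moreover have "w i = z j" using assms by simp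
  ultimately show "lev J w (w i) = lev J z (z j)" "resid J w (w i) = resid J z (z j)"
    by (simp_all add: leverage_def lsq_def)
qed

lemma AE_invertible_gram_superset:
  assumes J: "finite J" "I \<subseteq> J" and inv: "AE z in PiM I (\<lambda>_. \<mu>). invertible (gram I (\<lambda>i. X (z i)))"
  shows "AE z in PiM J (\<lambda>_. \<mu>). invertible (gram I (\<lambda>i. X (z i)))"
    and "AE z in PiM J (\<lambda>_. \<mu>). invertible (gram J (\<lambda>i. X (z i)))"
proof -
  have m: "(\<lambda>z. restrict z I) \<in> measurable (PiM J (\<lambda>_. \<mu>)) (PiM I (\<lambda>_. \<mu>))"
    using J(2) by (rule measurable_restrict_subset)
  have "AE z in distr (PiM J (\<lambda>_. \<mu>)) (PiM I (\<lambda>_. \<mu>)) (\<lambda>z. restrict z I). invertible (gram I (\<lambda>i. X (z i)))"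
    using inv J by (subst distr_PiM_restrict) (auto intro: prob_space_axioms)
  from AE_distrD[OF m this]
  show "AE z in PiM J (\<lambda>_. \<mu>). invertible (gram I (\<lambda>i. X (z i)))" by (simp add: gram_def)
  then show "AE z in PiM J (\<lambda>_. \<mu>). invertible (gram J (\<lambda>i. X (z i)))"
    by eventually_elim (rule invertible_gram_superset[OF _ J(2,1)])
qed

text \<open>The in-sample leverages sum to the dimension and share one expectation.\<close>

lemma expected_lev:
  assumes J: "finite J" "i \<in> J" and inv: "AE z in PiM J (\<lambda>_. \<mu>). invertible (gram J (\<lambda>i. X (z i)))"
  shows "(\<integral>\<^sup>+z. ennreal (lev J z (z i)) \<partial>PiM J (\<lambda>_. \<mu>)) = ennreal (real CARD('n) / card J)"
proof -
  interpret P: prob_space "PiM J (\<lambda>_. \<mu>)" by (intro prob_space_PiM prob_space_axioms)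
  have c: "0 < real (card J)" using J by (auto simp: card_gt_0_iff)
  have "ennreal (card J) * (\<integral>\<^sup>+z. ennreal (lev J z (z i)) \<partial>PiM J (\<lambda>_. \<mu>))
      = (\<integral>\<^sup>+z. (\<Sum>j\<in>J. ennreal (lev J z (z j))) \<partial>PiM J (\<lambda>_. \<mu>))"
    unfolding ennreal_of_nat_eq_real_of_nat[symmetric]
  proof (rule nn_integral_PiM_exchangeable[OF J])
    show "(\<lambda>z. ennreal (lev J z (z j))) \<in> borel_measurable (PiM J (\<lambda>_. \<mu>))" if "j \<in> J" for j
      using that by measurable
  qed (rule arg_cong[where f=ennreal], rule lev_exchange(1)[OF J(2) _ refl])
  also have "\<dots> = (\<integral>\<^sup>+z. ennreal (real CARD('n)) \<partial>PiM J (\<lambda>_. \<mu>))"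
  proof (rule nn_integral_cong_AE, rule eventually_mono[OF inv])
    fix z assume elim: "invertible (gram J (\<lambda>i. X (z i)))"
    show "(\<Sum>j\<in>J. ennreal (lev J z (z j))) = ennreal (real CARD('n))"
      using sum_leverage[OF elim] leverage_nonneg[OF elim] by (simp add: sum_ennreal)
  qed
  also have "\<dots> = ennreal (card J) * ennreal (real CARD('n) / card J)"
    using c by (simp add: P.emeasure_space_1 ennreal_mult[symmetric] del: ennreal_of_nat_eq_real_of_nat)
  finally show ?thesis
    using c by (subst (asm) ennreal_mult_cancel_left) auto
qed

text \<open>Least squares beats any fixed \<open>\<theta>\<close> sample by sample, and every point
  carries an equal share of the expected sum. The free \<open>\<theta>\<close> lets the infimum be
  taken at the very end.\<close>

lemma expected_resid_le:
  assumes J: "finite J" "i \<in> J" and inv: "AE z in PiM J (\<lambda>_. \<mu>). invertible (gram J (\<lambda>i. X (z i)))"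
  shows "(\<integral>\<^sup>+z. ennreal ((resid J z (z i))\<^sup>2) \<partial>PiM J (\<lambda>_. \<mu>)) \<le> (\<integral>\<^sup>+b. ennreal ((Y b - \<theta> \<bullet> X b)\<^sup>2) \<partial>\<mu>)"
proof -
  have c: "0 < real (card J)" using J by (auto simp: card_gt_0_iff)
  have "ennreal (card J) * (\<integral>\<^sup>+z. ennreal ((resid J z (z i))\<^sup>2) \<partial>PiM J (\<lambda>_. \<mu>))
      = (\<integral>\<^sup>+z. (\<Sum>j\<in>J. ennreal ((resid J z (z j))\<^sup>2)) \<partial>PiM J (\<lambda>_. \<mu>))"
    unfolding ennreal_of_nat_eq_real_of_nat[symmetric]
  proof (rule nn_integral_PiM_exchangeable[OF J])
    show "(\<lambda>z. ennreal ((resid J z (z j))\<^sup>2)) \<in> borel_measurable (PiM J (\<lambda>_. \<mu>))" if "j \<in> J" for j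
      using that by measurable
  qed (rule arg_cong[where f="\<lambda>r. ennreal (r\<^sup>2)"], rule lev_exchange(2)[OF J(2) _ refl])
  also have "\<dots> \<le> (\<integral>\<^sup>+z. (\<Sum>j\<in>J. ennreal ((Y (z j) - \<theta> \<bullet> X (z j))\<^sup>2)) \<partial>PiM J (\<lambda>_. \<mu>))"
  proof (rule nn_integral_mono_AE, rule eventually_mono[OF inv])
    fix z assume elim: "invertible (gram J (\<lambda>i. X (z i)))"
    show "(\<Sum>j\<in>J. ennreal ((resid J z (z j))\<^sup>2)) \<le> (\<Sum>j\<in>J. ennreal ((Y (z j) - \<theta> \<bullet> X (z j))\<^sup>2))"
      using lsq_minimal[OF elim, of "\<lambda>i. Y (z i)" \<theta>] by (simp add: sum_ennreal ennreal_leI)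
  qed
  also have "\<dots> = (\<Sum>j\<in>J. \<integral>\<^sup>+z. ennreal ((Y (z j) - \<theta> \<bullet> X (z j))\<^sup>2) \<partial>PiM J (\<lambda>_. \<mu>))"
    by (rule nn_integral_sum) measurable
  also have "\<dots> = (\<Sum>j\<in>J. \<integral>\<^sup>+b. ennreal ((Y b - \<theta> \<bullet> X b)\<^sup>2) \<partial>\<mu>)"
    by (intro sum.cong refl nn_integral_PiM_component[where f="\<lambda>b. ennreal ((Y b - \<theta> \<bullet> X b)\<^sup>2)"] prob_space_axioms)
       measurable
  also have "\<dots> = ennreal (card J) * (\<integral>\<^sup>+b. ennreal ((Y b - \<theta> \<bullet> X b)\<^sup>2) \<partial>\<mu>)"
    by (simp add: ennreal_of_nat_eq_real_of_nat)
  finally show ?thesis using c by (simp add: ennreal_mult_le_mult_iff)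
qed

text \<open>The two ratios are the leverage and the residual of \<open>b\<close> in the sample enlarged by \<open>b\<close>, to
  which exchangeability applies.\<close>
lemma leave_one_out:
  assumes I: "finite I" "j \<notin> I"
    and inv: "AE z in PiM I (\<lambda>_. \<mu>). invertible (gram I (\<lambda>i. X (z i)))"
  shows expected_lev_ratio: "(\<integral>\<^sup>+z. (\<integral>\<^sup>+b. ennreal (lev I z b / (1 + lev I z b)) \<partial>\<mu>) \<partial>PiM I (\<lambda>_. \<mu>))
        = ennreal (real CARD('n) / (real (card I) + 1))"
    and expected_resid_ratio: "(\<integral>\<^sup>+z. (\<integral>\<^sup>+b. ennreal ((resid I z b / (1 + lev I z b))\<^sup>2) \<partial>\<mu>) \<partial>PiM I (\<lambda>_. \<mu>))
        \<le> (\<integral>\<^sup>+b. ennreal ((Y b - \<theta> \<bullet> X b)\<^sup>2) \<partial>\<mu>)"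
proof -
  interpret PS: product_sigma_finite "\<lambda>_. \<mu>" by (rule product_sigma_finite.intro) (rule sigma_finite_measure_axioms)
  let ?J = "insert j I"
  have J: "finite ?J" "j \<in> ?J" "I \<subseteq> ?J" using I by auto
  note inv' = AE_invertible_gram_superset(2)[OF J(1,3) inv]
  \<comment> \<open>As \<open>j\<close> is not in \<open>I\<close>, statistics over \<open>I\<close>
    ignore the coordinate \<open>j\<close>; integrating over it alone amounts to a fresh test
    point.\<close>
  have eq: "gram I (\<lambda>i. X ((z(j := b)) i)) = gram I (\<lambda>i. X (z i))"
      "leverage I (\<lambda>i. X ((z(j := b)) i)) x = leverage I (\<lambda>i. X (z i)) x"
      "lsq I (\<lambda>i. X ((z(j := b)) i)) (\<lambda>i. Y ((z(j := b)) i)) = lsq I (\<lambda>i. X (z i)) (\<lambda>i. Y (z i))" for z b x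
  proof -
    show g: "gram I (\<lambda>i. X ((z(j := b)) i)) = gram I (\<lambda>i. X (z i))"
      unfolding gram_def using I by (intro sum.cong) auto
    have "(\<Sum>i\<in>I. Y ((z(j := b)) i) *\<^sub>R X ((z(j := b)) i)) = (\<Sum>i\<in>I. Y (z i) *\<^sub>R X (z i))"
      using I by (intro sum.cong) auto
    with g show "leverage I (\<lambda>i. X ((z(j := b)) i)) x = leverage I (\<lambda>i. X (z i)) x"
      "lsq I (\<lambda>i. X ((z(j := b)) i)) (\<lambda>i. Y ((z(j := b)) i)) = lsq I (\<lambda>i. X (z i)) (\<lambda>i. Y (z i))"
      unfolding leverage_def lsq_def by simp_all
  qed
  have "(\<integral>\<^sup>+z. ennreal (lev ?J z (z j)) \<partial>PiM ?J (\<lambda>_. \<mu>))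
      = (\<integral>\<^sup>+z. (\<integral>\<^sup>+b. ennreal (lev ?J (z(j := b)) ((z(j := b)) j)) \<partial>\<mu>) \<partial>PiM I (\<lambda>_. \<mu>))"
    using I by (intro PS.product_nn_integral_insert) measurable
  also have "\<dots> = (\<integral>\<^sup>+z. (\<integral>\<^sup>+b. ennreal (lev I z b / (1 + lev I z b)) \<partial>\<mu>) \<partial>PiM I (\<lambda>_. \<mu>))"
  proof (rule nn_integral_cong_AE, rule eventually_mono[OF inv])
    fix z assume elim: "invertible (gram I (\<lambda>i. X (z i)))"
    have "lev ?J (z(j := b)) ((z(j := b)) j) = lev I z b / (1 + lev I z b)" for b
      using leverage_insert[of I "\<lambda>i. X ((z(j := b)) i)" j] elim I unfolding eq by simp
    then show "(\<integral>\<^sup>+b. ennreal (lev ?J (z(j := b)) ((z(j := b)) j)) \<partial>\<mu>) = (\<integral>\<^sup>+b. ennreal (lev I z b / (1 + lev I z b)) \<partial>\<mu>)"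
      by simp
  qed
  finally show "(\<integral>\<^sup>+z. (\<integral>\<^sup>+b. ennreal (lev I z b / (1 + lev I z b)) \<partial>\<mu>) \<partial>PiM I (\<lambda>_. \<mu>))
        = ennreal (real CARD('n) / (real (card I) + 1))"
    using expected_lev[OF J(1,2) inv'] I by (simp add: add.commute)
  have "(\<integral>\<^sup>+z. ennreal ((resid ?J z (z j))\<^sup>2) \<partial>PiM ?J (\<lambda>_. \<mu>))
      = (\<integral>\<^sup>+z. (\<integral>\<^sup>+b. ennreal ((resid ?J (z(j := b)) ((z(j := b)) j))\<^sup>2) \<partial>\<mu>) \<partial>PiM I (\<lambda>_. \<mu>))"
    using I by (intro PS.product_nn_integral_insert) measurable
  also have "\<dots> = (\<integral>\<^sup>+z. (\<integral>\<^sup>+b. ennreal ((resid I z b / (1 + lev I z b))\<^sup>2) \<partial>\<mu>) \<partial>PiM I (\<lambda>_. \<mu>))"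
  proof (rule nn_integral_cong_AE, rule eventually_mono[OF inv])
    fix z assume elim: "invertible (gram I (\<lambda>i. X (z i)))"
    have "resid ?J (z(j := b)) ((z(j := b)) j) = resid I z b / (1 + lev I z b)" for b
      using lsq_insert_residual[of I "\<lambda>i. X ((z(j := b)) i)" j "\<lambda>i. Y ((z(j := b)) i)"] elim I
      unfolding eq by simp
    then show "(\<integral>\<^sup>+b. ennreal ((resid ?J (z(j := b)) ((z(j := b)) j))\<^sup>2) \<partial>\<mu>)
        = (\<integral>\<^sup>+b. ennreal ((resid I z b / (1 + lev I z b))\<^sup>2) \<partial>\<mu>)"
      by simp
  qed
  finally show "(\<integral>\<^sup>+z. (\<integral>\<^sup>+b. ennreal ((resid I z b / (1 + lev I z b))\<^sup>2) \<partial>\<mu>) \<partial>PiM I (\<lambda>_. \<mu>))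
        \<le> (\<integral>\<^sup>+b. ennreal ((Y b - \<theta> \<bullet> X b)\<^sup>2) \<partial>\<mu>)"
    using expected_resid_le[OF J(1,2) inv'] by simp
qed

end

subsection \<open>Whitening\<close>

text \<open>The Gram matrix \<open>A\<close> becomes \<open>W ** A ** W\<close>, and the outer
  factors cancel against the transformed test point. Leverages may therefore be computed after
  whitening, where the small ball condition is isotropic.\<close>

lemma leverage_linear_image:
  fixes W :: "real^'n^'n"
  assumes W: "transpose W = W" "invertible W" and inv: "invertible (gram I xs)"
  shows "leverage I (\<lambda>i. W *v xs i) (W *v x) = leverage I xs x"
proof -
  define A where "A = gram I xs"
  define B where "B = matrix_inv W ** matrix_inv A ** matrix_inv W"
  have "(W ** A ** W) ** B = W ** (A ** (W ** matrix_inv W) ** matrix_inv A) ** matrix_inv W"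
    by (simp add: B_def matrix_mul_assoc)
  also have "\<dots> = mat 1" using W inv by (simp add: A_def matrix_inv)
  finally have "matrix_inv (W ** A ** W) = B" by (rule matrix_inv_unique)
  then have "leverage I (\<lambda>i. W *v xs i) (W *v x) = (matrix_inv W *v (matrix_inv A *v x)) \<bullet> (W *v x)"
    using W(2) by (simp add: leverage_def gram_linear_image[OF W(1)] A_def[symmetric] B_def
      matrix_vector_mul_assoc[symmetric])
  also have "\<dots> = leverage I xs x"
    using W by (simp add: leverage_def A_def symmetric_matrix_inner[OF W(1), symmetric])
  finally show ?thesis .
qed

lemma matrix_inv_sqrt:
  fixes A :: "real^'n^'n"
  assumes A: "pos_semidef A" "invertible A"
  shows transpose_matrix_inv_sqrt: "transpose (matrix_inv_sqrt A) = matrix_inv_sqrt A"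
    and invertible_matrix_inv_sqrt: "invertible (matrix_inv_sqrt A)"
    and matrix_inv_sqrt_sandwich: "matrix_inv_sqrt A ** A ** matrix_inv_sqrt A = mat 1"
proof -
  define S where "S = matrix_sqrt A"
  have S: "pos_semidef S" "S ** S = A" using matrix_sqrt[OF A(1)] by (auto simp: S_def)
  have "det S * det S = det A" using S(2) det_mul[of S S] by simp
  then have invS: "invertible S" using A(2) by (auto simp: invertible_det_nz)
  have W: "matrix_inv_sqrt A = matrix_inv S" by (simp add: matrix_inv_sqrt_def S_def)
  show "transpose (matrix_inv_sqrt A) = matrix_inv_sqrt A"
    unfolding W using S(1) invS by (intro transpose_matrix_inv) (auto simp: pos_semidef_def)
  show "invertible (matrix_inv_sqrt A)"
    unfolding W using matrix_inv[OF invS] by (auto simp: invertible_def)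
  have "matrix_inv S ** A ** matrix_inv S = (matrix_inv S ** S) ** (S ** matrix_inv S)"
    by (simp add: S(2)[symmetric] matrix_mul_assoc)
  then show "matrix_inv_sqrt A ** A ** matrix_inv_sqrt A = mat 1"
    unfolding W by (simp add: matrix_inv[OF invS])
qed

text \<open>\<open>second_moment\<close> is a Bochner integral of matrices: integrability excludes
  the default value 0 and lets linear functionals pass under the integral.\<close>

lemma integrable_outer_square:
  fixes X :: "'a \<Rightarrow> real^'n"
  assumes [measurable]: "X \<in> borel_measurable M" and int: "integrable M (\<lambda>\<omega>. (norm (X \<omega>))\<^sup>2)"
  shows "integrable M (\<lambda>\<omega>. outer_square (X \<omega>))"
proof (rule Bochner_Integration.integrable_bound)
  show "integrable M (\<lambda>\<omega>. real CARD('n) * (norm (X \<omega>))\<^sup>2)" using int by simp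
  show "AE \<omega> in M. norm (outer_square (X \<omega>)) \<le> norm (real CARD('n) * (norm (X \<omega>))\<^sup>2)"
  proof (rule AE_I2)
    fix \<omega>
    have "norm (outer_square (X \<omega>)) \<le> (\<Sum>i\<in>UNIV. norm (outer_square (X \<omega>) $ i))"
      by (subst norm_vec_def) (rule L2_set_le_sum, simp)
    also have "\<dots> \<le> (\<Sum>i\<in>(UNIV::'n set). (norm (X \<omega>))\<^sup>2)"
    proof (rule sum_mono)
      fix i
      have "outer_square (X \<omega>) $ i = (X \<omega> $ i) *\<^sub>R X \<omega>"
        by (simp add: vec_eq_iff outer_square_nth)
      then show "norm (outer_square (X \<omega>) $ i) \<le> (norm (X \<omega>))\<^sup>2"
        using component_le_norm_cart[of "X \<omega>" i] by (simp add: power2_eq_square mult_right_mono)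
    qed
    finally show "norm (outer_square (X \<omega>)) \<le> norm (real CARD('n) * (norm (X \<omega>))\<^sup>2)" by simp
  qed
qed measurable

lemma second_moment_form:
  fixes X :: "'a \<Rightarrow> real^'n"
  assumes X: "X \<in> borel_measurable M" and int: "integrable M (\<lambda>\<omega>. (norm (X \<omega>))\<^sup>2)"
  shows "(second_moment M X *v v) \<bullet> w = (\<integral>\<omega>. (X \<omega> \<bullet> v) * (X \<omega> \<bullet> w) \<partial>M)"
proof -
  have "linear (\<lambda>A::real^'n^'n. (A *v v) \<bullet> w)"
    by (rule linearI) (simp_all add: matrix_vector_mult_add_rdistrib inner_add_left scaleR_matrix_vector_assoc[symmetric])
  then have "bounded_linear (\<lambda>A::real^'n^'n. (A *v v) \<bullet> w)" by (simp add: linear_conv_bounded_linear)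
  from integral_bounded_linear[OF this integrable_outer_square[OF X int]]
  show ?thesis by (simp add: second_moment_def outer_square_mult_vec)
qed

lemma pos_semidef_second_moment:
  fixes X :: "'a \<Rightarrow> real^'n"
  assumes X: "X \<in> borel_measurable M" and int: "integrable M (\<lambda>\<omega>. (norm (X \<omega>))\<^sup>2)"
  shows "pos_semidef (second_moment M X)"
  unfolding pos_semidef_def
proof (intro conjI allI)
  have "(second_moment M X *v v) \<bullet> w = (second_moment M X *v w) \<bullet> v" for v w
    by (simp add: second_moment_form[OF X int] mult.commute)
  then have "(second_moment M X *v axis j 1) \<bullet> axis i 1 = (second_moment M X *v axis i 1) \<bullet> axis j 1" for i j by blast
  then show "transpose (second_moment M X) = second_moment M X"
    by (simp add: vec_eq_iff transpose_def inner_axis matrix_vector_mul_component)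
  show "0 \<le> (second_moment M X *v v) \<bullet> v" for v
    by (simp add: second_moment_form[OF X int])
qed

text \<open>Expanding the norm in the basis gives the trace of
  \<open>W ** second_moment M X ** W\<close>, which is the identity.\<close>

lemma whitened_norm_expectation:
  fixes X :: "'a \<Rightarrow> real^'n"
  assumes X: "X \<in> borel_measurable M" and int: "integrable M (\<lambda>\<omega>. (norm (X \<omega>))\<^sup>2)"
    and inv: "invertible (second_moment M X)"
  defines "W \<equiv> matrix_inv_sqrt (second_moment M X)"
  shows "integrable M (\<lambda>\<omega>. (norm (W *v X \<omega>))\<^sup>2)" "(\<integral>\<omega>. (norm (W *v X \<omega>))\<^sup>2 \<partial>M) = CARD('n)"
proof -
  note psd = pos_semidef_second_moment[OF X int]
  have W: "transpose W = W" "W ** second_moment M X ** W = mat 1"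
    using matrix_inv_sqrt[OF psd inv] by (auto simp: W_def)
  have eq: "(norm (W *v x))\<^sup>2 = (\<Sum>j\<in>Basis. (x \<bullet> (W *v j)) * (x \<bullet> (W *v j)))" for x
    unfolding power2_norm_eq_inner by (subst euclidean_inner) (simp only: symmetric_matrix_inner[OF W(1)])
  have i: "integrable M (\<lambda>\<omega>. (X \<omega> \<bullet> v) * (X \<omega> \<bullet> v))" for v
  proof (rule Bochner_Integration.integrable_bound)
    show "integrable M (\<lambda>\<omega>. (norm v)\<^sup>2 * (norm (X \<omega>))\<^sup>2)" using int by simp
    show "AE \<omega> in M. norm ((X \<omega> \<bullet> v) * (X \<omega> \<bullet> v)) \<le> norm ((norm v)\<^sup>2 * (norm (X \<omega>))\<^sup>2)"
    proof (rule AE_I2)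
      fix \<omega>
      have "\<bar>X \<omega> \<bullet> v\<bar> * \<bar>X \<omega> \<bullet> v\<bar> \<le> (norm (X \<omega>) * norm v) * (norm (X \<omega>) * norm v)"
        by (intro mult_mono Cauchy_Schwarz_ineq2) auto
      then show "norm ((X \<omega> \<bullet> v) * (X \<omega> \<bullet> v)) \<le> norm ((norm v)\<^sup>2 * (norm (X \<omega>))\<^sup>2)"
        by (simp add: abs_mult power2_eq_square mult_ac)
    qed
  qed (use X in measurable)
  show "integrable M (\<lambda>\<omega>. (norm (W *v X \<omega>))\<^sup>2)"
    unfolding eq by (intro Bochner_Integration.integrable_sum i)
  have "(\<integral>\<omega>. (norm (W *v X \<omega>))\<^sup>2 \<partial>M) = (\<Sum>j\<in>Basis. (second_moment M X *v (W *v j)) \<bullet> (W *v j))"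
    unfolding eq by (simp add: Bochner_Integration.integral_sum i second_moment_form[OF X int])
  also have "\<dots> = (\<Sum>j\<in>(Basis::(real^'n) set). ((W ** second_moment M X ** W) *v j) \<bullet> j)"
    by (simp add: symmetric_matrix_inner[OF W(1), symmetric] matrix_vector_mul_assoc[symmetric])
  also have "\<dots> = CARD('n)" by (simp add: W(2) inner_Basis)
  finally show "(\<integral>\<omega>. (norm (W *v X \<omega>))\<^sup>2 \<partial>M) = CARD('n)" .
qed

lemma linear_hyperplane_orthogonal:
  "\<theta> \<noteq> 0 \<Longrightarrow> linear_hyperplane {y. \<theta> \<bullet> y = 0}"
  by (simp add: linear_hyperplane_def subspace_hyperplane dim_hyperplane)

text \<open>Comparison with the orthogonal projection \<open>h\<close>. It places the slab around
  the hyperplane inside the event of the small ball hypothesis.\<close>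

lemma infdist_hyperplane_le:
  fixes \<theta> :: "'a::euclidean_space"
  assumes "\<theta> \<noteq> 0"
  shows "infdist y {y. \<theta> \<bullet> y = 0} \<le> \<bar>y \<bullet> \<theta>\<bar> / norm \<theta>"
proof -
  define h where "h = y - ((y \<bullet> \<theta>) / (\<theta> \<bullet> \<theta>)) *\<^sub>R \<theta>"
  have "\<theta> \<bullet> h = 0" using assms by (simp add: h_def inner_diff_right inner_commute)
  then have "infdist y {y. \<theta> \<bullet> y = 0} \<le> dist y h" by (intro infdist_le) simp
  also have "dist y h = \<bar>y \<bullet> \<theta>\<bar> / norm \<theta>"
    using assms by (simp add: h_def dist_norm power2_norm_eq_inner[symmetric] power2_eq_square)
  finally show ?thesis .
qed

subsection \<open>Excess risk\<close>

text \<open>With \<open>r = d / n\<close>, this bounds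
  \<open>(1 / r) powr (3 * r / \<alpha>)\<close> by \<open>exp (3 / \<alpha>)\<close>.\<close>

lemma mult_ln_inverse_le_one:
  fixes r :: real
  assumes "0 < r"
  shows "r * ln (1 / r) \<le> 1"
proof -
  have "ln (1 / r) \<le> 1 / r - 1" using assms by (intro ln_le_minus_one) auto
  then have "r * ln (1 / r) \<le> r * (1 / r - 1)" using assms by (intro mult_left_mono) auto
  also have "\<dots> \<le> 1" using assms by (simp add: field_simps)
  finally show ?thesis .
qed

text \<open>\<open>K\<close> is the constant of the second moment bound at \<open>r = d / n\<close>,
  and \<open>c\<close> the target. In the surplus power of \<open>C\<^sup>2 = x / r\<close>, the
  factor \<open>1 / r\<close> costs at most \<open>exp (3 / \<alpha>)\<close>. The factor
  \<open>x\<close> is harmless if \<open>x \<le> 1\<close>; otherwise \<open>sqrt K\<close> acquires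
  at most \<open>C\<^sup>2 * x = C ^ 4 * r\<close>, which is where the extra \<open>r\<close> on the
  right comes from.\<close>

lemma constant_bound:
  fixes C \<alpha> r :: real
  assumes C: "1 \<le> C" and \<alpha>: "0 < \<alpha>" "\<alpha> \<le> 1" and r: "0 < r" "r \<le> \<alpha> / 6"
  defines "K \<equiv> 1024 * exp 3 * (C\<^sup>2 / \<alpha>) powr (2 + 3 * r / \<alpha>)"
    and "c \<equiv> 28 * C ^ 4 * exp (1 + 9 / \<alpha>)"
  shows "K \<le> c \<or> sqrt K \<le> c * r"
proof -
  define \<delta> where "\<delta> = 3 * r / \<alpha>"
  define x where "x = C\<^sup>2 * r"
  define la where "la = ln (1 / \<alpha>)"
  have x: "0 < x" using C r by (simp add: x_def)
  have \<delta>: "0 \<le> \<delta>" "\<delta> \<le> 1 / 2" using \<alpha> r by (auto simp: \<delta>_def field_simps)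
  have la0: "0 \<le> la" using \<alpha> by (simp add: la_def)
  have la: "la \<le> 1 / \<alpha> - 1" unfolding la_def using \<alpha> by (intro ln_le_minus_one) auto
  have e1: "5 / 2 \<le> exp (1::real)" using exp_lower_Taylor_quadratic[of 1] by simp
  have "(5 / 2) ^ 4 \<le> exp (1::real) ^ 4" using e1 by (intro power_mono) auto
  \<comment> \<open>Origin of \<open>28\<close>: the factor \<open>1024\<close> is exchanged for it
    at the price of \<open>exp 4\<close>, which explains the \<open>- 4\<close> in the exponents
    below.\<close>
  then have e4: "1024 \<le> 28 * exp (4::real)" by (simp add: exp_of_nat_mult[symmetric] power_divide)
  have lnC: "ln (C\<^sup>2) = ln x + ln (1 / r)" using C r by (simp add: x_def ln_mult ln_div)
  have pw: "(C\<^sup>2 / \<alpha>) powr s = (C\<^sup>2) powr s * exp (s * la)" for s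
    using \<alpha> C by (simp add: powr_def la_def ln_div ln_mult exp_add[symmetric] algebra_simps)
  have C2: "(C\<^sup>2) powr (2 + \<delta>) = C ^ 4 * exp (\<delta> * ln (C\<^sup>2))"
    using C by (simp add: powr_add) (simp add: powr_def power2_eq_square power4_eq_xxxx)
  have rln: "r * ln (1 / r) \<le> 1" by (rule mult_ln_inverse_le_one[OF r(1)])
  have rln3: "3 / \<alpha> * (r * ln (1 / r)) \<le> 3 / \<alpha>"
    using mult_left_mono[OF rln, of "3 / \<alpha>"] \<alpha> by simp
  have dl: "\<delta> * ln (C\<^sup>2) = \<delta> * ln x + 3 / \<alpha> * (r * ln (1 / r))"
    by (simp add: lnC \<delta>_def algebra_simps add_divide_distrib)
  have la2: "(2 + \<delta>) * la \<le> 5 / 2 * (1 / \<alpha> - 1)"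
    using mult_mono[of "2 + \<delta>" "5 / 2" la "1 / \<alpha> - 1"] \<delta> la la0 by simp
  have K: "K = 1024 * C ^ 4 * exp (3 + \<delta> * ln (C\<^sup>2) + (2 + \<delta>) * la)"
    unfolding K_def \<delta>_def[symmetric] pw C2 by (simp add: exp_add mult_ac)
  have ia: "1 \<le> 1 / \<alpha>" using \<alpha> by simp
  show ?thesis
  proof (cases "x \<le> 1")
    case True
    then have "\<delta> * ln x \<le> 0" using \<delta> x by (intro mult_nonneg_nonpos) auto
    then have "\<delta> * ln (C\<^sup>2) \<le> 3 / \<alpha>" using dl rln3 by linarith
    \<comment> \<open>How \<open>9 / \<alpha>\<close> is spent: \<open>3 / \<alpha>\<close> on the
      power of \<open>1 / r\<close>, \<open>(5 / 2) / \<alpha>\<close> on the powers of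
      \<open>1 / \<alpha>\<close>, and the last \<open>(7 / 2) / \<alpha>\<close> covers the
      constant \<open>7 / 2\<close> that is left over.\<close>
    then have "3 + \<delta> * ln (C\<^sup>2) + (2 + \<delta>) * la \<le> - 4 + (1 + 9 / \<alpha>)"
      using la2 ia by simp
    then have "exp (3 + \<delta> * ln (C\<^sup>2) + (2 + \<delta>) * la) \<le> exp (- 4) * exp (1 + 9 / \<alpha>)"
      by (simp only: exp_add[symmetric] exp_le_cancel_iff)
    then have "K \<le> 1024 * C ^ 4 * (exp (- 4) * exp (1 + 9 / \<alpha>))"
      unfolding K using C by (intro mult_left_mono) auto
    also have "\<dots> = (1024 * exp (- 4)) * (C ^ 4 * exp (1 + 9 / \<alpha>))" by simp
    also have "\<dots> \<le> 28 * (C ^ 4 * exp (1 + 9 / \<alpha>))"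
      using e4 by (intro mult_right_mono) (auto simp: exp_minus field_simps)
    finally show ?thesis by (simp add: c_def)
  next
    case False
    then have lx: "0 \<le> ln x" by simp
    have "\<delta> * ln x \<le> 1 / 2 * ln x" using \<delta> lx by (intro mult_right_mono) auto
    then have "\<delta> * ln (C\<^sup>2) \<le> 2 * ln x + 3 / \<alpha>" using dl rln3 lx by linarith
    then have le: "3 + \<delta> * ln (C\<^sup>2) + (2 + \<delta>) * la \<le> - 4 + 2 * ln x + 2 * (1 + 9 / \<alpha>)"
      using la2 ia by simp
    have "exp (3 + \<delta> * ln (C\<^sup>2) + (2 + \<delta>) * la) \<le> exp (- 4 + 2 * ln x + 2 * (1 + 9 / \<alpha>))"
      using le by simp
    also have "\<dots> = exp (- 4) * x\<^sup>2 * (exp (1 + 9 / \<alpha>))\<^sup>2"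
      using x by (simp only: exp_add exp_double[symmetric] exp_ln power2_eq_square mult_2 exp_add)
    finally have "K \<le> 1024 * C ^ 4 * (exp (- 4) * x\<^sup>2 * (exp (1 + 9 / \<alpha>))\<^sup>2)"
      unfolding K using C by (intro mult_left_mono) auto
    also have "\<dots> = (1024 * exp (- 4)) * (C ^ 4 * x\<^sup>2 * (exp (1 + 9 / \<alpha>))\<^sup>2)" by simp
    also have "\<dots> \<le> 28\<^sup>2 * (C ^ 4 * x\<^sup>2 * (exp (1 + 9 / \<alpha>))\<^sup>2)"
      using e4 by (intro mult_right_mono) (auto simp: exp_minus field_simps)
    also have "\<dots> = (c * r)\<^sup>2"
      by (simp add: c_def x_def power_mult_distrib power2_eq_square power4_eq_xxxx mult_ac)
    finally have "sqrt K \<le> sqrt ((c * r)\<^sup>2)" by (rule real_sqrt_le_mono)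
    also have "\<dots> = c * r" using C r by (simp add: c_def)
    finally show ?thesis by simp
  qed
qed

text \<open>\<open>12 / \<alpha>\<close> is at least 9 and hence at least \<open>exp 2\<close>, so
  the logarithm is at least 2. The threshold 24 makes \<open>k = p / 3\<close> at least 8.\<close>

lemma sample_size_ge:
  fixes \<alpha> n :: real
  assumes "0 < \<alpha>" "\<alpha> \<le> 1" "12 * ln (12 / \<alpha>) / \<alpha> \<le> n"
  shows "24 \<le> \<alpha> * n"
proof -
  have "exp (2::real) = exp 1 * exp 1" by (simp add: exp_add[symmetric])
  also have "\<dots> \<le> 3 * 3" by (intro mult_mono exp_le) auto
  also have "\<dots> \<le> 12 / \<alpha>" using assms by (simp add: field_simps)
  finally have "exp 2 \<le> 12 / \<alpha>" .
  then have "2 \<le> ln (12 / \<alpha>)" using assms by (simp add: ln_ge_iff)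
  moreover have "12 * ln (12 / \<alpha>) \<le> \<alpha> * n" using assms by (simp add: field_simps)
  ultimately show ?thesis by simp
qed

text \<open>The dominating measure absorbs \<open>sqrt (2 * pi)\<close>, so no additive constant
  remains and the losses of interest, where \<open>s \<ge> 1\<close>, are nonnegative.\<close>

lemma neg_ln_gaussian_density:
  assumes "0 < s"
  shows "- ln (gaussian_density m (s\<^sup>2) y) = ln s + ((y - m) / s)\<^sup>2 / 2"
proof -
  have "gaussian_density m (s\<^sup>2) y = exp (- ((y - m) / s)\<^sup>2 / 2) / s"
    using assms by (simp add: gaussian_density_def normal_density_def real_sqrt_mult power_divide)
  then show ?thesis using assms by (simp add: ln_div)
qed

lemma log_loss_linear_model: "log_loss (linear_model \<theta>) x y = (y - \<theta> \<bullet> x)\<^sup>2 / 2"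
  using neg_ln_gaussian_density[of 1 "\<theta> \<bullet> x" y] by (simp add: log_loss_def linear_model_def)

lemma matrix_inv_scaleR:
  fixes A :: "real^'n^'n"
  assumes "c \<noteq> 0" "invertible A"
  shows "matrix_inv (c *\<^sub>R A) = (1 / c) *\<^sub>R matrix_inv A"
proof (rule matrix_inv_unique(2))
  show "(c *\<^sub>R A) ** ((1 / c) *\<^sub>R matrix_inv A) = mat 1"
    using assms matrix_inv_right[OF assms(2)]
    by (simp add: scalar_matrix_assoc[symmetric] matrix_scalar_ac)
qed

lemma empirical_second_moment_eq: "empirical_second_moment n xs = (1 / real n) *\<^sub>R gram {1..n} xs"
  by (simp add: empirical_second_moment_def gram_def)

lemma invertible_empirical_second_moment_iff:
  assumes "0 < n"
  shows "invertible (empirical_second_moment n xs) \<longleftrightarrow> invertible (gram {1..n} xs)"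
proof
  assume "invertible (empirical_second_moment n xs)"
  then have "invertible (real n *\<^sub>R empirical_second_moment n xs)"
    using assms by (intro scalar_invertible) auto
  then show "invertible (gram {1..n} xs)" using assms by (simp add: empirical_second_moment_eq)
qed (use assms in \<open>auto simp: empirical_second_moment_eq intro!: scalar_invertible\<close>)

lemma log_loss_smp:
  assumes n: "0 < n" and inv: "invertible (gram {1..n} xs)"
  shows "log_loss (smp n xs ys) x y = ln (1 + leverage {1..n} xs x) +
           ((y - lsq {1..n} xs ys \<bullet> x) / (1 + leverage {1..n} xs x))\<^sup>2 / 2"
proof -
  have "least_squares n xs ys = lsq {1..n} xs ys"
    using n inv by (simp add: least_squares_def lsq_def empirical_second_moment_eq matrix_inv_scaleR
        scaleR_matrix_vector_assoc[symmetric] matrix_vector_mult_scaleR)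
  moreover have "real n *\<^sub>R empirical_second_moment n xs = gram {1..n} xs"
    using n by (simp add: empirical_second_moment_eq)
  moreover have "0 < 1 + leverage {1..n} xs x" using leverage_nonneg[OF inv, of x] by linarith
  ultimately show ?thesis
    by (simp add: log_loss_def smp_def leverage_def[symmetric] neg_ln_gaussian_density)
qed

text \<open>\<open>ln (1 + u) \<le> u = u / (1 + u) + u\<^sup>2 / (1 + u)\<close>: the first term has expectation at most
  \<open>d / n\<close> by exchangeability, the second is at most \<open>min (u\<^sup>2) u\<close>.\<close>
lemma (in regression_pair) expected_loss_le:
  fixes I :: "'i set"
  assumes I: "finite I" "I \<noteq> {}" "j \<notin> I"
    and inv: "AE z in PiM I (\<lambda>_. \<mu>). invertible (gram I (\<lambda>i. X (z i)))"
    and Q: "0 < Q" "(\<integral>\<^sup>+z. (\<integral>\<^sup>+b. ennreal ((lev I z b)\<^sup>2) \<partial>\<mu>) \<partial>PiM I (\<lambda>_. \<mu>)) \<le> ennreal Q"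
    and B: "Q \<le> B \<or> sqrt Q \<le> B"
  shows "(\<integral>\<^sup>+z. (\<integral>\<^sup>+b. ennreal (ln (1 + lev I z b) + (resid I z b / (1 + lev I z b))\<^sup>2 / 2) \<partial>\<mu>) \<partial>PiM I (\<lambda>_. \<mu>))
     \<le> ennreal (real CARD('n) / card I + B) + ennreal (1 / 2) * (\<integral>\<^sup>+b. ennreal ((Y b - \<theta> \<bullet> X b)\<^sup>2) \<partial>\<mu>)"
proof -
  let ?P = "PiM I (\<lambda>_. \<mu>)"
  interpret P: prob_space ?P by (intro prob_space_PiM prob_space_axioms)
  have n: "0 < real (card I)" using I by (simp add: card_gt_0_iff)
  have B0: "0 < B" using B Q(1) real_sqrt_gt_zero[OF Q(1)] by linarith
  define u where "u = (\<lambda>z b. lev I z b)"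
  have [measurable]: "(\<lambda>(z, b). u z b) \<in> borel_measurable (?P \<Otimes>\<^sub>M \<mu>)" unfolding u_def by measurable
  have [measurable]: "(\<lambda>(z, b). resid I z b) \<in> borel_measurable (?P \<Otimes>\<^sub>M \<mu>)" by measurable
  have rest: "(\<integral>\<^sup>+z. (\<integral>\<^sup>+b. ennreal ((u z b)\<^sup>2 / (1 + u z b)) \<partial>\<mu>) \<partial>?P) \<le> ennreal B"
    using B
  proof
    assume "Q \<le> B"
    have "(\<integral>\<^sup>+z. (\<integral>\<^sup>+b. ennreal ((u z b)\<^sup>2 / (1 + u z b)) \<partial>\<mu>) \<partial>?P) \<le> (\<integral>\<^sup>+z. (\<integral>\<^sup>+b. ennreal ((u z b)\<^sup>2) \<partial>\<mu>) \<partial>?P)"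
    proof (rule nn_integral_mono_AE, rule eventually_mono[OF inv], intro nn_integral_mono ennreal_leI)
      fix z b assume "invertible (gram I (\<lambda>i. X (z i)))"
      then have "0 \<le> u z b" by (simp add: u_def leverage_nonneg)
      then show "(u z b)\<^sup>2 / (1 + u z b) \<le> (u z b)\<^sup>2" by (simp add: divide_le_eq mult_left_mono algebra_simps)
    qed
    also have "\<dots> \<le> ennreal Q" using Q(2) by (simp add: u_def)
    also have "\<dots> \<le> ennreal B" using \<open>Q \<le> B\<close> by (rule ennreal_leI)
    finally show ?thesis .
  next
    assume "sqrt Q \<le> B"
    \<comment> \<open>Integrating the pointwise bound
      \<open>u \<le> u\<^sup>2 / (2 * s) + s / 2\<close> gives \<open>sqrt Q\<close>: this is
      Cauchy-Schwarz for the iterated integral.\<close>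
    define s where "s = sqrt Q"
    have s: "0 < s" "s * s = Q" using Q by (auto simp: s_def)
    have "(\<integral>\<^sup>+z. (\<integral>\<^sup>+b. ennreal ((u z b)\<^sup>2 / (1 + u z b)) \<partial>\<mu>) \<partial>?P)
        \<le> (\<integral>\<^sup>+z. (\<integral>\<^sup>+b. ennreal (1 / (2 * s)) * ennreal ((u z b)\<^sup>2) + ennreal (s / 2) \<partial>\<mu>) \<partial>?P)"
    proof (rule nn_integral_mono_AE, rule eventually_mono[OF inv], intro nn_integral_mono)
      fix z b assume "invertible (gram I (\<lambda>i. X (z i)))"
      then have u: "0 \<le> u z b" by (simp add: u_def leverage_nonneg)
      then have "(u z b)\<^sup>2 / (1 + u z b) \<le> u z b" by (simp add: divide_le_eq power2_eq_square algebra_simps)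
      also have "u z b \<le> 1 / (2 * s) * (u z b)\<^sup>2 + s / 2"
      proof -
        have "0 \<le> (u z b - s)\<^sup>2 / (2 * s)" using s by simp
        also have "\<dots> = 1 / (2 * s) * (u z b)\<^sup>2 + s / 2 - u z b"
          using s(1) by (simp add: power2_eq_square field_simps)
        finally show ?thesis by simp
      qed
      finally have "ennreal ((u z b)\<^sup>2 / (1 + u z b)) \<le> ennreal (1 / (2 * s) * (u z b)\<^sup>2 + s / 2)" by (rule ennreal_leI)
      also have "\<dots> = ennreal (1 / (2 * s)) * ennreal ((u z b)\<^sup>2) + ennreal (s / 2)"
        using s(1) by (subst ennreal_plus) (auto simp: ennreal_mult[symmetric])
      finally show "ennreal ((u z b)\<^sup>2 / (1 + u z b)) \<le> ennreal (1 / (2 * s)) * ennreal ((u z b)\<^sup>2) + ennreal (s / 2)" .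
    qed
    also have "\<dots> = (\<integral>\<^sup>+z. ennreal (1 / (2 * s)) * (\<integral>\<^sup>+b. ennreal ((u z b)\<^sup>2) \<partial>\<mu>) + ennreal (s / 2) \<partial>?P)"
    proof (intro nn_integral_cong)
      fix z assume z[measurable]: "z \<in> space ?P"
      have [measurable]: "(\<lambda>b. u z b) \<in> borel_measurable \<mu>" unfolding u_def by measurable
      show "(\<integral>\<^sup>+b. ennreal (1 / (2 * s)) * ennreal ((u z b)\<^sup>2) + ennreal (s / 2) \<partial>\<mu>)
          = ennreal (1 / (2 * s)) * (\<integral>\<^sup>+b. ennreal ((u z b)\<^sup>2) \<partial>\<mu>) + ennreal (s / 2)"
        by (subst nn_integral_add) (auto simp: nn_integral_cmult emeasure_space_1)
    qed
    also have "\<dots> = ennreal (1 / (2 * s)) * (\<integral>\<^sup>+z. (\<integral>\<^sup>+b. ennreal ((u z b)\<^sup>2) \<partial>\<mu>) \<partial>?P) + ennreal (s / 2)"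
      by (subst nn_integral_add) (auto simp: nn_integral_cmult P.emeasure_space_1)
    also have "\<dots> \<le> ennreal (1 / (2 * s)) * ennreal Q + ennreal (s / 2)"
      using Q(2) by (intro add_mono mult_left_mono) (auto simp: u_def)
    also have "\<dots> = ennreal (1 / (2 * s) * Q + s / 2)"
      using s(1) Q(1) by (subst ennreal_plus) (auto simp: ennreal_mult[symmetric])
    also have "1 / (2 * s) * Q + s / 2 = s" using s(1) by (simp add: s(2)[symmetric])
    also have "ennreal s \<le> ennreal B" using \<open>sqrt Q \<le> B\<close> by (intro ennreal_leI) (simp add: s_def)
    finally show ?thesis .
  qed
  have "(\<integral>\<^sup>+z. (\<integral>\<^sup>+b. ennreal (ln (1 + lev I z b) + (resid I z b / (1 + lev I z b))\<^sup>2 / 2) \<partial>\<mu>) \<partial>?P)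
      \<le> (\<integral>\<^sup>+z. (\<integral>\<^sup>+b. ennreal (u z b / (1 + u z b)) + (ennreal ((u z b)\<^sup>2 / (1 + u z b))
           + ennreal (1 / 2) * ennreal ((resid I z b / (1 + u z b))\<^sup>2)) \<partial>\<mu>) \<partial>?P)"
  proof (rule nn_integral_mono_AE, rule eventually_mono[OF inv], intro nn_integral_mono)
    fix z b assume "invertible (gram I (\<lambda>i. X (z i)))"
    then have u: "0 \<le> u z b" by (simp add: u_def leverage_nonneg)
    define q where "q = (resid I z b / (1 + u z b))\<^sup>2"
    have q: "0 \<le> q" by (simp add: q_def)
    have "ln (1 + u z b) \<le> u z b" using u by (rule ln_add_one_self_le_self)
    also have "u z b = u z b / (1 + u z b) + (u z b)\<^sup>2 / (1 + u z b)"
      using u by (simp add: add_divide_distrib[symmetric] eq_divide_eq power2_eq_square algebra_simps)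
    finally have "ennreal (ln (1 + u z b) + q / 2) \<le> ennreal (u z b / (1 + u z b) + ((u z b)\<^sup>2 / (1 + u z b) + 1 / 2 * q))"
      by (intro ennreal_leI) simp
    also have "\<dots> = ennreal (u z b / (1 + u z b)) + (ennreal ((u z b)\<^sup>2 / (1 + u z b)) + ennreal (1 / 2) * ennreal q)"
      using u q by (subst ennreal_plus, simp, simp, subst ennreal_plus, simp, simp, subst ennreal_mult) auto
    finally show "ennreal (ln (1 + lev I z b) + (resid I z b / (1 + lev I z b))\<^sup>2 / 2)
        \<le> ennreal (u z b / (1 + u z b)) + (ennreal ((u z b)\<^sup>2 / (1 + u z b))
           + ennreal (1 / 2) * ennreal ((resid I z b / (1 + u z b))\<^sup>2))" by (simp add: q_def u_def)
  qed
  also have "\<dots> = (\<integral>\<^sup>+z. (\<integral>\<^sup>+b. ennreal (u z b / (1 + u z b)) \<partial>\<mu>) + ((\<integral>\<^sup>+b. ennreal ((u z b)\<^sup>2 / (1 + u z b)) \<partial>\<mu>)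
           + ennreal (1 / 2) * (\<integral>\<^sup>+b. ennreal ((resid I z b / (1 + u z b))\<^sup>2) \<partial>\<mu>)) \<partial>?P)"
  proof (intro nn_integral_cong)
    fix z assume z[measurable]: "z \<in> space ?P"
    have [measurable]: "(\<lambda>b. u z b) \<in> borel_measurable \<mu>" unfolding u_def by measurable
    have [measurable]: "(\<lambda>b. resid I z b) \<in> borel_measurable \<mu>" by measurable
    show "(\<integral>\<^sup>+b. ennreal (u z b / (1 + u z b)) + (ennreal ((u z b)\<^sup>2 / (1 + u z b))
           + ennreal (1 / 2) * ennreal ((resid I z b / (1 + u z b))\<^sup>2)) \<partial>\<mu>)
        = (\<integral>\<^sup>+b. ennreal (u z b / (1 + u z b)) \<partial>\<mu>) + ((\<integral>\<^sup>+b. ennreal ((u z b)\<^sup>2 / (1 + u z b)) \<partial>\<mu>)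
           + ennreal (1 / 2) * (\<integral>\<^sup>+b. ennreal ((resid I z b / (1 + u z b))\<^sup>2) \<partial>\<mu>))"
      by (simp add: nn_integral_add nn_integral_cmult del: ennreal_half)
  qed
  also have "\<dots> = (\<integral>\<^sup>+z. (\<integral>\<^sup>+b. ennreal (u z b / (1 + u z b)) \<partial>\<mu>) \<partial>?P) +
      ((\<integral>\<^sup>+z. (\<integral>\<^sup>+b. ennreal ((u z b)\<^sup>2 / (1 + u z b)) \<partial>\<mu>) \<partial>?P)
        + ennreal (1 / 2) * (\<integral>\<^sup>+z. (\<integral>\<^sup>+b. ennreal ((resid I z b / (1 + u z b))\<^sup>2) \<partial>\<mu>) \<partial>?P))"
    by (simp add: nn_integral_add nn_integral_cmult del: ennreal_half)
  also have "\<dots> \<le> ennreal (real CARD('n) / card I) + (ennreal B + ennreal (1 / 2) * (\<integral>\<^sup>+b. ennreal ((Y b - \<theta> \<bullet> X b)\<^sup>2) \<partial>\<mu>))"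
  proof (intro add_mono rest mult_left_mono)
    have "(\<integral>\<^sup>+z. (\<integral>\<^sup>+b. ennreal (u z b / (1 + u z b)) \<partial>\<mu>) \<partial>?P) = ennreal (real CARD('n) / (real (card I) + 1))"
      unfolding u_def by (rule expected_lev_ratio[OF I(1,3) inv])
    also have "\<dots> \<le> ennreal (real CARD('n) / card I)"
      using n by (intro ennreal_leI divide_left_mono) auto
    finally show "(\<integral>\<^sup>+z. (\<integral>\<^sup>+b. ennreal (u z b / (1 + u z b)) \<partial>\<mu>) \<partial>?P) \<le> ennreal (real CARD('n) / card I)" .
    show "(\<integral>\<^sup>+z. (\<integral>\<^sup>+b. ennreal ((resid I z b / (1 + u z b))\<^sup>2) \<partial>\<mu>) \<partial>?P) \<le> (\<integral>\<^sup>+b. ennreal ((Y b - \<theta> \<bullet> X b)\<^sup>2) \<partial>\<mu>)"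
      unfolding u_def by (rule expected_resid_ratio[OF I(1,3) inv])
  qed simp
  also have "\<dots> = ennreal (real CARD('n) / card I + B) + ennreal (1 / 2) * (\<integral>\<^sup>+b. ennreal ((Y b - \<theta> \<bullet> X b)\<^sup>2) \<partial>\<mu>)"
    using B0 by (simp add: add.assoc del: ennreal_half)
  finally show ?thesis .
qed

text \<open>The integrability conjuncts guarantee that the risks and the expectation are genuine,
  since the Bochner integral of a nonintegrable function is 0.\<close>

theorem corollary1:
  fixes M :: "'a measure"
    and X :: "'a \<Rightarrow> real ^ 'd" and Y :: "'a \<Rightarrow> real"
    and Xs :: "nat \<Rightarrow> 'a \<Rightarrow> real ^ 'd" and Ys :: "nat \<Rightarrow> 'a \<Rightarrow> real"
    and n :: nat and C \<alpha> \<kappa> :: real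
  defines "\<Sigma> \<equiv> second_moment M X"
    and "f \<equiv> (\<lambda>\<omega>. smp n (\<lambda>i. Xs i \<omega>) (\<lambda>i. Ys i \<omega>))"
  assumes "prob_space M"
    and indep: "prob_space.indep_vars M (\<lambda>_. borel)
          (\<lambda>i \<omega>. if i = 0 then (X \<omega>, Y \<omega>) else (Xs i \<omega>, Ys i \<omega>)) {0..n}"
    and ident: "\<And>i. i \<in> {1..n} \<Longrightarrow>
          distr M borel (\<lambda>\<omega>. (Xs i \<omega>, Ys i \<omega>)) = distr M borel (\<lambda>\<omega>. (X \<omega>, Y \<omega>))"
    and "integrable M (\<lambda>\<omega>. (norm (X \<omega>))\<^sup>2)"
    and "integrable M (\<lambda>\<omega>. (Y \<omega>)\<^sup>2)"
    and "invertible \<Sigma>"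
    and "AE \<omega> in M. invertible (empirical_second_moment n (\<lambda>i. Xs i \<omega>))"
    and "C \<ge> 1" and "0 < \<alpha>" and "\<alpha> < 1"
    and small_ball: "\<And>H t. linear_hyperplane H \<Longrightarrow> t > 0 \<Longrightarrow>
          measure M {\<omega> \<in> space M. infdist (matrix_inv_sqrt \<Sigma> *v X \<omega>) H \<le> t} \<le> (C * t) powr \<alpha>"
    and "\<kappa> \<ge> 1"
    and "integrable M (\<lambda>\<omega>. (norm (matrix_inv_sqrt \<Sigma> *v X \<omega>)) ^ 4)"
    and "(\<integral>\<omega>. (norm (matrix_inv_sqrt \<Sigma> *v X \<omega>)) ^ 4 \<partial>M) \<le> \<kappa> * (real CARD('d))\<^sup>2"
    and "real n \<ge> max (6 * real CARD('d) / \<alpha>) (12 * ln (12 / \<alpha>) / \<alpha>)"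
  shows "(\<forall>\<theta>. integrable M (\<lambda>\<omega>. log_loss (linear_model \<theta>) (X \<omega>) (Y \<omega>))) \<and>
    (AE \<omega> in M. integrable M (\<lambda>\<omega>'. log_loss (f \<omega>) (X \<omega>') (Y \<omega>'))) \<and>
    integrable M (\<lambda>\<omega>. excess_risk M X Y (f \<omega>)) \<and>
    (\<integral>\<omega>. excess_risk M X Y (f \<omega>) \<partial>M)
      \<le> real CARD('d) / real n *
         (1 + (28 * C ^ 4 * exp (1 + 9 / \<alpha>)) * (\<kappa> * real CARD('d) / real n))"
proof -
  note One_nat_def [simp del]
  interpret prob_space M by (rule \<open>prob_space M\<close>)
  let ?d = "real CARD('d)"
  let ?W = "matrix_inv_sqrt \<Sigma>"
  define r where "r = ?d / real n"
  define Z where "Z = (\<lambda>i \<omega>. if i = 0 then (X \<omega>, Y \<omega>) else (Xs i \<omega>, Ys i \<omega>))"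
  define \<mu> where "\<mu> = distr M borel (\<lambda>\<omega>. (X \<omega>, Y \<omega>))"
  define P where "P = PiM {1..n} (\<lambda>_. \<mu>)"
  define \<Phi> where "\<Phi> = (\<lambda>\<omega>. \<lambda>i\<in>{1..n}. Z i \<omega>)"
  define K where "K = 1024 * exp 3 * (C\<^sup>2 / \<alpha>) powr (2 + 3 * r / \<alpha>)"
  define c where "c = 28 * C ^ 4 * exp (1 + 9 / \<alpha>)"
  define loss :: "(nat \<Rightarrow> (real^'d) \<times> real) \<Rightarrow> (real^'d) \<times> real \<Rightarrow> real"
    where "loss = (\<lambda>z b. log_loss (smp n (\<lambda>i. fst (z i)) (\<lambda>i. snd (z i))) (fst b) (snd b))"
  have nbig: "6 * ?d / \<alpha> \<le> real n" "12 * ln (12 / \<alpha>) / \<alpha> \<le> real n"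
    using \<open>real n \<ge> max _ _\<close> by auto
  have \<alpha>n: "6 * ?d \<le> \<alpha> * real n" "24 \<le> \<alpha> * real n"
    using nbig sample_size_ge[of \<alpha> "real n"] \<open>0 < \<alpha>\<close> \<open>\<alpha> < 1\<close> by (auto simp: field_simps)
  have n: "0 < n"
  proof (rule ccontr)
    assume "\<not> 0 < n"
    then show False using \<alpha>n(2) by simp
  qed
  have r: "0 < r" "r \<le> \<alpha> / 6" using \<alpha>n n by (auto simp: r_def field_simps)

  \<comment> \<open>Law of the sample as a product measure\<close>
  have Z_meas: "Z i \<in> borel_measurable M" if "i \<in> {0..n}" for i
    using indep that by (auto simp: indep_vars_def Z_def)
  have XY [measurable]: "(\<lambda>\<omega>. (X \<omega>, Y \<omega>)) \<in> borel_measurable M" using Z_meas[of 0] by (simp add: Z_def)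
  have fst_snd [measurable]: "fst \<in> borel_measurable (borel :: ((real^'d) \<times> real) measure)"
    "snd \<in> borel_measurable (borel :: ((real^'d) \<times> real) measure)"
    by (intro borel_measurable_continuous_onI continuous_intros)+
  have X [measurable]: "X \<in> borel_measurable M" using measurable_compose[OF XY fst_snd(1)] by simp
  have Y [measurable]: "Y \<in> borel_measurable M" using measurable_compose[OF XY fst_snd(2)] by simp
  have sets_\<mu> [measurable_cong]: "sets \<mu> = sets borel" by (simp add: \<mu>_def)
  interpret \<mu>: prob_space \<mu> unfolding \<mu>_def by (rule prob_space_distr) (rule XY)
  interpret R: regression_pair \<mu> fst snd
    by unfold_locales (simp_all add: measurable_cong_sets[OF sets_\<mu> refl] fst_snd)
  interpret P: prob_space P unfolding P_def by (intro prob_space_PiM \<mu>.prob_space_axioms)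
  have nn_\<mu>: "(\<integral>\<^sup>+b. g b \<partial>\<mu>) = (\<integral>\<^sup>+\<omega>. g (X \<omega>, Y \<omega>) \<partial>M)" if "g \<in> borel_measurable borel" for g
    unfolding \<mu>_def using that by (intro nn_integral_distr) (simp_all add: XY)
  have \<Phi> [measurable]: "\<Phi> \<in> measurable M P"
    unfolding \<Phi>_def P_def by (intro measurable_restrict) (simp add: measurable_cong_sets[OF refl sets_\<mu>] Z_meas)
  have distr_\<Phi>: "distr M P \<Phi> = P"
  proof -
    have "indep_vars (\<lambda>_. borel) Z {0..n}" using indep unfolding Z_def .
    then have indep': "indep_vars (\<lambda>_. borel) Z {1..n}" by (rule indep_vars_subset) auto
    have rv: "\<And>i. i \<in> {1..n} \<Longrightarrow> Z i \<in> borel_measurable M" by (rule Z_meas) auto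
    have ne: "{1..n} \<noteq> {}" using n by auto
    have "distr M (PiM {1..n} (\<lambda>_. borel)) \<Phi> = PiM {1..n} (\<lambda>i. distr M borel (Z i))"
      unfolding \<Phi>_def by (rule indep_vars_iff_distr_eq_PiM'[THEN iffD1, OF ne rv indep'])
    also have "\<dots> = P"
      unfolding P_def
    proof (intro PiM_cong refl)
      fix i assume "i \<in> {1..n}"
      then show "distr M borel (Z i) = \<mu>" using ident[of i] by (simp add: Z_def \<mu>_def)
    qed
    finally have "distr M (PiM {1..n} (\<lambda>_. borel)) \<Phi> = P" .
    moreover have "sets (PiM {1..n} (\<lambda>_. borel)) = sets P"
      unfolding P_def by (intro sets_PiM_cong) (auto simp: sets_\<mu>)
    ultimately show ?thesis by (metis distr_cong)
  qed
  have \<Phi>_fst: "i \<in> {1..n} \<Longrightarrow> fst (\<Phi> \<omega> i) = Xs i \<omega>" and \<Phi>_snd: "i \<in> {1..n} \<Longrightarrow> snd (\<Phi> \<omega> i) = Ys i \<omega>" for i \<omega>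
    by (auto simp: \<Phi>_def Z_def)
  have emp_\<Phi>: "empirical_second_moment n (\<lambda>i. fst (\<Phi> \<omega> i)) = empirical_second_moment n (\<lambda>i. Xs i \<omega>)" for \<omega>
    unfolding empirical_second_moment_def by (intro arg_cong[where f="\<lambda>v. _ *\<^sub>R v"] sum.cong) (simp_all add: \<Phi>_fst)
  have ls_\<Phi>: "least_squares n (\<lambda>i. fst (\<Phi> \<omega> i)) (\<lambda>i. snd (\<Phi> \<omega> i)) = least_squares n (\<lambda>i. Xs i \<omega>) (\<lambda>i. Ys i \<omega>)" for \<omega>
  proof -
    have "(\<Sum>i=1..n. snd (\<Phi> \<omega> i) *\<^sub>R fst (\<Phi> \<omega> i)) = (\<Sum>i=1..n. Ys i \<omega> *\<^sub>R Xs i \<omega>)"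
      by (intro sum.cong) (simp_all add: \<Phi>_fst \<Phi>_snd)
    then show ?thesis by (simp add: least_squares_def emp_\<Phi>)
  qed
  have f_\<Phi>: "log_loss (f \<omega>) (fst b) (snd b) = loss (\<Phi> \<omega>) b" for \<omega> b
    by (simp add: f_def loss_def log_loss_def smp_def emp_\<Phi> ls_\<Phi>)

  have inv: "AE z in P. invertible (gram {1..n} (\<lambda>i. fst (z i)))"
  proof -
    have "AE \<omega> in M. invertible (gram {1..n} (\<lambda>i. fst (\<Phi> \<omega> i)))"
      using \<open>AE \<omega> in M. invertible (empirical_second_moment n (\<lambda>i. Xs i \<omega>))\<close>
      by eventually_elim (simp only: invertible_empirical_second_moment_iff[OF n, symmetric] emp_\<Phi>)
    \<comment> \<open>Writing invertibility as a nonzero determinant makes the event measurable, so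
      that the almost sure statement can be moved to the law \<open>P\<close>.\<close>
    moreover have "{z \<in> space P. invertible (gram {1..n} (\<lambda>i. fst (z i)))} \<in> sets P"
      unfolding invertible_det_nz P_def by measurable
    ultimately have "AE z in distr M P \<Phi>. invertible (gram {1..n} (\<lambda>i. fst (z i)))"
      by (subst AE_distr_iff) auto
    then show ?thesis unfolding distr_\<Phi> .
  qed

  \<comment> \<open>Whitening and the small ball condition\<close>
  have psd: "pos_semidef \<Sigma>" unfolding \<Sigma>_def by (rule pos_semidef_second_moment[OF X]) fact
  note W = matrix_inv_sqrt[OF psd \<open>invertible \<Sigma>\<close>]
  have W_meas [measurable]: "(\<lambda>b. ?W *v fst b) \<in> borel_measurable \<mu>" by measurable
  interpret B: small_ball_sample \<mu> "\<lambda>b. ?W *v fst b" C \<alpha> "{1..n}"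
  proof unfold_locales
    fix \<theta> :: "real^'d" and t :: real assume \<theta>: "\<theta> \<noteq> 0" and t: "0 < t"
    have "{b \<in> space \<mu>. \<bar>(?W *v fst b) \<bullet> \<theta>\<bar> \<le> t * norm \<theta>} \<in> sets borel"
      unfolding sets_\<mu>[symmetric] by measurable
    then have "measure \<mu> {b \<in> space \<mu>. \<bar>(?W *v fst b) \<bullet> \<theta>\<bar> \<le> t * norm \<theta>} =
        measure M {\<omega> \<in> space M. \<bar>(?W *v X \<omega>) \<bullet> \<theta>\<bar> \<le> t * norm \<theta>}"
      unfolding \<mu>_def by (subst measure_distr) (auto intro!: arg_cong[where f="measure M"] XY)
    also have "\<dots> \<le> measure M {\<omega> \<in> space M. infdist (?W *v X \<omega>) {y. \<theta> \<bullet> y = 0} \<le> t}"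
    proof (rule finite_measure_mono)
      have "(\<lambda>y. infdist y {y. \<theta> \<bullet> y = 0}) \<in> borel_measurable borel"
        by (intro borel_measurable_continuous_onI continuous_on_infdist continuous_on_id)
      then show "{\<omega> \<in> space M. infdist (?W *v X \<omega>) {y. \<theta> \<bullet> y = 0} \<le> t} \<in> sets M" by measurable
      have "infdist y {y. \<theta> \<bullet> y = 0} \<le> t" if "\<bar>y \<bullet> \<theta>\<bar> \<le> t * norm \<theta>" for y
      proof -
        have "\<bar>y \<bullet> \<theta>\<bar> / norm \<theta> \<le> t" using that \<theta> by (simp add: field_simps)
        then show ?thesis using infdist_hyperplane_le[OF \<theta>, of y] by linarith
      qed
      then show "{\<omega> \<in> space M. \<bar>(?W *v X \<omega>) \<bullet> \<theta>\<bar> \<le> t * norm \<theta>}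
          \<subseteq> {\<omega> \<in> space M. infdist (?W *v X \<omega>) {y. \<theta> \<bullet> y = 0} \<le> t}" by auto
    qed
    also have "\<dots> \<le> (C * t) powr \<alpha>" by (rule small_ball[OF linear_hyperplane_orthogonal[OF \<theta>] t])
    finally show "measure \<mu> {b \<in> space \<mu>. \<bar>(?W *v fst b) \<bullet> \<theta>\<bar> \<le> t * norm \<theta>} \<le> (C * t) powr \<alpha>" .
  qed (use \<open>C \<ge> 1\<close> \<open>0 < \<alpha>\<close> \<open>\<alpha> < 1\<close> in auto)
  have Bp: "B.p = \<alpha> * real n" unfolding B.p_def by simp

  \<comment> \<open>Second moment of the leverage at a random test point\<close>
  have lev_W: "leverage {1..n} (\<lambda>i. ?W *v fst (z i)) (?W *v x) = leverage {1..n} (\<lambda>i. fst (z i)) x"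
    if "invertible (gram {1..n} (\<lambda>i. fst (z i)))" for z x
    by (rule leverage_linear_image[OF W(1,2) that])
  have inv_W: "AE z in P. invertible (gram {1..n} (\<lambda>i. ?W *v fst (z i)))"
    using inv by eventually_elim (auto simp: gram_linear_image[OF W(1)] intro!: invertible_mult W(2))
  have second: "(\<integral>\<^sup>+b. ennreal ((norm (?W *v fst b))\<^sup>2) \<partial>\<mu>) \<le> ennreal ?d"
  proof -
    note wn = whitened_norm_expectation[OF X _ \<open>invertible \<Sigma>\<close>[unfolded \<Sigma>_def], folded \<Sigma>_def]
    have "(\<integral>\<^sup>+b. ennreal ((norm (?W *v fst b))\<^sup>2) \<partial>\<mu>) = (\<integral>\<^sup>+\<omega>. ennreal ((norm (?W *v X \<omega>))\<^sup>2) \<partial>M)"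
      by (subst nn_\<mu>) auto
    also have "\<dots> = ennreal (\<integral>\<omega>. (norm (?W *v X \<omega>))\<^sup>2 \<partial>M)"
      by (intro nn_integral_eq_integral wn) (use assms in auto)
    also have "(\<integral>\<omega>. (norm (?W *v X \<omega>))\<^sup>2 \<partial>M) = ?d" by (rule wn) fact
    finally show ?thesis by simp
  qed
  \<comment> \<open>At a fixed test point the second moment of the leverage is at most
    \<open>K / n\<^sup>2\<close> times a fourth power of the whitened norm; averaging over the test
    point contributes \<open>\<kappa> * d\<^sup>2\<close>.\<close>
  define Q where "Q = K * \<kappa> * r\<^sup>2"
  have K: "0 < K" using \<open>C \<ge> 1\<close> \<open>0 < \<alpha>\<close> by (simp add: K_def)
  have Q: "0 < Q" using K \<open>\<kappa> \<ge> 1\<close> r by (simp add: Q_def)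
  have lev2: "(\<integral>\<^sup>+z. (\<integral>\<^sup>+b. ennreal ((R.lev {1..n} z b)\<^sup>2) \<partial>\<mu>) \<partial>P) \<le> ennreal Q"
  proof -
    interpret PM: pair_sigma_finite P \<mu>
      by (simp add: pair_sigma_finite_def P.sigma_finite_measure_axioms \<mu>.sigma_finite_measure_axioms)
    have "(\<integral>\<^sup>+z. (\<integral>\<^sup>+b. ennreal ((R.lev {1..n} z b)\<^sup>2) \<partial>\<mu>) \<partial>P) = (\<integral>\<^sup>+b. (\<integral>\<^sup>+z. ennreal ((R.lev {1..n} z b)\<^sup>2) \<partial>P) \<partial>\<mu>)"
      by (rule PM.Fubini'[symmetric]) (unfold P_def, measurable)
    also have "\<dots> \<le> (\<integral>\<^sup>+b. ennreal (K / (real n)\<^sup>2) * ennreal (norm (?W *v fst b) ^ 4) \<partial>\<mu>)"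
    proof (intro nn_integral_mono)
      fix b
      have "(\<integral>\<^sup>+z. ennreal ((R.lev {1..n} z b)\<^sup>2) \<partial>P)
          = (\<integral>\<^sup>+z. ennreal ((leverage {1..n} (\<lambda>i. ?W *v fst (z i)) (?W *v fst b))\<^sup>2) \<partial>P)"
        using inv by (intro nn_integral_cong_AE) (auto elim!: eventually_mono simp: lev_W)
      also have "\<dots> \<le> ennreal (1024 * exp 3 * (C\<^sup>2 / \<alpha>) powr (2 + 3 * ?d / B.p) * norm (?W *v fst b) ^ 4 / (real (card {1..n}))\<^sup>2)"
        using B.leverage_second_moment_le[OF inv_W[unfolded P_def] second] \<alpha>n unfolding Bp P_def by simp
      also have "1024 * exp 3 * (C\<^sup>2 / \<alpha>) powr (2 + 3 * ?d / B.p) * norm (?W *v fst b) ^ 4 / (real (card {1..n}))\<^sup>2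
          = K / (real n)\<^sup>2 * norm (?W *v fst b) ^ 4"
        by (simp add: K_def Bp r_def mult.commute)
      also have "ennreal \<dots> = ennreal (K / (real n)\<^sup>2) * ennreal (norm (?W *v fst b) ^ 4)"
        using K by (subst ennreal_mult) auto
      finally show "(\<integral>\<^sup>+z. ennreal ((R.lev {1..n} z b)\<^sup>2) \<partial>P) \<le> ennreal (K / (real n)\<^sup>2) * ennreal (norm (?W *v fst b) ^ 4)" .
    qed
    also have "\<dots> = ennreal (K / (real n)\<^sup>2) * (\<integral>\<^sup>+b. ennreal (norm (?W *v fst b) ^ 4) \<partial>\<mu>)"
      by (rule nn_integral_cmult) measurable
    also have "(\<integral>\<^sup>+b. ennreal (norm (?W *v fst b) ^ 4) \<partial>\<mu>) = (\<integral>\<^sup>+\<omega>. ennreal (norm (?W *v X \<omega>) ^ 4) \<partial>M)"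
      by (subst nn_\<mu>) auto
    also have "\<dots> = ennreal (\<integral>\<omega>. norm (?W *v X \<omega>) ^ 4 \<partial>M)"
      by (intro nn_integral_eq_integral) (use assms in auto)
    also have "\<dots> \<le> ennreal (\<kappa> * ?d\<^sup>2)" by (intro ennreal_leI) fact
    also have "ennreal (K / (real n)\<^sup>2) * ennreal (\<kappa> * ?d\<^sup>2) = ennreal Q"
      using K \<open>\<kappa> \<ge> 1\<close> by (simp add: ennreal_mult[symmetric] Q_def r_def power_divide mult_ac)
    finally show ?thesis by (simp add: mult_left_mono)
  qed
  define E where "E = c * \<kappa> * r\<^sup>2"
  have c: "0 < c" using \<open>C \<ge> 1\<close> by (simp add: c_def)
  have E: "0 \<le> E" using c \<open>\<kappa> \<ge> 1\<close> by (simp add: E_def)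
  \<comment> \<open>The two alternatives of \<open>constant_bound\<close>, scaled by
    \<open>\<kappa> * r\<^sup>2\<close>; in the second one \<open>\<kappa> \<ge> 1\<close> lets
    \<open>\<kappa>\<close> replace its root.\<close>
  have QE: "Q \<le> E \<or> sqrt Q \<le> E"
  proof -
    have "K \<le> c \<or> sqrt K \<le> c * r"
      unfolding K_def c_def using \<open>C \<ge> 1\<close> \<open>0 < \<alpha>\<close> \<open>\<alpha> < 1\<close> r by (intro constant_bound) auto
    then show ?thesis
    proof
      assume "K \<le> c"
      then have "Q \<le> E" unfolding Q_def E_def using \<open>\<kappa> \<ge> 1\<close> by (intro mult_right_mono) auto
      then show ?thesis ..
    next
      assume *: "sqrt K \<le> c * r"
      have "sqrt \<kappa> \<le> \<kappa>" using \<open>\<kappa> \<ge> 1\<close> by (simp add: real_le_lsqrt power2_eq_square)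
      then have "sqrt K * sqrt \<kappa> * r \<le> (c * r) * \<kappa> * r"
        using * r c K \<open>\<kappa> \<ge> 1\<close> by (intro mult_right_mono mult_mono) auto
      then have "sqrt Q \<le> E" using r by (simp add: Q_def E_def real_sqrt_mult power2_eq_square mult_ac)
      then show ?thesis ..
    qed
  qed

  \<comment> \<open>Risks of the linear family\<close>
  have lin_int: "integrable M (\<lambda>\<omega>. log_loss (linear_model \<theta>) (X \<omega>) (Y \<omega>))" for \<theta>
  proof (rule Bochner_Integration.integrable_bound)
    show "integrable M (\<lambda>\<omega>. (Y \<omega>)\<^sup>2 + (norm \<theta>)\<^sup>2 * (norm (X \<omega>))\<^sup>2)"
      using assms by (intro Bochner_Integration.integrable_add integrable_mult_right) auto
    show "AE \<omega> in M. norm (log_loss (linear_model \<theta>) (X \<omega>) (Y \<omega>)) \<le> norm ((Y \<omega>)\<^sup>2 + (norm \<theta>)\<^sup>2 * (norm (X \<omega>))\<^sup>2)"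
    proof (rule AE_I2)
      fix \<omega>
      have "(\<theta> \<bullet> X \<omega>)\<^sup>2 \<le> (norm \<theta> * norm (X \<omega>))\<^sup>2"
        using Cauchy_Schwarz_ineq2[of \<theta> "X \<omega>"] by (simp add: abs_le_square_iff[symmetric])
      moreover have "(Y \<omega> - \<theta> \<bullet> X \<omega>)\<^sup>2 \<le> 2 * (Y \<omega>)\<^sup>2 + 2 * (\<theta> \<bullet> X \<omega>)\<^sup>2"
        using zero_le_power2[of "Y \<omega> + \<theta> \<bullet> X \<omega>"] by (simp add: power2_eq_square algebra_simps)
      ultimately show "norm (log_loss (linear_model \<theta>) (X \<omega>) (Y \<omega>)) \<le> norm ((Y \<omega>)\<^sup>2 + (norm \<theta>)\<^sup>2 * (norm (X \<omega>))\<^sup>2)"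
        by (simp add: log_loss_linear_model power_mult_distrib)
    qed
  qed (unfold log_loss_linear_model, measurable)
  have risk0: "0 \<le> risk M X Y (linear_model \<theta>)" for \<theta>
    unfolding risk_def by (simp add: log_loss_linear_model)
  have half_sq: "ennreal (1 / 2) * (\<integral>\<^sup>+b. ennreal ((snd b - \<theta> \<bullet> fst b)\<^sup>2) \<partial>\<mu>) = ennreal (risk M X Y (linear_model \<theta>))" for \<theta>
  proof -
    have "ennreal (risk M X Y (linear_model \<theta>)) = (\<integral>\<^sup>+\<omega>. ennreal ((Y \<omega> - \<theta> \<bullet> X \<omega>)\<^sup>2 / 2) \<partial>M)"
      unfolding risk_def using lin_int[of \<theta>]
      by (subst nn_integral_eq_integral[symmetric]) (auto simp: log_loss_linear_model)
    also have "\<dots> = (\<integral>\<^sup>+\<omega>. ennreal (1 / 2) * ennreal ((Y \<omega> - \<theta> \<bullet> X \<omega>)\<^sup>2) \<partial>M)"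
      by (intro nn_integral_cong) (subst ennreal_mult[symmetric], auto simp del: ennreal_half)
    also have "\<dots> = ennreal (1 / 2) * (\<integral>\<^sup>+\<omega>. ennreal ((Y \<omega> - \<theta> \<bullet> X \<omega>)\<^sup>2) \<partial>M)"
      by (rule nn_integral_cmult) measurable
    finally show ?thesis by (subst nn_\<mu>) auto
  qed

  \<comment> \<open>Expected loss of the predictor over sample and test point\<close>
  have loss_meas: "(\<lambda>(z, b). loss z b) \<in> borel_measurable (P \<Otimes>\<^sub>M \<mu>)"
    unfolding loss_def log_loss_def smp_def gaussian_density_def normal_density_def least_squares_def
      empirical_second_moment_def P_def by measurable
  have loss_eq: "loss z b = ln (1 + R.lev {1..n} z b) + (R.resid {1..n} z b / (1 + R.lev {1..n} z b))\<^sup>2 / 2"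
    if "invertible (gram {1..n} (\<lambda>i. fst (z i)))" for z b
    unfolding loss_def by (rule log_loss_smp[OF n that])
  have loss_nonneg: "0 \<le> loss z b" if "invertible (gram {1..n} (\<lambda>i. fst (z i)))" for z b
    unfolding loss_eq[OF that] using leverage_nonneg[OF that, of "fst b"] by simp
  have total: "(\<integral>\<^sup>+z. (\<integral>\<^sup>+b. ennreal (loss z b) \<partial>\<mu>) \<partial>P) \<le> ennreal (r + E + risk M X Y (linear_model \<theta>))" for \<theta>
  proof -
    have "(\<integral>\<^sup>+z. (\<integral>\<^sup>+b. ennreal (loss z b) \<partial>\<mu>) \<partial>P) = (\<integral>\<^sup>+z. (\<integral>\<^sup>+b. ennreal (ln (1 + R.lev {1..n} z b)
        + (R.resid {1..n} z b / (1 + R.lev {1..n} z b))\<^sup>2 / 2) \<partial>\<mu>) \<partial>P)"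
      using inv by (intro nn_integral_cong_AE) (auto elim!: eventually_mono simp: loss_eq)
    also have "\<dots> \<le> ennreal (?d / card {1..n} + E) + ennreal (1 / 2) * (\<integral>\<^sup>+b. ennreal ((snd b - \<theta> \<bullet> fst b)\<^sup>2) \<partial>\<mu>)"
      \<comment> \<open>The index \<open>0\<close> lies outside \<open>{1..n}\<close> and is the
        slot of the test point.\<close>
      using n inv Q lev2 QE unfolding P_def by (intro R.expected_loss_le[where j=0]) auto
    also have "\<dots> = ennreal (r + E + risk M X Y (linear_model \<theta>))"
      unfolding half_sq using r E risk0[of \<theta>] by (simp add: r_def)
    finally show ?thesis .
  qed
  have fin: "AE z in P. (\<integral>\<^sup>+b. ennreal (loss z b) \<partial>\<mu>) \<noteq> \<infinity>"
  proof (rule nn_integral_PInf_AE)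
    show "(\<lambda>z. \<integral>\<^sup>+b. ennreal (loss z b) \<partial>\<mu>) \<in> borel_measurable P" using loss_meas by measurable
    show "(\<integral>\<^sup>+z. (\<integral>\<^sup>+b. ennreal (loss z b) \<partial>\<mu>) \<partial>P) \<noteq> \<infinity>"
      using total[of 0] by (auto simp: top_unique)
  qed
  have int_loss: "AE z in P. integrable \<mu> (loss z) \<and> 0 \<le> (\<integral>b. loss z b \<partial>\<mu>) \<and> ennreal (\<integral>b. loss z b \<partial>\<mu>) = (\<integral>\<^sup>+b. ennreal (loss z b) \<partial>\<mu>)"
    using fin inv AE_space
  proof eventually_elim
    case (elim z)
    have [measurable]: "loss z \<in> borel_measurable \<mu>"
      using measurable_compose[OF measurable_Pair1'[OF elim(3)] loss_meas] by simp
    have "integrable \<mu> (loss z)"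
      using elim loss_nonneg[OF elim(2)] by (intro integrableI_nonneg) (auto simp: less_top)
    with loss_nonneg[OF elim(2)] show ?case by (auto simp: nn_integral_eq_integral)
  qed
  define \<rho> where "\<rho> = (\<lambda>z. \<integral>b. loss z b \<partial>\<mu>)"
  have \<rho>_meas [measurable]: "\<rho> \<in> borel_measurable P"
    unfolding \<rho>_def using loss_meas by (rule \<mu>.borel_measurable_lebesgue_integral)
  \<comment> \<open>The norm appears because \<open>\<rho>\<close> is known to be nonnegative only
    almost surely: on singular samples \<open>matrix_inv\<close> is unspecified.\<close>
  have \<rho>_nn: "(\<integral>\<^sup>+z. ennreal (norm (\<rho> z)) \<partial>P) = (\<integral>\<^sup>+z. (\<integral>\<^sup>+b. ennreal (loss z b) \<partial>\<mu>) \<partial>P)"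
    by (rule nn_integral_cong_AE, rule eventually_mono[OF int_loss]) (simp add: \<rho>_def)
  have \<rho>_int: "integrable P \<rho>"
  proof (rule integrableI_bounded[OF \<rho>_meas])
    show "(\<integral>\<^sup>+z. ennreal (norm (\<rho> z)) \<partial>P) < \<infinity>"
      unfolding \<rho>_nn using total[of 0] by (rule order_le_less_trans) simp
  qed
  have \<rho>_le: "(\<integral>z. \<rho> z \<partial>P) \<le> r + E + risk M X Y (linear_model \<theta>)" for \<theta>
  proof -
    have "ennreal (\<integral>z. norm (\<rho> z) \<partial>P) = (\<integral>\<^sup>+z. ennreal (norm (\<rho> z)) \<partial>P)"
      using \<rho>_int by (subst nn_integral_eq_integral) auto
    also have "\<dots> \<le> ennreal (r + E + risk M X Y (linear_model \<theta>))" unfolding \<rho>_nn by (rule total)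
    finally have "(\<integral>z. norm (\<rho> z) \<partial>P) \<le> r + E + risk M X Y (linear_model \<theta>)"
      using r E risk0[of \<theta>] by (subst (asm) ennreal_le_iff) auto
    moreover have "(\<integral>z. \<rho> z \<partial>P) \<le> (\<integral>z. norm (\<rho> z) \<partial>P)" using \<rho>_int by (intro integral_mono) auto
    ultimately show ?thesis by linarith
  qed

  \<comment> \<open>Transfer to the original probability space\<close>
  define c0 where "c0 = (INF \<theta>. risk M X Y (linear_model \<theta>))"
  have loss_meas1: "loss (\<Phi> \<omega>) \<in> borel_measurable borel" if "\<omega> \<in> space M" for \<omega>
    using measurable_compose[OF measurable_Pair1'[OF measurable_space[OF \<Phi> that]] loss_meas]
    by (simp add: measurable_cong_sets[OF sets_\<mu> refl])
  have loss_f: "log_loss (f \<omega>) (X \<omega>') (Y \<omega>') = loss (\<Phi> \<omega>) (X \<omega>', Y \<omega>')" for \<omega> \<omega>'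
    using f_\<Phi>[of \<omega> "(X \<omega>', Y \<omega>')"] by simp
  \<comment> \<open>\<open>\<omega>\<close> enters only through the sample
    \<open>\<Phi> \<omega>\<close>; the test pair is integrated out under its own law
    \<open>\<mu>\<close>.\<close>
  have excess: "excess_risk M X Y (f \<omega>) = \<rho> (\<Phi> \<omega>) - c0" if "\<omega> \<in> space M" for \<omega>
    unfolding excess_risk_def risk_def c0_def \<rho>_def \<mu>_def loss_f
    using integral_distr[OF XY loss_meas1[OF that]] by simp
  have \<rho>\<Phi>_int: "integrable M (\<lambda>\<omega>. \<rho> (\<Phi> \<omega>))"
    using integrable_distr_eq[OF \<Phi> \<rho>_meas] \<rho>_int unfolding distr_\<Phi> by simp
  have \<rho>\<Phi>_eq: "(\<integral>\<omega>. \<rho> (\<Phi> \<omega>) \<partial>M) = (\<integral>z. \<rho> z \<partial>P)"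
    using integral_distr[OF \<Phi> \<rho>_meas] unfolding distr_\<Phi> by simp
  have concl2: "AE \<omega> in M. integrable M (\<lambda>\<omega>'. log_loss (f \<omega>) (X \<omega>') (Y \<omega>'))"
  proof -
    have "AE z in distr M P \<Phi>. integrable \<mu> (loss z)" 
      unfolding distr_\<Phi> by (rule eventually_mono[OF int_loss]) simp
    from AE_distrD[OF \<Phi> this] AE_space show ?thesis
    proof eventually_elim
      case (elim \<omega>)
      then show ?case
        unfolding loss_f \<mu>_def using loss_meas1[of \<omega>] by (simp add: integrable_distr_eq)
    qed
  qed
  have concl3: "integrable M (\<lambda>\<omega>. excess_risk M X Y (f \<omega>))"
    using \<rho>\<Phi>_int by (subst Bochner_Integration.integrable_cong[OF refl excess]) auto
  have "(\<integral>\<omega>. excess_risk M X Y (f \<omega>) \<partial>M) = (\<integral>\<omega>. \<rho> (\<Phi> \<omega>) - c0 \<partial>M)"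
    by (rule Bochner_Integration.integral_cong[OF refl excess])
  also have "\<dots> = (\<integral>z. \<rho> z \<partial>P) - c0" using \<rho>\<Phi>_int by (simp add: \<rho>\<Phi>_eq prob_space)
  \<comment> \<open>The bound on the mean of \<open>\<rho>\<close> holds with the same
    \<open>r + E\<close> for every \<open>\<theta>\<close>, so it passes to the infimum without a
    minimizer being exhibited.\<close>
  also have "\<dots> \<le> r + E"
  proof -
    have "(\<integral>z. \<rho> z \<partial>P) - (r + E) \<le> c0"
      unfolding c0_def
    proof (rule cINF_greatest)
      show "(\<integral>z. \<rho> z \<partial>P) - (r + E) \<le> risk M X Y (linear_model \<theta>)" for \<theta> using \<rho>_le[of \<theta>] by linarith
    qed simp
    then show ?thesis by linarith
  qed
  also have "r + E = ?d / real n * (1 + (28 * C ^ 4 * exp (1 + 9 / \<alpha>)) * (\<kappa> * ?d / real n))"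
    by (simp add: E_def r_def c_def power2_eq_square algebra_simps)
  finally show ?thesis using lin_int concl2 concl3 by blast
qed

end
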